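(* Let $R=S^G$ be the invariant subring of $S=\Bbbk[[x,y]]$ under the cyclic group $G=\frac1n(1,a)$. Let $t\in\{0,1,\dots,n-1\}$ and suppose that $M_t$ is an Ulrich module. Then $n-a\le t\le n-1$. Furthermore, $M_{n-1}$ and $M_{n-a}$ are Ulrich modules.
   Context: $\Bbbk$ is an algebraically closed field; $n,a$ are integers with $1\le a\le n-1$, $\gcd(a,n)=1$, and $n$ is invertible in $\Bbbk$. $\frac1n(1,a)$ denotes the cyclic group generated by $\sigma=\mathrm{diag}(\zeta_n,\zeta_n^a)$, $\zeta_n$ a primitive $n$-th root of unity, acting on $S=\Bbbk[[x,y]]$ by $x\mapsto\zeta_n x$, $y\mapsto\zeta_n^a y$. $R=S^G$ is a local ring with maximal ideal $\mathfrak m$. For an integer $t$, $M_t\subset S$ is the $R$-submodule generated by the monomials $x^iy^j$ with $i+ja\equiv t \pmod n$; $M_0=R$, and $M_0,\dots,M_{n-1}$ are, up to isomorphism, exactly the indecomposable maximal Cohen-Macaulay (MCM) $R$-modules, pairwise non-isomorphic and of rank one. Ulrich module: an MCM $R$-module $M$ is Ulrich if $\mu_R(M)=\mathrm{e}_{\mathfrak m}(M)$, where $\mu_R(M)=\dim_\Bbbk M/\mathfrak mM$ and $\mathrm{e}_{\mathfrak m}(M)$ is the multiplicity of $M$ with respect to $\mathfrak m$. *)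

theory Defs
  imports
    "HOL-Algebra.Bij"
    "HOL-Algebra.Generated_Groups"
    "HOL-Algebra.Ideal_Product"
    "HOL-Algebra.Algebraic_Closure_Type"
    "HOL-Library.Extended_Nat"
    "HOL-Number_Theory.Cong"
    "Jordan_Normal_Form.Missing_VectorSpace"
begin

section \<open>Commutative algebra over a local ring\<close>

definition max_ideal :: "('r, 's) ring_scheme \<Rightarrow> 'r set"
  where "max_ideal R = (THE I. maximalideal I R)"

primrec ideal_pow :: "('r, 's) ring_scheme \<Rightarrow> 'r set \<Rightarrow> nat \<Rightarrow> 'r set"
  where
    "ideal_pow R I 0 = carrier R"
  | "ideal_pow R I (Suc l) = ideal_prod R I (ideal_pow R I l)"

definition krull_dim :: "('r, 's) ring_scheme \<Rightarrow> enat"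
  where "krull_dim R =
    Sup {enat l | l. \<exists>P. (\<forall>i\<le>l. primeideal (P i) R) \<and> (\<forall>i<l. P i \<subset> P (Suc i))}"

text \<open>The multiplicative fields that a module inherits from its underlying ring record are
  meaningless for a quotient module and are left unspecified.\<close>

definition quot_module :: "('r, 'm) module \<Rightarrow> 'm set \<Rightarrow> ('r, 'm set) module"
  where "quot_module M N =
    \<lparr>carrier = a_rcosets\<^bsub>M\<^esub> N, monoid.mult = (\<lambda>_ _. undefined), monoid.one = undefined,
     ring.zero = N, ring.add = set_add M,
     module.smult = (\<lambda>r Q. \<Union>v\<in>Q. a_r_coset M N (r \<odot>\<^bsub>M\<^esub> v))\<rparr>"

definition ideal_smult :: "('r, 's) ring_scheme \<Rightarrow> 'r set \<Rightarrow> ('r, 'm) module \<Rightarrow> 'm set"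
  where "ideal_smult R I M = module.span R M {r \<odot>\<^bsub>M\<^esub> v | r v. r \<in> I \<and> v \<in> carrier M}"

definition fin_gen :: "('r, 's) ring_scheme \<Rightarrow> ('r, 'm) module \<Rightarrow> bool"
  where "fin_gen R M \<longleftrightarrow> (\<exists>A\<subseteq>carrier M. finite A \<and> module.span R M A = carrier M)"

definition module_length :: "('r, 's) ring_scheme \<Rightarrow> ('r, 'm) module \<Rightarrow> enat"
  where "module_length R M =
    Sup {enat l | l. \<exists>N. (\<forall>i\<le>l. Module.submodule (N i) R M) \<and> (\<forall>i<l. N i \<subset> N (Suc i))}"

definition nonzerodivisor_on :: "('r, 'm) module \<Rightarrow> 'r \<Rightarrow> bool"
  where "nonzerodivisor_on M r \<longleftrightarrow> (\<forall>v\<in>carrier M. r \<odot>\<^bsub>M\<^esub> v = \<zero>\<^bsub>M\<^esub> \<longrightarrow> v = \<zero>\<^bsub>M\<^esub>)"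

definition mod_out :: "('r, 's) ring_scheme \<Rightarrow> ('r, 'm) module \<Rightarrow> 'r list \<Rightarrow> ('r, 'm set) module"
  where "mod_out R M xs = quot_module M (ideal_smult R (genideal R (set xs)) M)"

definition regular_sequence :: "('r, 's) ring_scheme \<Rightarrow> ('r, 'm) module \<Rightarrow> 'r list \<Rightarrow> bool"
  where "regular_sequence R M xs \<longleftrightarrow>
    set xs \<subseteq> carrier R \<and>
    (\<forall>i<length xs. nonzerodivisor_on (mod_out R M (take i xs)) (xs ! i)) \<and>
    carrier (mod_out R M xs) \<noteq> {\<zero>\<^bsub>mod_out R M xs\<^esub>}"

definition depth :: "('r, 's) ring_scheme \<Rightarrow> ('r, 'm) module \<Rightarrow> enat"
  where "depth R M = Sup {enat (length xs) | xs. set xs \<subseteq> max_ideal R \<and> regular_sequence R M xs}"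

definition maximal_cohen_macaulay :: "('r, 's) ring_scheme \<Rightarrow> ('r, 'm) module \<Rightarrow> bool"
  where "maximal_cohen_macaulay R M \<longleftrightarrow>
    module R M \<and> fin_gen R M \<and> carrier M \<noteq> {\<zero>\<^bsub>M\<^esub>} \<and> depth R M = krull_dim R"

text \<open>The multiplicity of \<open>M\<close> with respect to the maximal ideal \<open>\<mm>\<close>, normalised by the dimension
  \<open>d\<close> of \<open>R\<close>: the limit of \<open>d! \<cdot> length (M / \<mm>\<^sup>l M) / l\<^sup>d\<close>. The lengths and \<open>d\<close> are finite for
  finitely generated modules over a Noetherian local ring.\<close>

definition multiplicity_max :: "('r, 's) ring_scheme \<Rightarrow> ('r, 'm) module \<Rightarrow> real"
  where "multiplicity_max R M =
    (let d = the_enat (krull_dim R) in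
     lim (\<lambda>l. fact d *
       real (the_enat (module_length R
         (quot_module M (ideal_smult R (ideal_pow R (max_ideal R) l) M)))) / real l ^ d))"

definition restrict_scalars :: "('k \<Rightarrow> 'r) \<Rightarrow> ('r, 'm) module \<Rightarrow> ('k, 'm) module"
  where "restrict_scalars c M =
    \<lparr>carrier = carrier M, monoid.mult = monoid.mult M, monoid.one = monoid.one M, ring.zero = ring.zero M,
     ring.add = ring.add M,
     module.smult = (\<lambda>u. module.smult M (c u))\<rparr>"

text \<open>Here \<open>c\<close> embeds the ground field into \<open>R\<close>.\<close>

definition num_generators ::
    "('k::field \<Rightarrow> 'r) \<Rightarrow> ('r, 's) ring_scheme \<Rightarrow> ('r, 'm) module \<Rightarrow> nat"
  where "num_generators c R M =
    vectorspace.dim (ring_of_type_algebra :: 'k ring)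
      (restrict_scalars c (quot_module M (ideal_smult R (max_ideal R) M)))"

definition ulrich ::
    "('k::field \<Rightarrow> 'r) \<Rightarrow> ('r, 's) ring_scheme \<Rightarrow> ('r, 'm) module \<Rightarrow> bool"
  where "ulrich c R M \<longleftrightarrow>
    maximal_cohen_macaulay R M \<and> real (num_generators c R M) = multiplicity_max R M"


section \<open>The cyclic quotient singularity\<close>

definition primitive_root_of_unity :: "nat \<Rightarrow> 'k::field \<Rightarrow> bool"
  where "primitive_root_of_unity n z \<longleftrightarrow> z ^ n = 1 \<and> (\<forall>l. 0 < l \<and> l < n \<longrightarrow> z ^ l \<noteq> 1)"

text \<open>The ring of formal power series in \<open>x\<close> and \<open>y\<close> is represented as \<open>'k fps fps\<close>, the series in
  \<open>y\<close> with coefficients in the series in \<open>x\<close>; the coefficient of \<open>x\<^sup>i y\<^sup>j\<close> in \<open>f\<close> is therefore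
  \<open>fps_nth (fps_nth f j) i\<close>.\<close>

definition var_x :: "'k::field fps fps"
  where "var_x = fps_const fps_X"

definition var_y :: "'k::field fps fps"
  where "var_y = fps_X"

definition scalar :: "'k::field \<Rightarrow> 'k fps fps"
  where "scalar u = fps_const (fps_const u)"

text \<open>The substitution \<open>f(x, y) \<mapsto> f(z x, z\<^sup>a y)\<close>, which multiplies the monomial \<open>x\<^sup>i y\<^sup>j\<close> by
  \<open>z\<^sup>i (z\<^sup>a)\<^sup>j\<close>.\<close>

definition diag_act :: "'k::field \<Rightarrow> nat \<Rightarrow> 'k fps fps \<Rightarrow> 'k fps fps"
  where "diag_act z a f =
    Abs_fps (\<lambda>j. Abs_fps (\<lambda>i. z ^ i * (z ^ a) ^ j * fps_nth (fps_nth f j) i))"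

lemma diag_act_add: "diag_act z a (f + g) = diag_act z a f + diag_act z a g"
  by (simp add: diag_act_def fps_eq_iff algebra_simps)

lemma diag_act_mult: "diag_act z a (f * g) = diag_act z a f * diag_act z a g"
proof (rule fps_ext, rule fps_ext)
  fix j i
  have "z ^ i * (z ^ a) ^ j * (fps_nth (fps_nth f p) q * fps_nth (fps_nth g (j - p)) (i - q)) =
      (z ^ q * (z ^ a) ^ p * fps_nth (fps_nth f p) q) *
      (z ^ (i - q) * (z ^ a) ^ (j - p) * fps_nth (fps_nth g (j - p)) (i - q))"
    if "p \<le> j" "q \<le> i" for p q
  proof -
    have "z ^ i = z ^ q * z ^ (i - q)" "(z ^ a) ^ j = (z ^ a) ^ p * (z ^ a) ^ (j - p)"
      using that by (simp_all flip: power_add)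
    then show ?thesis
      by simp
  qed
  then show "fps_nth (fps_nth (diag_act z a (f * g)) j) i =
      fps_nth (fps_nth (diag_act z a f * diag_act z a g) j) i"
    unfolding diag_act_def fps_mult_nth fps_sum_nth sum_distrib_left fps_nth_Abs_fps
    by (intro sum.cong refl) simp
qed

lemma diag_act_scalar: "diag_act z a (scalar u) = scalar u"
  by (auto simp: diag_act_def scalar_def fps_eq_iff)

lemma diag_act_var_x: "diag_act z a var_x = scalar z * var_x"
  by (auto simp: diag_act_def scalar_def var_x_def fps_eq_iff le_Suc_eq)

lemma diag_act_var_y: "diag_act z a var_y = scalar (z ^ a) * var_y"
  by (auto simp: diag_act_def scalar_def var_y_def fps_eq_iff le_Suc_eq)

definition cyclic_action :: "'k::field \<Rightarrow> nat \<Rightarrow> ('k fps fps \<Rightarrow> 'k fps fps) set"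
  where "cyclic_action z a = generate (BijGroup UNIV) {diag_act z a}"

definition invariant_ring :: "'k::field \<Rightarrow> nat \<Rightarrow> 'k fps fps ring"
  where "invariant_ring z a =
    ring_of_type_algebra\<lparr>carrier := {f. \<forall>g\<in>cyclic_action z a. g f = f}\<rparr>"

definition power_series_module :: "('k::field fps fps, 'k fps fps) module"
  where "power_series_module =
    \<lparr>carrier = UNIV, monoid.mult = (*), monoid.one = 1, ring.zero = 0,
     ring.add = (+), module.smult = (*)\<rparr>"

definition semi_invariants ::
    "nat \<Rightarrow> nat \<Rightarrow> 'k::field \<Rightarrow> int \<Rightarrow> ('k fps fps, 'k fps fps) module"
  where "semi_invariants n a z t =
    power_series_module\<lparr>carrier :=
      module.span (invariant_ring z a) power_series_module
        {var_x ^ i * var_y ^ j | i j. [int i + int j * int a = t] (mod int n)}\<rparr>"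

end

theory Submission
  imports Defs "HOL-Library.Product_Plus"
begin

text \<open>The monomial \<open>x\<^sup>i y\<^sup>j\<close> has weight \<open>i + j a\<close> modulo \<open>n\<close>. The invariant ring \<open>R\<close> consists of the
  series supported on exponents of weight \<open>0\<close>, and \<open>M\<^sub>t\<close> of those supported on exponents of weight
  \<open>t\<close>. So both numbers in the definition of an Ulrich module become questions about lattice points.

  The Hirzebruch-Jung continued fraction of \<open>n / (n - a)\<close> yields invariant exponents
  \<open>v\<^sub>0 = (n, 0), v\<^sub>1 = (n - a, 1), \<dots>, v\<^sub>e = (0, n)\<close> in which any two neighbours have determinant \<open>n\<close>
  (\<open>hj_chain_exists\<close>). Write a point of weight \<open>t\<close> in the cone of \<open>v\<^sub>s\<close> and \<open>v\<^sub>s\<^sub>+\<^sub>1\<close> in coordinates with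
  respect to these two vectors. The sum of the coordinates is positive on all nonzero invariant
  exponents and takes integral values there, hence values at least \<open>1\<close>; so it measures, up to an
  error of at most \<open>2\<close>, the power of \<open>\<mm>\<close> that divides the monomial. Each of the \<open>e\<close> cones therefore
  contributes \<open>l\<^sup>2 / 2 + O(l)\<close> to the length of \<open>M\<^sub>t / \<mm>\<^sup>l M\<^sub>t\<close>, and every \<open>M\<^sub>t\<close> has multiplicity \<open>e\<close>
  (\<open>colength_limit\<close>).

  The minimal generators of \<open>M\<^sub>t\<close> are the exponents of weight \<open>t\<close> below the staircase with corners \<open>v\<^sub>s\<close>.
  This staircase splits into \<open>e\<close> rectangular blocks, and a block contains each weight at most once
  (\<open>block_weight_inj\<close>). So \<open>M\<^sub>t\<close> is Ulrich exactly if each block contains the weight \<open>t\<close>. The lower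
  right corners of the blocks have weight \<open>n - 1\<close> and the points just below \<open>v\<^sub>1, \<dots>, v\<^sub>e\<close> have weight
  \<open>n - a\<close>, which gives the two modules of the second claim. If \<open>t < n - a\<close> and all blocks contain \<open>t\<close>,
  then the points of weight \<open>t\<close> in consecutive blocks differ exactly like consecutive \<open>v\<^sub>s\<close>, so the last
  one would lie left of the \<open>y\<close>-axis (\<open>card_min_gens_lower\<close>).

  The multiplicity is normalised by the Krull dimension, and an Ulrich module has to be maximal
  Cohen-Macaulay, so \<open>dim R = 2\<close> and \<open>depth M\<^sub>t = 2\<close> are needed as well. The lower bounds come from the
  coordinate axes: a chain of primes and the sequence \<open>x\<^sup>n, y\<^sup>n\<close>. Both upper bounds follow from one
  identity (\<open>collapse\<close>): elements \<open>f\<^sub>1 \<noteq> 0\<close> and \<open>f\<^sub>2\<close> of \<open>R\<close> and a nonunit \<open>f\<^sub>3\<close> satisfy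
  \<open>f\<^sub>2\<^sup>p (f\<^sub>3\<^sup>q + A f\<^sub>2) = B f\<^sub>1\<close> for suitable \<open>p, q\<close> and \<open>A, B \<in> R\<close>. It makes a strict chain of four primes
  and a regular sequence of length three impossible, and it is proved by Weierstrass division.\<close>

section \<open>Exponents of semi-invariant monomials\<close>

abbreviation monomial_le :: "nat \<times> nat \<Rightarrow> nat \<times> nat \<Rightarrow> bool" (infix "\<unlhd>" 50)
  where "u \<unlhd> w \<equiv> fst u \<le> fst w \<and> snd u \<le> snd w"

locale cyclic_weights =
  fixes n a :: nat
  assumes a_pos: "1 \<le> a" and a_less: "a < n" and coprime_a_n: "coprime a n"
begin

definition weight_class :: "int \<Rightarrow> (nat \<times> nat) set"
  where "weight_class t = {w. [int (fst w) + int (snd w) * int a = t] (mod int n)}"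

definition invariant_exps :: "(nat \<times> nat) set"
  where "invariant_exps = weight_class 0 - {0}"

text \<open>The exponents of the monomials in the power \<open>\<mm>\<^sup>l\<close> of the maximal ideal, with \<open>\<mm>\<^sup>0 = R\<close>; likewise
  \<open>exps_pow_class\<close> below gives the exponents of the monomials in \<open>\<mm>\<^sup>l M\<^sub>t\<close>.\<close>

primrec exps_pow :: "nat \<Rightarrow> (nat \<times> nat) set"
  where
    "exps_pow 0 = weight_class 0"
  | "exps_pow (Suc l) = {u + v | u v. u \<in> invariant_exps \<and> v \<in> exps_pow l}"

definition exps_pow_class :: "nat \<Rightarrow> int \<Rightarrow> (nat \<times> nat) set"
  where "exps_pow_class l t = {u + v | u v. u \<in> exps_pow l \<and> v \<in> weight_class t}"

definition min_gens :: "int \<Rightarrow> (nat \<times> nat) set"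
  where "min_gens t = {w \<in> weight_class t. \<forall>u\<in>invariant_exps. \<not> u \<unlhd> w}"

lemma n_gt_1: "1 < n"
  using a_pos a_less by linarith

lemma weight_class_iff:
  "w \<in> weight_class t \<longleftrightarrow> int n dvd int (fst w) + int (snd w) * int a - t"
  by (simp add: weight_class_def cong_iff_dvd_diff)

lemma weight_class_add:
  assumes "u \<in> weight_class s" "v \<in> weight_class t"
  shows "u + v \<in> weight_class (s + t)"
  using cong_add[OF assms[unfolded weight_class_def mem_Collect_eq]]
  by (simp add: weight_class_def algebra_simps)

lemma weight_class_diff:
  assumes "u \<in> weight_class s" "w \<in> weight_class t" "u \<unlhd> w"
  shows "w - u \<in> weight_class (t - s)"
  using cong_diff[OF assms(2)[unfolded weight_class_def mem_Collect_eq] assms(1)[unfolded weight_class_def mem_Collect_eq]] assms(3)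
  by (simp add: weight_class_def algebra_simps of_nat_diff)

lemma weight_class_0_add:
  assumes "u \<in> weight_class 0" "v \<in> weight_class t"
  shows "u + v \<in> weight_class t"
  using weight_class_add[OF assms] by simp

lemma zero_in_weight_class: "0 \<in> weight_class 0"
  by (simp add: weight_class_def)

text \<open>The determinant with an invariant exponent is divisible by \<open>n\<close> up to a term that depends on the weight
  only. This is what makes the cone coordinates of an exponent integral, and determined modulo \<open>n\<close> by
  its weight.\<close>

lemma cross_product_cong:
  assumes "u \<in> weight_class s" "v \<in> weight_class t"
  shows "int n dvd int (fst u) * int (snd v) - int (snd u) * int (fst v)
    - (s * int (snd v) - t * int (snd u))"
proof -
  have "int n dvd (int (fst u) + int (snd u) * int a - s) * int (snd v)
      - (int (fst v) + int (snd v) * int a - t) * int (snd u)"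
    using assms by (intro dvd_diff[OF dvd_mult2 dvd_mult2]) (simp_all only: weight_class_iff)
  then show ?thesis
    by (simp add: algebra_simps)
qed

lemma exps_pow_SucI: "u \<in> invariant_exps \<Longrightarrow> v \<in> exps_pow l \<Longrightarrow> u + v \<in> exps_pow (Suc l)"
  unfolding exps_pow.simps by blast

lemma exps_pow_SucE:
  assumes "w \<in> exps_pow (Suc l)"
  obtains u v where "w = u + v" "u \<in> invariant_exps" "v \<in> exps_pow l"
  using assms unfolding exps_pow.simps by blast

lemma exps_pow_classI: "u \<in> exps_pow l \<Longrightarrow> v \<in> weight_class t \<Longrightarrow> u + v \<in> exps_pow_class l t"
  unfolding exps_pow_class_def by blast

lemma exps_pow_classE:
  assumes "w \<in> exps_pow_class l t"
  obtains u v where "w = u + v" "u \<in> exps_pow l" "v \<in> weight_class t"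
  using assms unfolding exps_pow_class_def by blast

lemma exps_pow_add:
  assumes "u \<in> weight_class 0" "v \<in> exps_pow l"
  shows "u + v \<in> exps_pow l"
  using assms(2)
proof (induction l arbitrary: v)
  case 0
  then show ?case using weight_class_0_add[OF assms(1)] by simp
next
  case (Suc l)
  from Suc.prems obtain p q where pq: "v = p + q" "p \<in> invariant_exps" "q \<in> exps_pow l"
    by (rule exps_pow_SucE)
  have "u + v = p + (u + q)"
    by (simp only: pq add.left_commute)
  then show ?case using exps_pow_SucI[OF pq(2) Suc.IH[OF pq(3)]] by (simp only:)
qed

lemma exps_pow_Suc_subset: "exps_pow (Suc l) \<subseteq> exps_pow l"
proof
  fix w assume "w \<in> exps_pow (Suc l)"
  then obtain u v where uv: "w = u + v" "u \<in> invariant_exps" "v \<in> exps_pow l"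
    by (rule exps_pow_SucE)
  then have "u \<in> weight_class 0" unfolding invariant_exps_def by blast
  from exps_pow_add[OF this uv(3)] show "w \<in> exps_pow l" by (simp only: uv(1))
qed

lemma exps_pow_antimono: "l \<le> m \<Longrightarrow> exps_pow m \<subseteq> exps_pow l"
  using exps_pow_Suc_subset by (rule lift_Suc_antimono_le[of exps_pow])

lemma exps_pow_subset: "exps_pow l \<subseteq> weight_class 0"
  using exps_pow_antimono[of 0 l] by simp

lemma exps_pow_mult:
  assumes "u \<in> exps_pow l" "v \<in> exps_pow m"
  shows "u + v \<in> exps_pow (l + m)"
  using assms(1)
proof (induction l arbitrary: u)
  case 0
  then show ?case using exps_pow_add assms(2) by simp
next
  case (Suc l)
  from Suc.prems obtain p q where pq: "u = p + q" "p \<in> invariant_exps" "q \<in> exps_pow l"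
    by (rule exps_pow_SucE)
  have "u + v = p + (q + v)"
    by (simp only: pq add.assoc)
  then show ?case using exps_pow_SucI[OF pq(2) Suc.IH[OF pq(3)]] by (simp only: add_Suc)
qed

lemma exps_pow_multiple:
  assumes "(x, y) \<in> invariant_exps"
  shows "(p * x, p * y) \<in> exps_pow p"
proof (induction p)
  case 0
  then show ?case using zero_in_weight_class by (simp add: zero_prod_def)
next
  case (Suc p)
  have "(Suc p * x, Suc p * y) = (x, y) + (p * x, p * y)" by simp
  then show ?case using exps_pow_SucI[OF assms Suc] by (simp only:)
qed

lemma exps_pow_class_subset: "exps_pow_class l t \<subseteq> weight_class t"
proof
  fix w assume "w \<in> exps_pow_class l t"
  then obtain u v where uv: "w = u + v" "u \<in> exps_pow l" "v \<in> weight_class t"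
    by (rule exps_pow_classE)
  from weight_class_0_add[OF subsetD[OF exps_pow_subset uv(2)] uv(3)] show "w \<in> weight_class t"
    by (simp only: uv(1))
qed

lemma exps_pow_class_add:
  assumes "u \<in> weight_class 0" "w \<in> exps_pow_class l t"
  shows "u + w \<in> exps_pow_class l t"
proof -
  from assms(2) obtain p q where pq: "w = p + q" "p \<in> exps_pow l" "q \<in> weight_class t"
    by (rule exps_pow_classE)
  have "u + w = p + (u + q)"
    by (simp only: pq add.left_commute)
  then show ?thesis
    using exps_pow_classI[OF pq(2) weight_class_0_add[OF assms(1) pq(3)]] by (simp only:)
qed

lemma min_gens_eq: "min_gens t = weight_class t - exps_pow_class 1 t"
proof -
  have "w \<in> exps_pow_class 1 t \<longleftrightarrow> (\<exists>u\<in>invariant_exps. u \<unlhd> w)" if w: "w \<in> weight_class t" for w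
  proof
    assume "w \<in> exps_pow_class 1 t"
    then obtain p q where pq: "w = p + q" "p \<in> exps_pow 1"
      by (rule exps_pow_classE)
    from pq(2)[unfolded One_nat_def] obtain u v where "p = u + v" "u \<in> invariant_exps"
      by (rule exps_pow_SucE)
    then show "\<exists>u\<in>invariant_exps. u \<unlhd> w" using pq(1) by (intro bexI[of _ u]) auto
  next
    assume "\<exists>u\<in>invariant_exps. u \<unlhd> w"
    then obtain u where u: "u \<in> invariant_exps" "u \<unlhd> w" by blast
    have "u \<in> exps_pow 1"
      using exps_pow_SucI[OF u(1), of 0 0] zero_in_weight_class by simp
    moreover have "w - u \<in> weight_class t"
      using weight_class_diff[OF _ w u(2), of 0] u(1) by (simp add: invariant_exps_def)
    moreover have "w = u + (w - u)"
      using u(2) by (auto simp: prod_eq_iff)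
    ultimately show "w \<in> exps_pow_class 1 t"
      using exps_pow_classI by metis
  qed
  then show ?thesis by (auto simp: min_gens_def)
qed

lemma weight_class_0_add_iff:
  assumes "v \<in> weight_class 0"
  shows "u + v \<in> weight_class t \<longleftrightarrow> u \<in> weight_class t"
proof
  assume "u + v \<in> weight_class t"
  from weight_class_diff[OF assms this] have "u + v - v \<in> weight_class t" by simp
  moreover have "u + v - v = u" by (simp add: prod_eq_iff)
  ultimately show "u \<in> weight_class t" by simp
next
  assume "u \<in> weight_class t"
  from weight_class_0_add[OF assms this] show "u + v \<in> weight_class t" by (simp only: add.commute)
qed

lemma weight_class_0_diff:
  assumes "u \<in> weight_class 0" "w \<in> weight_class t" "u \<unlhd> w"
  shows "w - u \<in> weight_class t"
  using weight_class_diff[OF assms] by simp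

lemma x_axis_weight: "(i, 0) \<in> weight_class 0 \<longleftrightarrow> n dvd i"
  by (simp add: weight_class_iff)

lemma y_axis_weight: "(0, j) \<in> weight_class 0 \<longleftrightarrow> n dvd j"
proof -
  have "(0, j) \<in> weight_class 0 \<longleftrightarrow> n dvd j * a"
    by (simp add: weight_class_iff flip: of_nat_mult)
  also have "\<dots> \<longleftrightarrow> n dvd j"
    using coprime_a_n by (simp add: coprime_commute coprime_dvd_mult_left_iff)
  finally show ?thesis .
qed

section \<open>The Hirzebruch-Jung chain\<close>

text \<open>The points \<open>(vx s, vy s)\<close> go left and up until they reach the \<open>y\<close>-axis. As \<open>n\<close> is the index of the
  lattice of invariant exponents, determinant \<open>n\<close> says that neighbouring points form a basis of it.\<close>

definition hj_chain :: "nat \<Rightarrow> (nat \<Rightarrow> nat) \<Rightarrow> (nat \<Rightarrow> nat) \<Rightarrow> bool"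
  where "hj_chain e vx vy \<longleftrightarrow> (\<forall>s\<le>e. (vx s, vy s) \<in> weight_class 0) \<and>
    (\<forall>s<e. vx (Suc s) < vx s \<and> vy s < vy (Suc s) \<and> vx s * vy (Suc s) = vx (Suc s) * vy s + n) \<and> vx e = 0"

text \<open>The Hirzebruch-Jung step replaces the pair \<open>v, v'\<close> by \<open>v', b v' - v\<close>. This keeps the determinant \<open>n\<close>,
  and \<open>b\<close>, the quotient of the first coordinates rounded up, is the only choice for which the first
  coordinate stays nonnegative and decreases. The second coordinate increases because \<open>b \<ge> 2\<close>.\<close>

lemma hj_chain_from:
  assumes "(x, y) \<in> weight_class 0" "(x', y') \<in> weight_class 0"
    and "x' < x" "y < y'" "x * y' = x' * y + n"
  shows "\<exists>e vx vy. hj_chain (Suc e) vx vy \<and> vx 0 = x \<and> vy 0 = y \<and> vx 1 = x' \<and> vy 1 = y'"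
  using assms
proof (induction x' arbitrary: x y y' rule: less_induct)
  case (less x')
  show ?case
  proof (cases "x' = 0")
    case True
    show ?thesis
      by (rule exI[of _ 0], rule exI[of _ "case_nat x (\<lambda>_. x')"], rule exI[of _ "case_nat y (\<lambda>_. y')"])
        (use less True in \<open>auto simp: hj_chain_def le_Suc_eq\<close>)
  next
    case False
    define b where "b = (x + x' - 1) div x'"
    have b1: "x \<le> b * x'" "b * x' < x + x'"
    proof -
      have eq: "x + x' - 1 = b * x' + (x + x' - 1) mod x'"
        by (simp add: b_def)
      have lt: "(x + x' - 1) mod x' < x'"
        using False by simp
      show "x \<le> b * x'" "b * x' < x + x'"
        using eq lt False by linarith+
    qed
    have b2: "2 \<le> b"
    proof (rule ccontr)
      assume "\<not> 2 \<le> b"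
      then have "b \<le> 1" by simp
      then have "b * x' \<le> 1 * x'" by (rule mult_le_mono1)
      then show False using b1 less.prems(3) by linarith
    qed
    define x'' where "x'' = b * x' - x"
    define y'' where "y'' = b * y' - y"
    have "2 * y' \<le> b * y'"
      using b2 by (rule mult_le_mono1)
    then have "y' + y < b * y'"
      using less.prems(4) by linarith
    then have y'': "y' < y''" "int y'' = int b * int y' - int y"
      by (simp_all add: y''_def of_nat_diff)
    have x'': "x'' < x'" "int x'' = int b * int x' - int x"
      using b1 by (simp_all add: x''_def)
    have "int (x' * y'') = int (x'' * y' + n)"
    proof -
      have "int x * int y' = int x' * int y + int n"
        using less.prems(5) by (metis of_nat_add of_nat_mult)
      then show ?thesis
        by (simp add: x'' y'' algebra_simps)
    qed
    then have det: "x' * y'' = x'' * y' + n"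
      by (simp only: of_nat_eq_iff)
    have "int n dvd int b * (int x' + int y' * int a) - (int x + int y * int a)"
      using less.prems(1,2) by (intro dvd_diff dvd_mult) (auto simp: weight_class_iff)
    then have "(x'', y'') \<in> weight_class 0"
      by (simp add: weight_class_iff x'' y'' algebra_simps)
    from less.IH[OF x''(1) less.prems(2) this x''(1) y''(1) det]
    obtain e vx vy where vxy: "hj_chain (Suc e) vx vy" "vx 0 = x'" "vy 0 = y'" "vx 1 = x''" "vy 1 = y''"
      by blast
    show ?thesis
    proof (rule exI[of _ "Suc e"], rule exI[of _ "case_nat x vx"], rule exI[of _ "case_nat y vy"],
        intro conjI)
      show "hj_chain (Suc (Suc e)) (case_nat x vx) (case_nat y vy)"
        unfolding hj_chain_def
      proof (intro conjI allI impI)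
        fix s assume "s \<le> Suc (Suc e)"
        then show "(case s of 0 \<Rightarrow> x | Suc k \<Rightarrow> vx k, case s of 0 \<Rightarrow> y | Suc k \<Rightarrow> vy k) \<in> weight_class 0"
          using vxy(1) less.prems(1) by (cases s) (auto simp: hj_chain_def)
      next
        fix s assume s: "s < Suc (Suc e)"
        show "(case Suc s of 0 \<Rightarrow> x | Suc k \<Rightarrow> vx k) < (case s of 0 \<Rightarrow> x | Suc k \<Rightarrow> vx k)"
          using s vxy(1,2) less.prems(3) by (cases s) (auto simp: hj_chain_def)
        show "(case s of 0 \<Rightarrow> y | Suc k \<Rightarrow> vy k) < (case Suc s of 0 \<Rightarrow> y | Suc k \<Rightarrow> vy k)"
          using s vxy(1,3) less.prems(4) by (cases s) (auto simp: hj_chain_def)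
        show "(case s of 0 \<Rightarrow> x | Suc k \<Rightarrow> vx k) * (case Suc s of 0 \<Rightarrow> y | Suc k \<Rightarrow> vy k) =
          (case Suc s of 0 \<Rightarrow> x | Suc k \<Rightarrow> vx k) * (case s of 0 \<Rightarrow> y | Suc k \<Rightarrow> vy k) + n"
          using s vxy(1,2,3) less.prems(5) by (cases s) (auto simp: hj_chain_def)
      next
        show "(case Suc (Suc e) of 0 \<Rightarrow> x | Suc k \<Rightarrow> vx k) = 0"
          using vxy(1) by (simp add: hj_chain_def)
      qed
    qed (use vxy in auto)
  qed
qed

lemma hj_chain_exists:
  "\<exists>e vx vy. hj_chain e vx vy \<and> 0 < e \<and> vx 0 = n \<and> vy 0 = 0 \<and> vx 1 = n - a \<and> vy 1 = 1"
proof -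
  have "(n, 0) \<in> weight_class 0" "(n - a, 1) \<in> weight_class 0"
    using a_less by (auto simp: weight_class_iff of_nat_diff)
  from hj_chain_from[OF this] obtain e vx vy where
    "hj_chain (Suc e) vx vy" "vx 0 = n" "vy 0 = 0" "vx 1 = n - a" "vy 1 = 1"
    using a_pos a_less by auto
  then show ?thesis by blast
qed

end

locale hj_vertices = cyclic_weights +
  fixes e :: nat and vx vy :: "nat \<Rightarrow> nat"
  assumes chain: "hj_chain e vx vy" and e_pos: "0 < e"
    and vx_0: "vx 0 = n" and vy_0: "vy 0 = 0" and vx_1: "vx 1 = n - a" and vy_1: "vy 1 = 1"
begin

lemma vertex_weight: "s \<le> e \<Longrightarrow> (vx s, vy s) \<in> weight_class 0"
  using chain by (simp add: hj_chain_def)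

lemma vx_Suc_less: "s < e \<Longrightarrow> vx (Suc s) < vx s"
  and vy_less_Suc: "s < e \<Longrightarrow> vy s < vy (Suc s)"
  and det_nat: "s < e \<Longrightarrow> vx s * vy (Suc s) = vx (Suc s) * vy s + n"
  and vx_e: "vx e = 0"
  using chain by (auto simp: hj_chain_def)

lemma det: "s < e \<Longrightarrow> int (vx s) * int (vy (Suc s)) - int (vx (Suc s)) * int (vy s) = int n"
  using det_nat by (metis add_diff_cancel_left' of_nat_add of_nat_mult)

lemma vx_antimono: "r \<le> s \<Longrightarrow> s \<le> e \<Longrightarrow> vx s \<le> vx r"
  by (induction s rule: nat_induct_at_least)
    (simp, metis Suc_le_eq le_trans less_imp_le vx_Suc_less)

lemma vy_mono: "r \<le> s \<Longrightarrow> s \<le> e \<Longrightarrow> vy r \<le> vy s"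
  by (induction s rule: nat_induct_at_least)
    (simp, metis Suc_le_eq le_trans less_imp_le vy_less_Suc)

lemma vertex_invariant: "s \<le> e \<Longrightarrow> (vx s, vy s) \<in> invariant_exps"
proof -
  assume s: "s \<le> e"
  have "(vx s, vy s) \<noteq> 0"
  proof (cases "s = 0")
    case True
    then show ?thesis using vx_0 n_gt_1 by (simp add: zero_prod_def)
  next
    case False
    then have "vy 1 \<le> vy s" using s by (intro vy_mono) auto
    then show ?thesis using vy_1 by (simp add: zero_prod_def)
  qed
  then show ?thesis
    using vertex_weight[OF s] by (simp add: invariant_exps_def)
qed

text \<open>By Cramer's rule, \<open>n\<close> times an exponent \<open>w\<close> is \<open>left_coord s w\<close> times \<open>v\<^sub>s\<close> plus \<open>right_coord s w\<close> times
  \<open>v\<^sub>s\<^sub>+\<^sub>1\<close>. Keeping the factor \<open>n\<close> makes both coordinates integral for all exponents.\<close>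

definition in_cone :: "nat \<Rightarrow> nat \<times> nat \<Rightarrow> bool"
  where "in_cone s w \<longleftrightarrow>
    snd w * vx (Suc s) \<le> fst w * vy (Suc s) \<and> fst w * vy s \<le> snd w * vx s"

definition left_coord :: "nat \<Rightarrow> nat \<times> nat \<Rightarrow> int"
  where "left_coord s w = int (fst w) * int (vy (Suc s)) - int (snd w) * int (vx (Suc s))"

definition right_coord :: "nat \<Rightarrow> nat \<times> nat \<Rightarrow> int"
  where "right_coord s w = int (snd w) * int (vx s) - int (fst w) * int (vy s)"

lemma in_cone_iff: "in_cone s w \<longleftrightarrow> 0 \<le> left_coord s w \<and> 0 \<le> right_coord s w"
  by (auto simp: in_cone_def left_coord_def right_coord_def simp flip: of_nat_mult)

text \<open>Take the first \<open>s\<close> for which \<open>w\<close> lies on or to the right of the ray through \<open>v\<^sub>s\<^sub>+\<^sub>1\<close>. Such an \<open>s\<close> exists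
  because the last ray is the \<open>y\<close>-axis.\<close>

lemma cone_cover: "\<exists>s<e. in_cone s w"
proof -
  let ?P = "\<lambda>s. s < e \<and> snd w * vx (Suc s) \<le> fst w * vy (Suc s)"
  define s where "s = (LEAST s. ?P s)"
  have "?P (e - 1)"
    using e_pos vx_e by simp
  then have s: "?P s"
    unfolding s_def by (rule LeastI)
  have "fst w * vy s \<le> snd w * vx s"
  proof (cases s)
    case 0
    then show ?thesis using vy_0 by simp
  next
    case (Suc r)
    then have "\<not> ?P r"
      using not_less_Least[of r ?P] by (simp add: s_def)
    then show ?thesis using s Suc by auto
  qed
  then show ?thesis
    using s by (auto simp: in_cone_def)
qed

lemma coords_fst:
  "s < e \<Longrightarrow> int n * int (fst w) = left_coord s w * int (vx s) + right_coord s w * int (vx (Suc s))"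
  unfolding det[symmetric] left_coord_def right_coord_def by (simp add: algebra_simps)

lemma coords_snd:
  "s < e \<Longrightarrow> int n * int (snd w) = left_coord s w * int (vy s) + right_coord s w * int (vy (Suc s))"
  unfolding det[symmetric] left_coord_def right_coord_def by (simp add: algebra_simps)

lemma left_coord_cong:
  assumes "w \<in> weight_class t" "s < e"
  shows "left_coord s w mod int n = (t * int (vy (Suc s))) mod int n"
  using cross_product_cong[OF assms(1) vertex_weight[of "Suc s"]] assms(2)
  by (simp add: left_coord_def mod_eq_dvd_iff)

lemma right_coord_cong:
  assumes "w \<in> weight_class t" "s < e"
  shows "right_coord s w mod int n = (- t * int (vy s)) mod int n"
proof -
  have "int n dvd - (int (fst w) * int (vy s) - int (snd w) * int (vx s) - t * int (vy s))"
    using cross_product_cong[OF assms(1) vertex_weight[of s]] assms(2) by (simp only: dvd_minus_iff) simp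
  then show ?thesis
    by (simp add: right_coord_def mod_eq_dvd_iff algebra_simps)
qed

text \<open>In its cone, an invariant exponent is a combination of the two neighbouring vertices with integral
  coefficients, because the determinant of the vertices is \<open>n\<close>. One of the coefficients is at
  least \<open>1\<close>.\<close>

lemma vertex_le:
  assumes "u \<in> invariant_exps"
  shows "\<exists>r\<le>e. (vx r, vy r) \<unlhd> u"
proof -
  obtain s where s: "s < e" "in_cone s u"
    using cone_cover by blast
  have u: "u \<in> weight_class 0" "u \<noteq> 0"
    using assms by (auto simp: invariant_exps_def)
  have dvd: "int n dvd left_coord s u" "int n dvd right_coord s u"
    using left_coord_cong[OF u(1) s(1)] right_coord_cong[OF u(1) s(1)] by (auto simp: dvd_eq_mod_eq_0)
  then obtain A B where AB: "left_coord s u = int n * A" "right_coord s u = int n * B"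
    by (auto simp: dvd_def)
  have n0: "0 < int n"
    using n_gt_1 by simp
  have pos: "0 \<le> A" "0 \<le> B"
    using s(2) n0 by (auto simp: in_cone_iff AB zero_le_mult_iff)
  have "int n * int (fst u) = int n * (A * int (vx s) + B * int (vx (Suc s)))"
    "int n * int (snd u) = int n * (A * int (vy s) + B * int (vy (Suc s)))"
    using coords_fst[OF s(1), of u] coords_snd[OF s(1), of u] by (simp_all add: AB algebra_simps)
  then have f: "int (fst u) = A * int (vx s) + B * int (vx (Suc s))"
    and g: "int (snd u) = A * int (vy s) + B * int (vy (Suc s))"
    using n0 by (simp_all only: mult_cancel_left) auto
  have "A \<noteq> 0 \<or> B \<noteq> 0"
    using f g u(2) by (auto simp: prod_eq_iff)
  then consider "1 \<le> A" | "1 \<le> B"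
    using pos by linarith
  then show ?thesis
  proof cases
    case 1
    have "1 * int (vx s) \<le> A * int (vx s)" "1 * int (vy s) \<le> A * int (vy s)"
      using 1 by (intro mult_right_mono; simp)+
    moreover have "0 \<le> B * int (vx (Suc s))" "0 \<le> B * int (vy (Suc s))"
      using pos by auto
    ultimately have "(vx s, vy s) \<unlhd> u"
      using f g by auto
    then show ?thesis using s(1) by (intro exI[of _ s]) auto
  next
    case 2
    have "1 * int (vx (Suc s)) \<le> B * int (vx (Suc s))" "1 * int (vy (Suc s)) \<le> B * int (vy (Suc s))"
      using 2 by (intro mult_right_mono; simp)+
    moreover have "0 \<le> A * int (vx s)" "0 \<le> A * int (vy s)"
      using pos by auto
    ultimately have "(vx (Suc s), vy (Suc s)) \<unlhd> u"
      using f g by auto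
    then show ?thesis using s(1) by (intro exI[of _ "Suc s"]) auto
  qed
qed

section \<open>The staircase of minimal generators\<close>

text \<open>The staircase has no invariant exponent other than \<open>0\<close> below it: a vertex below \<open>u\<close> would have to lie to
  the left of \<open>v\<^sub>s\<close> and below \<open>v\<^sub>s\<^sub>+\<^sub>1\<close>.\<close>

lemma no_small_invariant:
  assumes "u \<in> weight_class 0" "s < e" "fst u < vx s" "snd u < vy (Suc s)"
  shows "u = 0"
proof (rule ccontr)
  assume "u \<noteq> 0"
  then obtain r where r: "r \<le> e" "vx r \<le> fst u" "vy r \<le> snd u"
    using vertex_le[of u] assms(1) by (auto simp: invariant_exps_def)
  have "s < r"
    using vx_antimono[of r s] r assms(2,3) by (metis le_less_trans less_imp_le not_le)
  then have "vy (Suc s) \<le> vy r"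
    using vy_mono r(1) by simp
  then show False using r assms(4) by simp
qed

definition block :: "nat \<Rightarrow> (nat \<times> nat) set"
  where "block s = {w. fst w < vx s \<and> vy s \<le> snd w \<and> snd w < vy (Suc s)}"

lemma min_gens_iff: "w \<in> min_gens t \<longleftrightarrow> w \<in> weight_class t \<and> (\<exists>s<e. w \<in> block s)"
proof
  assume w: "w \<in> min_gens t"
  define s where "s = (LEAST s. s < e \<and> snd w < vy (Suc s))"
  have not_ge: "\<not> (vx r, vy r) \<unlhd> w" if "r \<le> e" for r
    using vertex_invariant[OF that] w by (auto simp: min_gens_def)
  have "snd w < vy e"
    using not_ge[of e] vx_e by simp
  then have "e - 1 < e \<and> snd w < vy (Suc (e - 1))"
    using e_pos by simp
  then have s: "s < e \<and> snd w < vy (Suc s)"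
    unfolding s_def by (rule LeastI)
  have "vy s \<le> snd w"
  proof (cases s)
    case 0
    then show ?thesis using vy_0 by simp
  next
    case (Suc r)
    then show ?thesis
      using not_less_Least[of r "\<lambda>s. s < e \<and> snd w < vy (Suc s)"] s by (auto simp: s_def)
  qed
  then show "w \<in> weight_class t \<and> (\<exists>s<e. w \<in> block s)"
    using s not_ge[of s] w by (auto simp: block_def min_gens_def)
next
  assume "w \<in> weight_class t \<and> (\<exists>s<e. w \<in> block s)"
  then obtain s where s: "w \<in> weight_class t" "s < e" "w \<in> block s" by blast
  have "\<not> u \<unlhd> w" if u: "u \<in> invariant_exps" for u
    using no_small_invariant[of u s] u s by (auto simp: block_def invariant_exps_def)
  then show "w \<in> min_gens t"
    using s by (auto simp: min_gens_def)
qed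

text \<open>The difference of two points of equal weight is an invariant vector. If its coordinates have the same
  sign, it is too small to be a nonzero invariant exponent; if not, it becomes too small after adding
  \<open>v\<^sub>s\<close>.\<close>

lemma block_weight_inj:
  assumes "w \<in> block s" "w' \<in> block s" "w \<in> weight_class t" "w' \<in> weight_class t" "s < e"
  shows "w = w'"
proof -
  have *: "w = w'" if "w \<in> block s" "w' \<in> block s" "w \<in> weight_class t" "w' \<in> weight_class t"
    "snd w \<le> snd w'" for w w'
  proof (cases "fst w \<le> fst w'")
    case True
    then have "w' - w \<in> weight_class 0"
      using weight_class_diff[of w t w' t] that by simp
    then have "w' - w = 0"
      using that assms(5) by (intro no_small_invariant[of _ s]) (auto simp: block_def)
    then show ?thesis
      using True that(5) by (auto simp: prod_eq_iff)
  next
    case False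
    let ?u = "(vx s - (fst w - fst w'), vy s + (snd w' - snd w))"
    have "int n dvd int (vx s) + int (vy s) * int a"
      using vertex_weight[of s] assms(5) by (simp add: weight_class_iff)
    then have "int n dvd (int (vx s) + int (vy s) * int a)
        + (int (fst w') + int (snd w') * int a - t) - (int (fst w) + int (snd w) * int a - t)"
      by (rule dvd_diff[OF dvd_add[OF _ that(4)[unfolded weight_class_iff]] that(3)[unfolded weight_class_iff]])
    moreover have "int (vx s - (fst w - fst w')) = int (vx s) - (int (fst w) - int (fst w'))"
      using False that(1) by (auto simp: block_def)
    moreover have "int (vy s + (snd w' - snd w)) = int (vy s) + (int (snd w') - int (snd w))"
      using that(5) by simp
    ultimately have "?u \<in> weight_class 0"
      by (simp add: weight_class_iff algebra_simps)
    then have "?u = 0"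
      using that False assms(5) by (intro no_small_invariant[of _ s]) (auto simp: block_def)
    then show ?thesis
      using False that(1) by (auto simp: zero_prod_def block_def)
  qed
  show ?thesis
    using *[of w w'] *[of w' w] assms by (metis nle_le)
qed

lemma blocks_disjoint:
  assumes "w \<in> block s" "w \<in> block r" "s < e" "r < e"
  shows "s = r"
proof -
  have "\<not> s < r" if "w \<in> block s" "w \<in> block r" "r < e" for s r
    using that vy_mono[of "Suc s" r] by (auto simp: block_def)
  from this[of s r] this[of r s] show ?thesis using assms by auto
qed

definition block_of :: "nat \<times> nat \<Rightarrow> nat"
  where "block_of w = (THE s. s < e \<and> w \<in> block s)"

lemma block_of_eq: "s < e \<Longrightarrow> w \<in> block s \<Longrightarrow> block_of w = s"
  unfolding block_of_def by (rule the_equality) (auto dest: blocks_disjoint)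

lemma block_of_inj: "inj_on block_of (min_gens t)"
proof (rule inj_onI)
  fix w w' assume *: "w \<in> min_gens t" "w' \<in> min_gens t" "block_of w = block_of w'"
  then obtain s s' where "s < e" "w \<in> block s" "s' < e" "w' \<in> block s'"
    by (auto simp: min_gens_iff)
  then show "w = w'"
    using * block_weight_inj[of w s w' t] by (auto simp: min_gens_iff block_of_eq)
qed

lemma block_of_image: "block_of ` min_gens t = {s. s < e \<and> (\<exists>w\<in>weight_class t. w \<in> block s)}"
proof (intro equalityI subsetI)
  fix s assume "s \<in> block_of ` min_gens t"
  then obtain w r where "s = block_of w" "w \<in> weight_class t" "r < e" "w \<in> block r"
    by (auto simp: min_gens_iff)
  then show "s \<in> {s. s < e \<and> (\<exists>w\<in>weight_class t. w \<in> block s)}"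
    using block_of_eq[of r w] by auto
next
  fix s assume "s \<in> {s. s < e \<and> (\<exists>w\<in>weight_class t. w \<in> block s)}"
  then obtain w where w: "s < e" "w \<in> weight_class t" "w \<in> block s"
    by blast
  then have "w \<in> min_gens t" "block_of w = s"
    using block_of_eq by (auto simp: min_gens_iff)
  then show "s \<in> block_of ` min_gens t" by blast
qed

lemma finite_min_gens: "finite (min_gens t)"
proof (rule finite_imageD[OF _ block_of_inj])
  show "finite (block_of ` min_gens t)"
    unfolding block_of_image by simp
qed

lemma card_min_gens_eq_iff:
  "card (min_gens t) = e \<longleftrightarrow> (\<forall>s<e. \<exists>w\<in>weight_class t. w \<in> block s)"
proof -
  let ?H = "{s. s < e \<and> (\<exists>w\<in>weight_class t. w \<in> block s)}"
  have "card (min_gens t) = card ?H"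
    using card_image[OF block_of_inj] block_of_image by metis
  moreover have "card ?H = e \<longleftrightarrow> ?H = {..<e}"
  proof
    assume "card ?H = e"
    then show "?H = {..<e}" by (intro card_subset_eq) auto
  qed simp
  ultimately show ?thesis by auto
qed

text \<open>The lower right corner of each block has weight \<open>n - 1\<close>, as it is \<open>v\<^sub>s\<close> moved one step to the left.\<close>

lemma card_min_gens_n_minus_1: "card (min_gens (int n - 1)) = e"
proof -
  have "(vx s - 1, vy s) \<in> weight_class (int n - 1) \<and> (vx s - 1, vy s) \<in> block s" if "s < e" for s
    using vertex_weight[of s] that vx_Suc_less[OF that] vy_less_Suc[OF that]
    by (auto simp: weight_class_iff block_def of_nat_diff algebra_simps)
  then show ?thesis
    unfolding card_min_gens_eq_iff by blast
qed

text \<open>Moving \<open>v\<^sub>s\<^sub>+\<^sub>1\<close> one step down gives a point of the block before it, of weight \<open>- a\<close>.\<close>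

lemma card_min_gens_n_minus_a: "card (min_gens (int n - int a)) = e"
proof -
  have "(vx (Suc s), vy (Suc s) - 1) \<in> weight_class (int n - int a) \<and>
      (vx (Suc s), vy (Suc s) - 1) \<in> block s" if "s < e" for s
    using vertex_weight[of "Suc s"] that vx_Suc_less[OF that] vy_less_Suc[OF that]
    by (auto simp: weight_class_iff block_def of_nat_diff algebra_simps)
  then show ?thesis
    unfolding card_min_gens_eq_iff by blast
qed

lemma eq_of_dvd_diff:
  assumes "int n dvd x - y" "0 \<le> x" "x < int n" "0 \<le> y" "y < int n"
  shows "x = y"
  using assms by (metis mod_eq_dvd_iff mod_pos_pos_trivial)

text \<open>Let \<open>W s\<close> be the point of weight \<open>t\<close> in block \<open>s\<close>; in particular \<open>W 0 = (t, 0)\<close>. For \<open>t < n - a\<close>, induction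
  along the blocks shows \<open>W s = (t, 0) + v\<^sub>s\<^sub>+\<^sub>1 - v\<^sub>1\<close>. In the last block the first coordinate is then
  \<open>t - (n - a) < 0\<close>.\<close>

lemma card_min_gens_lower:
  assumes "0 \<le> t" "t < int n" "card (min_gens t) = e"
  shows "int n - int a \<le> t"
proof (rule ccontr)
  assume "\<not> int n - int a \<le> t"
  then have t: "t < int (n - a)"
    using a_less by (simp add: of_nat_diff)
  obtain W where W: "\<And>s. s < e \<Longrightarrow> W s \<in> weight_class t \<and> W s \<in> block s"
    using assms(3) unfolding card_min_gens_eq_iff by metis
  have Xn: "vx s \<le> n" if "s \<le> e" for s
    using vx_antimono[of 0 s] that vx_0 by simp
  have key: "int (fst (W s)) = int (vx (Suc s)) - int (n - a) + t \<and> int (snd (W s)) = int (vy (Suc s)) - 1"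
    if "s < e" for s
    using that
  proof (induction s)
    case 0
    then have b: "fst (W 0) < n" "snd (W 0) = 0" "int n dvd int (fst (W 0)) - t"
      using W[of 0] vx_0 vy_1 by (auto simp: block_def weight_class_iff)
    then have "int (fst (W 0)) = t"
      using assms by (intro eq_of_dvd_diff) auto
    then show ?case
      using b(2) vx_1 vy_1 by simp
  next
    case (Suc s)
    then have IH: "int (fst (W s)) = int (vx (Suc s)) - int (n - a) + t"
      "int (snd (W s)) = int (vy (Suc s)) - 1" by auto
    have s: "s < e" using Suc by simp
    note W0 = W[OF s] and W1 = W[OF Suc.prems]
    let ?i = "fst (W (Suc s))" and ?j = "snd (W (Suc s))"
    have bl: "?i < vx (Suc s)" "vy (Suc s) \<le> ?j" "?j < vy (Suc (Suc s))"
      using W1 by (auto simp: block_def)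
    \<comment> \<open>otherwise the difference of the two points would be an invariant exponent below the staircase\<close>
    have lt: "?i < fst (W s)"
    proof (rule ccontr)
      assume "\<not> ?i < fst (W s)"
      then have le: "W s \<unlhd> W (Suc s)"
        using IH bl by linarith
      then have "W (Suc s) - W s \<in> weight_class 0"
        using weight_class_diff[of "W s" t "W (Suc s)" t] W0 W1 by simp
      then have "W (Suc s) - W s = 0"
        using bl Suc.prems by (intro no_small_invariant[of _ "Suc s"]) auto
      then show False
        using le bl IH by (auto simp: prod_eq_iff)
    qed
    \<comment> \<open>this is \<open>v\<^sub>s\<^sub>+\<^sub>1 + W (s + 1) - W s\<close>; by the staircase it can only be the next vertex\<close>
    define u where "u = (nat (int ?i + int (n - a) - t), Suc ?j)"
    have fu: "int (fst u) = int ?i + int (n - a) - t" "0 < fst u"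
      using t by (auto simp: u_def)
    have "int n dvd (int ?i + int ?j * int a - t) + int n"
      using W1 by (intro dvd_add) (auto simp: weight_class_iff)
    then have u: "u \<in> weight_class 0"
      using fu a_less by (simp add: weight_class_iff u_def of_nat_diff algebra_simps)
    have fu_less: "fst u < vx (Suc s)"
      using lt IH fu by linarith
    have "\<not> snd u < vy (Suc (Suc s))"
      using no_small_invariant[OF u Suc.prems fu_less] fu(2) by auto
    then have sj: "Suc ?j = vy (Suc (Suc s))"
      using bl(3) by (simp add: u_def)
    have "int n dvd (int (fst u) + int (snd u) * int a - 0) -
        (int (vx (Suc (Suc s))) + int (vy (Suc (Suc s))) * int a - 0)"
      using u vertex_weight[of "Suc (Suc s)"] Suc.prems
      by (intro dvd_diff) (auto simp: weight_class_iff)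
    then have "int n dvd int (fst u) - int (vx (Suc (Suc s)))"
      by (simp add: u_def sj)
    then have "int (fst u) = int (vx (Suc (Suc s)))"
      using fu_less Xn[of "Suc s"] vx_Suc_less[OF Suc.prems] Suc.prems
      by (intro eq_of_dvd_diff) auto
    then show ?case
      using fu sj by linarith
  qed
  have "int (fst (W (e - 1))) = int (vx e) - int (n - a) + t"
    using key[of "e - 1"] e_pos by simp
  then show False
    using vx_e t by simp
qed

end

section \<open>Counting exponents outside a power of the maximal ideal\<close>

lemma card_sum_less: "2 * card {(p, q). p + q < (l::nat)} = l * Suc l \<and> finite {(p, q). p + q < l}"
proof (induction l)
  case 0
  then show ?case by simp
next
  case (Suc l)
  have eq: "{(p, q). p + q < Suc l} = {(p, q). p + q < l} \<union> (\<lambda>p. (p, l - p)) ` {..l}"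
    by (auto simp: image_iff less_Suc_eq)
  have "{(p, q). p + q < l} \<inter> (\<lambda>p. (p, l - p)) ` {..l} = {}" by auto
  then have "card {(p, q). p + q < Suc l} = card {(p, q). p + q < l} + card ((\<lambda>p. (p, l - p)) ` {..l})"
    unfolding eq using Suc by (intro card_Un_disjoint) auto
  also have "card ((\<lambda>p. (p, l - p)) ` {..l}) = Suc l"
    by (subst card_image) (auto simp: inj_on_def)
  finally show ?case using Suc eq by auto
qed

context hj_vertices begin

text \<open>Rounding down the two cone coordinates of \<open>w\<close> exhibits a product of that many invariant monomials
  that divides \<open>w\<close>.\<close>

lemma order_less:
  assumes w: "w \<in> weight_class t" "w \<notin> exps_pow_class l t" and s: "s < e" "in_cone s w"
  shows "nat (left_coord s w div int n) + nat (right_coord s w div int n) < l"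
proof (rule ccontr)
  have div_mult_le: "int n * (x div int n) \<le> x" for x
    using n_gt_1 mult_div_mod_eq[of "int n" x] pos_mod_sign[of "int n" x] by linarith
  define p where "p = nat (left_coord s w div int n)"
  define q where "q = nat (right_coord s w div int n)"
  define u where "u = (p * vx s, p * vy s) + (q * vx (Suc s), q * vy (Suc s))"
  assume "\<not> ?thesis"
  then have "l \<le> p + q" by (simp add: p_def q_def)
  moreover have "u \<in> exps_pow (p + q)"
    unfolding u_def using s(1) by (intro exps_pow_mult exps_pow_multiple vertex_invariant) auto
  ultimately have u: "u \<in> exps_pow l" using exps_pow_antimono by blast
  have n0: "0 < int n" using n_gt_1 by simp
  have pq: "int n * int p \<le> left_coord s w" "int n * int q \<le> right_coord s w"
    using s(2) n0 div_mult_le by (simp_all add: p_def q_def in_cone_iff pos_imp_zdiv_nonneg_iff)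
  have "int n * int (fst u) \<le> int n * int (fst w)"
    unfolding coords_fst[OF s(1), of w] u_def
    using mult_right_mono[OF pq(1), of "int (vx s)"] mult_right_mono[OF pq(2), of "int (vx (Suc s))"]
    by (simp add: algebra_simps)
  moreover have "int n * int (snd u) \<le> int n * int (snd w)"
    unfolding coords_snd[OF s(1), of w] u_def
    using mult_right_mono[OF pq(1), of "int (vy s)"] mult_right_mono[OF pq(2), of "int (vy (Suc s))"]
    by (simp add: algebra_simps)
  ultimately have le: "u \<unlhd> w"
    using n0 by (simp add: mult_le_cancel_left_pos)
  then have "w - u \<in> weight_class t"
    using weight_class_diff[of u 0 w t] u exps_pow_subset w(1) by auto
  moreover have "w = u + (w - u)"
    using le by (auto simp: prod_eq_iff)
  ultimately have "w \<in> exps_pow_class l t"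
    using exps_pow_classI[OF u] by metis
  then show False using w(2) by blast
qed

lemma coords_inj:
  assumes "s < e" "left_coord s w = left_coord s w'" "right_coord s w = right_coord s w'"
  shows "w = w'"
proof -
  have n0: "int n \<noteq> 0" using n_gt_1 by simp
  have "int n * int (fst w) = int n * int (fst w')" "int n * int (snd w) = int n * int (snd w')"
    using assms by (simp_all only: coords_fst coords_snd)
  then show ?thesis using n0 by (simp add: prod_eq_iff)
qed

definition colength_set :: "nat \<Rightarrow> int \<Rightarrow> (nat \<times> nat) set"
  where "colength_set l t = weight_class t - exps_pow_class l t"

text \<open>An exponent is determined by its cone, its weight and its two rounded coordinates, as the weight fixes
  the coordinates modulo \<open>n\<close>.\<close>

lemma colength_upper:
  "finite (colength_set l t) \<and> 2 * card (colength_set l t) \<le> e * (l * Suc l)"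
proof -
  define c where "c w = (SOME s. s < e \<and> in_cone s w)" for w
  have c: "c w < e \<and> in_cone (c w) w" for w
    unfolding c_def using cone_cover[of w] by (rule someI_ex[of "\<lambda>s. s < e \<and> in_cone s w"])
  define f where "f w = (c w, nat (left_coord (c w) w div int n), nat (right_coord (c w) w div int n))" for w
  have inj: "inj_on f (colength_set l t)"
  proof (rule inj_onI)
    fix w w' assume w: "w \<in> colength_set l t" "w' \<in> colength_set l t" and eq: "f w = f w'"
    define s where "s = c w"
    have s: "s < e" "in_cone s w" "in_cone s w'" "c w' = s"
      using eq c[of w] c[of w'] by (auto simp: f_def s_def)
    have n0: "0 < int n" using n_gt_1 by simp
    have "left_coord s w div int n = left_coord s w' div int n"
      "right_coord s w div int n = right_coord s w' div int n"
      using eq s n0 by (auto simp: f_def s_def in_cone_iff pos_imp_zdiv_nonneg_iff eq_nat_nat_iff)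
    moreover have "left_coord s w mod int n = left_coord s w' mod int n"
      "right_coord s w mod int n = right_coord s w' mod int n"
      using w s(1) by (auto simp: colength_set_def left_coord_cong right_coord_cong)
    ultimately show "w = w'"
      by (intro coords_inj[OF s(1)]) (metis mult_div_mod_eq)+
  qed
  let ?B = "{..<e} \<times> {(p, q). p + q < l}"
  have sub: "f ` colength_set l t \<subseteq> ?B"
    using order_less c by (auto simp: f_def colength_set_def)
  have finB: "finite ?B" using card_sum_less[of l] by auto
  have "finite (colength_set l t)"
    using inj sub finB by (meson finite_imageD finite_subset)
  moreover have "card (colength_set l t) \<le> card ?B"
    by (rule card_inj_on_le[OF inj sub finB])
  then have "2 * card (colength_set l t) \<le> e * (2 * card {(p, q). p + q < l})"
    by (simp add: card_cartesian_product)
  ultimately show ?thesis using card_sum_less[of l] by simp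
qed

lemma coord_sum:
  "s < e \<Longrightarrow> left_coord s w + right_coord s w =
    int (fst w) * (int (vy (Suc s)) - int (vy s)) + int (snd w) * (int (vx s) - int (vx (Suc s)))"
  by (simp add: left_coord_def right_coord_def algebra_simps)

lemma coord_sum_nonneg:
  assumes "s < e"
  shows "0 \<le> left_coord s w + right_coord s w"
  unfolding coord_sum[OF assms] using vx_Suc_less[OF assms] vy_less_Suc[OF assms]
  by (intro add_nonneg_nonneg mult_nonneg_nonneg) auto

lemma coord_sum_add:
  "left_coord s (u + v) + right_coord s (u + v) =
    (left_coord s u + right_coord s u) + (left_coord s v + right_coord s v)"
  by (simp add: left_coord_def right_coord_def algebra_simps)

text \<open>Moving from \<open>v\<^sub>s\<close> to \<open>v\<^sub>s\<^sub>+\<^sub>1\<close> decreases the first and increases the second coordinate, so the sum of the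
  cone coordinates is a linear form with positive coefficients, and not only on its own cone. On
  invariant exponents its values are multiples of \<open>n\<close>.\<close>

lemma coord_sum_invariant:
  assumes "u \<in> invariant_exps" "s < e"
  shows "int n \<le> left_coord s u + right_coord s u"
proof -
  have u: "u \<in> weight_class 0" "u \<noteq> 0"
    using assms by (auto simp: invariant_exps_def)
  have "int n dvd left_coord s u + right_coord s u"
    using left_coord_cong[OF u(1) assms(2)] right_coord_cong[OF u(1) assms(2)]
    by (intro dvd_add) (simp_all add: dvd_eq_mod_eq_0)
  moreover have "left_coord s u + right_coord s u \<noteq> 0"
  proof
    assume 0: "left_coord s u + right_coord s u = 0"
    have nn: "0 \<le> int (fst u) * (int (vy (Suc s)) - int (vy s))"
      "0 \<le> int (snd u) * (int (vx s) - int (vx (Suc s)))"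
      using vx_Suc_less[OF assms(2)] vy_less_Suc[OF assms(2)] by (intro mult_nonneg_nonneg; simp)+
    have "int (fst u) * (int (vy (Suc s)) - int (vy s)) = 0"
      "int (snd u) * (int (vx s) - int (vx (Suc s))) = 0"
      using 0 nn unfolding coord_sum[OF assms(2)] by linarith+
    then show False
      using u(2) vx_Suc_less[OF assms(2)] vy_less_Suc[OF assms(2)] by (auto simp: prod_eq_iff)
  qed
  ultimately show ?thesis
    using coord_sum_nonneg[OF assms(2), of u] by (intro zdvd_imp_le) auto
qed

lemma coord_sum_pow:
  assumes "s < e" "u \<in> exps_pow l"
  shows "int n * int l \<le> left_coord s u + right_coord s u"
  using assms(2)
proof (induction l arbitrary: u)
  case 0
  then show ?case using coord_sum_nonneg[OF assms(1)] by simp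
next
  case (Suc l)
  from Suc.prems obtain p q where pq: "u = p + q" "p \<in> invariant_exps" "q \<in> exps_pow l"
    by (rule exps_pow_SucE)
  show ?case
    using coord_sum_invariant[OF pq(2) assms(1)] Suc.IH[OF pq(3)]
    by (simp add: pq(1) coord_sum_add algebra_simps)
qed

lemma coord_sum_pow_class:
  assumes "s < e" "w \<in> exps_pow_class l t"
  shows "int n * int l \<le> left_coord s w + right_coord s w"
proof -
  from assms(2) obtain p q where pq: "w = p + q" "p \<in> exps_pow l"
    by (rule exps_pow_classE)
  show ?thesis
    using coord_sum_pow[OF assms(1) pq(2)] coord_sum_nonneg[OF assms(1), of q]
    by (simp only: pq(1) coord_sum_add)
qed

text \<open>Cramer's rule read backwards: the congruences are exactly what makes the combination of \<open>v\<^sub>s\<close> and \<open>v\<^sub>s\<^sub>+\<^sub>1\<close>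
  divisible by \<open>n\<close> and of weight \<open>t\<close>.\<close>

lemma exists_with_coords:
  assumes s: "s < e" and A: "0 \<le> A" "int n dvd A - t * int (vy (Suc s))"
    and B: "0 \<le> B" "int n dvd B + t * int (vy s)"
  shows "\<exists>w\<in>weight_class t. left_coord s w = A \<and> right_coord s w = B"
proof -
  define x y x' y' where "x = int (vx s)" and "y = int (vy s)"
    and "x' = int (vx (Suc s))" and "y' = int (vy (Suc s))"
  note defs = x_def y_def x'_def y'_def
  have nn: "0 \<le> x" "0 \<le> y" "0 \<le> x'" "0 \<le> y'" by (simp_all add: defs)
  have n0: "0 < int n" using n_gt_1 by simp
  have d: "x * y' - x' * y = int n"
    using det[OF s] by (simp add: defs)
  have "int n dvd (A - t * y') * x + (B + t * y) * x' + t * (x * y' - x' * y)"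
    unfolding d unfolding defs
    by (rule dvd_add[OF dvd_add[OF dvd_mult2[OF A(2)] dvd_mult2[OF B(2)]] dvd_triv_right])
  then have "int n dvd A * x + B * x'" by (simp add: algebra_simps)
  then obtain i where i: "A * x + B * x' = int n * i" by (auto simp: dvd_def)
  have "int n dvd (A - t * y') * y + (B + t * y) * y'"
    unfolding defs by (rule dvd_add[OF dvd_mult2[OF A(2)] dvd_mult2[OF B(2)]])
  then have "int n dvd A * y + B * y'" by (simp add: algebra_simps)
  then obtain j where j: "A * y + B * y' = int n * j" by (auto simp: dvd_def)
  have "0 \<le> int n * i" "0 \<le> int n * j"
    unfolding i[symmetric] j[symmetric] using A B nn by auto
  then have ij: "0 \<le> i" "0 \<le> j" using n0 by (auto simp: zero_le_mult_iff)
  let ?w = "(nat i, nat j)"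
  have "int n * (i * y' - j * x') = (A * x + B * x') * y' - (A * y + B * y') * x'"
    unfolding i j by (simp add: algebra_simps)
  also have "\<dots> = int n * A"
    unfolding d[symmetric] by (simp add: algebra_simps)
  finally have L: "left_coord s ?w = A"
    using n0 ij by (simp add: left_coord_def defs)
  have "int n * (j * x - i * y) = (A * y + B * y') * x - (A * x + B * x') * y"
    unfolding i j by (simp add: algebra_simps)
  also have "\<dots> = int n * B"
    unfolding d[symmetric] by (simp add: algebra_simps)
  finally have R: "right_coord s ?w = B"
    using n0 ij by (simp add: right_coord_def defs)
  obtain k where k: "x + y * int a = int n * k"
    using vertex_weight[of s] s by (auto simp: weight_class_iff defs dvd_def)
  obtain k' where k': "x' + y' * int a = int n * k'"
    using vertex_weight[of "Suc s"] s by (auto simp: weight_class_iff defs dvd_def)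
  have "int n * (y' * k - y * k') = y' * (x + y * int a) - y * (x' + y' * int a)"
    unfolding k k' by (simp add: algebra_simps)
  also have "\<dots> = int n * 1"
    using d by (simp add: algebra_simps)
  finally have kk: "y' * k - y * k' = 1"
    using n0 by simp
  have "int n * (i + j * int a) = int n * i + (int n * j) * int a"
    by (simp add: algebra_simps)
  also have "\<dots> = A * (x + y * int a) + B * (x' + y' * int a)"
    unfolding i[symmetric] j[symmetric] by (simp add: algebra_simps)
  also have "\<dots> = int n * (A * k + B * k')"
    unfolding k k' by (simp add: algebra_simps)
  finally have "i + j * int a = A * k + B * k'"
    using n0 by simp
  moreover have "A * k + B * k' - t = (A - t * y') * k + (B + t * y) * k' + t * (y' * k - y * k' - 1)"
    by (simp add: algebra_simps)
  moreover have "int n dvd (A - t * y') * k + (B + t * y) * k' + t * (y' * k - y * k' - 1)"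
    unfolding kk unfolding defs
    by (rule dvd_add[OF dvd_add[OF dvd_mult2[OF A(2)] dvd_mult2[OF B(2)]]]) simp
  ultimately have "?w \<in> weight_class t"
    using ij by (simp add: weight_class_iff)
  with L R show ?thesis by blast
qed

lemma cones_disjoint:
  assumes "s < r" "r < e" "0 < left_coord s w" "0 \<le> right_coord r w"
  shows False
proof -
  have "fst w * vy r \<le> snd w * vx r"
    using assms(4) by (simp add: right_coord_def flip: of_nat_mult)
  moreover have "snd w * vx (Suc s) < fst w * vy (Suc s)"
    using assms(3) by (simp add: left_coord_def flip: of_nat_mult)
  moreover have "snd w * vx r \<le> snd w * vx (Suc s)"
    using vx_antimono[of "Suc s" r] assms by simp
  moreover have "fst w * vy (Suc s) \<le> fst w * vy r"
    using vy_mono[of "Suc s" r] assms by simp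
  ultimately show False by linarith
qed

text \<open>For all cones and all pairs \<open>p, q\<close> with \<open>p + q < m\<close> there is an exponent of weight \<open>t\<close> whose rounded
  coordinates are \<open>p + 1\<close> and \<open>q\<close>. Its coordinate sum is less than \<open>n (m + 2)\<close>, too small for
  \<open>\<mm>\<^sup>m\<^sup>+\<^sup>2 M\<^sub>t\<close>. Starting the left coordinate at \<open>1\<close> keeps different cones apart, because it excludes
  the ray that a cone shares with the next one.\<close>

lemma colength_lower: "e * (m * Suc m) \<le> 2 * card (colength_set (m + 2) t)"
proof -
  let ?B = "{..<e} \<times> {(p, q). p + q < m}"
  let ?A = "\<lambda>s p. int n * (int p + 1) + (t * int (vy (Suc s))) mod int n"
  let ?C = "\<lambda>s q. int n * int q + (- t * int (vy s)) mod int n"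
  have n0: "0 < int n" using n_gt_1 by simp
  have "\<exists>w\<in>weight_class t. left_coord s w = ?A s p \<and> right_coord s w = ?C s q" if "s < e" for s p q
  proof (rule exists_with_coords[OF that])
    show "0 \<le> ?A s p" "0 \<le> ?C s q" using n0 by auto
    show "int n dvd ?A s p - t * int (vy (Suc s))"
      by (simp add: mod_eq_dvd_iff[symmetric])
    have "int n dvd ?C s q - (- t * int (vy s))"
      by (simp only: mod_eq_dvd_iff[symmetric]) simp
    then show "int n dvd ?C s q + t * int (vy s)" by simp
  qed
  then obtain w where w: "\<And>s p q. s < e \<Longrightarrow> w s p q \<in> weight_class t \<and>
      left_coord s (w s p q) = ?A s p \<and> right_coord s (w s p q) = ?C s q"
    by metis
  have wL: "left_coord s (w s p q) = ?A s p" and wR: "right_coord s (w s p q) = ?C s q"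
    if "s < e" for s p q
    using w[OF that] by blast+
  have Apos: "0 < ?A s p" and Cpos: "0 \<le> ?C s q" for s p q
  proof -
    have "0 \<le> int n * int p" "0 \<le> int n * int q" by simp_all
    then show "0 < ?A s p" "0 \<le> ?C s q"
      using n0 pos_mod_sign[OF n0, of "t * int (vy (Suc s))"] pos_mod_sign[OF n0, of "- t * int (vy s)"]
      by (auto simp only: distrib_left mult_1_right)
  qed
  have Lpos: "0 < left_coord s (w s p q)" if "s < e" for s p q
    unfolding wL[OF that] by (rule Apos)
  have Rpos: "0 \<le> right_coord s (w s p q)" if "s < e" for s p q
    unfolding wR[OF that] by (rule Cpos)
  let ?f = "\<lambda>(s, p, q). w s p q"
  have inj: "inj_on ?f ?B"
  proof (rule inj_onI)
    fix b b' assume "b \<in> ?B" "b' \<in> ?B" and eq': "?f b = ?f b'"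
    then obtain s p q s' p' q' where b: "b = (s, p, q)" "b' = (s', p', q')" "s < e" "s' < e"
      by auto
    have eq: "w s p q = w s' p' q'" using eq' b by simp
    have ss: "s = s'"
      using cones_disjoint[of s s' "w s p q"] cones_disjoint[of s' s "w s p q"] b
        Lpos[OF b(3), of p q] Lpos[OF b(4), of p' q'] Rpos[OF b(3), of p q] Rpos[OF b(4), of p' q']
      unfolding eq by (metis less_linear)
    have eq2: "w s p q = w s p' q'" using eq ss by simp
    have "?A s p = ?A s p'"
      using wL[OF b(3), of p q] wL[OF b(3), of p' q'] unfolding eq2 by (rule trans[OF sym])
    moreover have "?C s q = ?C s q'"
      using wR[OF b(3), of p q] wR[OF b(3), of p' q'] unfolding eq2 by (rule trans[OF sym])
    ultimately have "p = p'" "q = q'"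
      using n0 by simp_all
    then show "b = b'" by (simp add: b ss)
  qed
  have sub: "?f ` ?B \<subseteq> colength_set (m + 2) t"
  proof
    fix v assume "v \<in> ?f ` ?B"
    then obtain b where b: "v = ?f b" "b \<in> ?B" by (rule imageE)
    obtain s p q where spq: "b = (s, p, q)" by (cases b)
    have v: "v = w s p q" "s < e" "p + q < m" using b spq by auto
    have "?A s p + ?C s q < (int n * (int p + 1) + int n) + (int n * int q + int n)"
      by (intro add_strict_mono add_strict_left_mono pos_mod_bound n0)
    also have "\<dots> = int n * (int (p + q) + 3)" by (simp add: algebra_simps)
    also have "\<dots> \<le> int n * int (m + 2)"
      using v(3) n0 by (intro mult_left_mono) auto
    finally have "v \<notin> exps_pow_class (m + 2) t"
      using coord_sum_pow_class[OF v(2), of v "m + 2" t] unfolding v(1) wL[OF v(2)] wR[OF v(2)]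
      by linarith
    then show "v \<in> colength_set (m + 2) t"
      using w[OF v(2)] v(1) by (simp add: colength_set_def)
  qed
  have "card ?B \<le> card (colength_set (m + 2) t)"
    using colength_upper[of "m + 2" t] by (intro card_inj_on_le[OF inj sub]) auto
  then have "e * (2 * card {(p, q). p + q < m}) \<le> 2 * card (colength_set (m + 2) t)"
    by (simp add: card_cartesian_product)
  then show ?thesis using card_sum_less[of m] by simp
qed

lemma colength_limit:
  "(\<lambda>l. 2 * real (card (colength_set l t)) / real l ^ 2) \<longlonglongrightarrow> real e"
proof (rule real_tendsto_sandwich)
  have bounds: "real e - (3 * real e) / real l \<le> 2 * real (card (colength_set l t)) / real l ^ 2 \<and>
      2 * real (card (colength_set l t)) / real l ^ 2 \<le> real e + real e / real l" if "l \<ge> 2" for l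
  proof -
    define m where "m = l - 2"
    have l: "l = m + 2" using that by (simp add: m_def)
    have "real (e * (m * Suc m)) \<le> real (2 * card (colength_set l t))"
      using colength_lower[of m t] l by (simp only: of_nat_le_iff)
    then have lo: "real e * ((real l - 2) * (real l - 1)) \<le> 2 * real (card (colength_set l t))"
      by (simp add: l algebra_simps)
    have "real (2 * card (colength_set l t)) \<le> real (e * (l * Suc l))"
      using colength_upper[of l t] by (simp only: of_nat_le_iff)
    then have hi: "2 * real (card (colength_set l t)) \<le> real e * (real l * (real l + 1))"
      by (simp add: algebra_simps)
    have lp: "0 < real l" using that by simp
    have "(real e - (3 * real e) / real l) * real l ^ 2 = real e * (real l ^ 2 - 3 * real l)"
      using lp by (simp add: field_simps power2_eq_square)
    also have "\<dots> \<le> real e * ((real l - 2) * (real l - 1))"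
      by (intro mult_left_mono) (auto simp: power2_eq_square algebra_simps)
    finally have 1: "(real e - (3 * real e) / real l) * real l ^ 2 \<le> 2 * real (card (colength_set l t))"
      using lo by linarith
    have "(real e + real e / real l) * real l ^ 2 = real e * (real l * (real l + 1))"
      using lp by (simp add: distrib_left distrib_right power2_eq_square)
    then have 2: "2 * real (card (colength_set l t)) \<le> (real e + real e / real l) * real l ^ 2"
      using hi by linarith
    show ?thesis
      using 1 2 zero_less_power[OF lp, of 2] by (simp only: pos_le_divide_eq pos_divide_le_eq)
  qed
  show "\<forall>\<^sub>F l in sequentially. real e - (3 * real e) / real l \<le> 2 * real (card (colength_set l t)) / real l ^ 2"
    using bounds by (auto simp: eventually_sequentially)
  show "\<forall>\<^sub>F l in sequentially. 2 * real (card (colength_set l t)) / real l ^ 2 \<le> real e + real e / real l"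
    using bounds by (auto simp: eventually_sequentially)
  show "(\<lambda>l. real e - (3 * real e) / real l) \<longlonglongrightarrow> real e"
    using tendsto_diff[OF tendsto_const lim_const_over_n, of "real e" "3 * real e"] by simp
  show "(\<lambda>l. real e + real e / real l) \<longlonglongrightarrow> real e"
    using tendsto_add[OF tendsto_const lim_const_over_n, of "real e" "real e"] by simp
qed

end

section \<open>Power series in two variables\<close>

definition coef :: "'k::field fps fps \<Rightarrow> nat \<times> nat \<Rightarrow> 'k"
  where "coef f w = fps_nth (fps_nth f (snd w)) (fst w)"

definition of_coef :: "(nat \<times> nat \<Rightarrow> 'k::field) \<Rightarrow> 'k fps fps"
  where "of_coef c = Abs_fps (\<lambda>j. Abs_fps (\<lambda>i. c (i, j)))"

definition xy_monomial :: "nat \<times> nat \<Rightarrow> 'k::field fps fps"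
  where "xy_monomial w = var_x ^ fst w * var_y ^ snd w"

text \<open>The invariant ring, its maximal ideal \<open>\<mm>\<close>, the modules \<open>M\<^sub>t\<close> and \<open>\<mm>\<^sup>l M\<^sub>t\<close> are all of this form.\<close>

definition supported :: "(nat \<times> nat) set \<Rightarrow> 'k::field fps fps set"
  where "supported D = {f. \<forall>w. coef f w \<noteq> 0 \<longrightarrow> w \<in> D}"

definition res :: "(nat \<times> nat) set \<Rightarrow> 'k::field fps fps \<Rightarrow> 'k fps fps"
  where "res D f = of_coef (\<lambda>w. if w \<in> D then coef f w else 0)"

lemma coef_of_coef [simp]: "coef (of_coef c) w = c w"
  by (simp add: coef_def of_coef_def)

lemma coef_ext: "(\<And>w. coef f w = coef g w) \<Longrightarrow> f = g"
  by (rule fps_ext, rule fps_ext) (metis coef_def fst_conv snd_conv)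

lemma coef_0 [simp]: "coef 0 w = 0"
  and coef_add [simp]: "coef (f + g) w = coef f w + coef g w"
  and coef_diff [simp]: "coef (f - g) w = coef f w - coef g w"
  and coef_minus [simp]: "coef (- f) w = - coef f w"
  and coef_1: "coef 1 w = (if w = 0 then 1 else 0)"
  by (auto simp: coef_def prod_eq_iff)

lemma coef_sum [simp]: "coef (sum f A) w = (\<Sum>x\<in>A. coef (f x) w)"
  by (simp add: coef_def fps_sum_nth)

lemma coef_scalar_mult [simp]: "coef (scalar c * f) w = c * coef f w"
  by (simp add: coef_def scalar_def)

lemma below_eq: "{u. u \<unlhd> w} = {0..fst w} \<times> {0..snd w}"
  by (auto simp: prod_eq_iff)

lemma finite_below [simp]: "finite {u. u \<unlhd> w}"
  by (simp add: below_eq)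

lemma coef_mult: "coef (f * g) w = (\<Sum>u | u \<unlhd> w. coef f u * coef g (w - u))"
proof -
  have "coef (f * g) w = (\<Sum>q=0..snd w. \<Sum>p=0..fst w. coef f (p, q) * coef g (w - (p, q)))"
    by (simp add: coef_def fps_mult_nth fps_sum_nth)
  also have "\<dots> = (\<Sum>p=0..fst w. \<Sum>q=0..snd w. coef f (p, q) * coef g (w - (p, q)))"
    by (rule sum.swap)
  also have "\<dots> = (\<Sum>u | u \<unlhd> w. coef f u * coef g (w - u))"
    by (simp add: below_eq sum.cartesian_product case_prod_unfold)
  finally show ?thesis .
qed

lemma xy_monomial_altdef: "xy_monomial w = fps_const (fps_X ^ fst w) * fps_X ^ snd w"
  by (simp add: xy_monomial_def var_x_def var_y_def)

lemma coef_xy_monomial_mult: "coef (xy_monomial w * f) v = (if w \<unlhd> v then coef f (v - w) else 0)"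
  by (simp add: coef_def xy_monomial_altdef mult.assoc fps_X_power_mult_nth)

lemma coef_xy_monomial: "coef (xy_monomial w) v = (if v = w then 1 else 0)"
  using coef_xy_monomial_mult[of w 1 v] by (auto simp: coef_1 prod_eq_iff)

lemma xy_monomial_0: "xy_monomial 0 = 1"
  by (simp add: xy_monomial_def)

lemma xy_monomial_add: "xy_monomial (u + v) = xy_monomial u * xy_monomial v"
  by (simp add: xy_monomial_def power_add mult_ac)

lemma xy_monomial_power: "xy_monomial w ^ k = xy_monomial (k * fst w, k * snd w)"
  by (simp add: xy_monomial_def power_mult_distrib power_mult[symmetric] mult.commute)

lemma xy_monomial_neq_0: "xy_monomial w \<noteq> 0"
proof
  assume "xy_monomial w = (0 :: 'a fps fps)"
  then have "coef (xy_monomial w :: 'a fps fps) w = 0" by simp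
  then show False by (simp add: coef_xy_monomial)
qed

lemma supportedD: "f \<in> supported D \<Longrightarrow> w \<notin> D \<Longrightarrow> coef f w = 0"
  unfolding supported_def by blast

lemma supported_0 [simp]: "0 \<in> supported D"
  by (simp add: supported_def)

lemma supported_add: "f \<in> supported D \<Longrightarrow> g \<in> supported D \<Longrightarrow> f + g \<in> supported D"
  by (auto simp: supported_def) (metis add_0)

lemma supported_minus: "f \<in> supported D \<Longrightarrow> - f \<in> supported D"
  by (auto simp: supported_def)

lemma supported_diff: "f \<in> supported D \<Longrightarrow> g \<in> supported D \<Longrightarrow> f - g \<in> supported D"
  using supported_add[of f D "- g"] supported_minus[of g D] by simp

lemma supported_sum: "(\<And>x. x \<in> A \<Longrightarrow> f x \<in> supported D) \<Longrightarrow> sum f A \<in> supported D"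
  by (induction A rule: infinite_finite_induct) (auto intro: supported_add)

lemma supported_mono: "f \<in> supported D \<Longrightarrow> D \<subseteq> D' \<Longrightarrow> f \<in> supported D'"
  by (auto simp: supported_def)

lemma supported_UNIV [simp]: "f \<in> supported UNIV"
  by (simp add: supported_def)

lemma supported_scalar_mult: "f \<in> supported D \<Longrightarrow> scalar c * f \<in> supported D"
  by (auto simp: supported_def)

lemma supported_xy_monomial: "w \<in> D \<Longrightarrow> xy_monomial w \<in> supported D"
  by (auto simp: supported_def coef_xy_monomial split: if_splits)

lemma supported_mult:
  assumes "f \<in> supported A" "g \<in> supported B" "\<And>u v. u \<in> A \<Longrightarrow> v \<in> B \<Longrightarrow> u + v \<in> D"
  shows "f * g \<in> supported D"
  unfolding supported_def
proof (intro CollectI allI impI)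
  fix w assume "coef (f * g) w \<noteq> 0"
  then obtain u where u: "u \<unlhd> w" "coef f u * coef g (w - u) \<noteq> 0"
    unfolding coef_mult by (metis (mono_tags, lifting) mem_Collect_eq sum.not_neutral_contains_not_neutral)
  then have "u \<in> A" "w - u \<in> B"
    using supportedD[OF assms(1)] supportedD[OF assms(2)] by (metis mult_zero_left mult_zero_right)+
  from assms(3)[OF this] have "u + (w - u) \<in> D" .
  moreover have "u + (w - u) = w" using u(1) by (auto simp: prod_eq_iff)
  ultimately show "w \<in> D" by simp
qed

lemma coef_res [simp]: "coef (res D f) w = (if w \<in> D then coef f w else 0)"
  by (simp add: res_def)

lemma res_supported: "res D f \<in> supported D"
  by (auto simp: supported_def)

lemma res_id: "f \<in> supported D \<Longrightarrow> res D f = f"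
  by (rule coef_ext) (auto simp: supported_def)

lemma res_sum: "res D (sum f A) = (\<Sum>x\<in>A. res D (f x))"
  by (rule coef_ext) simp

text \<open>For the set \<open>D\<close> of exponents of one weight and \<open>A\<close> of weight \<open>0\<close>, this says that the projection of the
  power series ring onto \<open>M\<^sub>t\<close> is linear over the invariant ring.\<close>

lemma res_mult:
  assumes g: "g \<in> supported A"
    and iff: "\<And>u v. v \<in> A \<Longrightarrow> u + v \<in> D \<longleftrightarrow> u \<in> D"
  shows "res D (f * g) = res D f * g"
proof (rule coef_ext)
  fix w
  have eq: "(if w \<in> D then coef f u * coef g (w - u) else 0) = coef (res D f) u * coef g (w - u)"
    if "u \<unlhd> w" for u
  proof (cases "w - u \<in> A")
    case True
    have "u + (w - u) = w" using that by (auto simp: prod_eq_iff)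
    then show ?thesis using iff[OF True, of u] by simp
  next
    case False
    then show ?thesis using supportedD[OF g] by simp
  qed
  have "coef (res D (f * g)) w = (\<Sum>u | u \<unlhd> w. if w \<in> D then coef f u * coef g (w - u) else 0)"
    by (simp add: coef_mult)
  also have "\<dots> = coef (res D f * g) w"
    unfolding coef_mult by (intro sum.cong refl eq) simp
  finally show "coef (res D (f * g)) w = coef (res D f * g) w" .
qed

text \<open>A power series module on \<open>E\<close> is generated by finitely many monomials as soon as its exponents are: send
  each exponent to a chosen generator and collect the coefficients that go to the same one.\<close>

lemma supported_decompose:
  assumes f: "f \<in> supported E" and F: "finite F"
    and red: "\<And>w. w \<in> E \<Longrightarrow> \<exists>u\<in>F. u \<unlhd> w \<and> w - u \<in> A"
  shows "\<exists>r. (\<forall>u. r u \<in> supported A) \<and> f = (\<Sum>u\<in>F. xy_monomial u * r u)"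
proof -
  define g where "g w = (SOME u. u \<in> F \<and> u \<unlhd> w \<and> w - u \<in> A)" for w
  have g: "g w \<in> F \<and> g w \<unlhd> w \<and> w - g w \<in> A" if "w \<in> E" for w
    unfolding g_def using red[OF that] by (intro someI_ex[of "\<lambda>u. u \<in> F \<and> u \<unlhd> w \<and> w - u \<in> A"]) blast
  define r where "r u = of_coef (\<lambda>v. if u + v \<in> E \<and> g (u + v) = u then coef f (u + v) else 0)" for u
  have "r u \<in> supported A" for u
  proof (unfold supported_def, intro CollectI allI impI)
    fix v assume "coef (r u) v \<noteq> 0"
    then have "u + v \<in> E" "g (u + v) = u" by (auto simp: r_def split: if_splits)
    then show "v \<in> A" using g[of "u + v"] by simp
  qed
  moreover have "f = (\<Sum>u\<in>F. xy_monomial u * r u)"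
  proof (rule coef_ext)
    fix w
    have *: "coef (xy_monomial u * r u) w = (if u = g w \<and> w \<in> E then coef f w else 0)" if "u \<in> F" for u
    proof (cases "u \<unlhd> w")
      case True
      then have "u + (w - u) = w" by (auto simp: prod_eq_iff)
      then show ?thesis using True by (auto simp: coef_xy_monomial_mult r_def)
    next
      case False
      then have "\<not> (u = g w \<and> w \<in> E)" using g by blast
      then show ?thesis using False by (simp only: coef_xy_monomial_mult if_False)
    qed
    show "coef f w = coef (\<Sum>u\<in>F. xy_monomial u * r u) w"
    proof (cases "w \<in> E")
      case True
      then have "g w \<in> F" using g by blast
      then show ?thesis using True F by (simp add: *)
    next
      case False
      then show ?thesis using supportedD[OF f] by (simp add: *)
    qed
  qed
  ultimately show ?thesis by blast
qed

lemma supported_xy_monomial_factor: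
  assumes "f \<in> supported E" "\<And>w. w \<in> E \<Longrightarrow> u \<unlhd> w \<and> w - u \<in> A"
  shows "\<exists>r\<in>supported A. f = xy_monomial u * r"
proof -
  have "\<exists>v\<in>{u}. v \<unlhd> w \<and> w - v \<in> A" if "w \<in> E" for w
    using assms(2)[OF that] by blast
  from supported_decompose[OF assms(1) _ this] obtain r where
    "\<forall>v. r v \<in> supported A" "f = (\<Sum>v\<in>{u}. xy_monomial v * r v)" by blast
  then have "r u \<in> supported A" "f = xy_monomial u * r u" by (blast, simp)
  then show ?thesis by blast
qed

lemma exists_inverse:
  assumes "coef f 0 \<noteq> 0"
  shows "\<exists>g. f * g = 1"
proof -
  have "fps_nth (fps_nth f 0) 0 \<noteq> 0"
    using assms by (simp add: coef_def)
  then have "fps_nth f 0 * inverse (fps_nth f 0) = 1"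
    by (rule inverse_mult_eq_1')
  then show ?thesis
    using fps_right_inverse by blast
qed

text \<open>Of the minimal elements, only finitely many have a first coordinate bounded by that of a fixed minimal
  element, since no two of them share it; the same holds for the second coordinate, and every minimal
  element satisfies one of the two bounds.\<close>

lemma dickson:
  fixes E :: "(nat \<times> nat) set"
  shows "\<exists>F\<subseteq>E. finite F \<and> (\<forall>w\<in>E. \<exists>u\<in>F. u \<unlhd> w)"
proof -
  define F where "F = {w \<in> E. \<forall>u\<in>E. u \<unlhd> w \<longrightarrow> u = w}"
  have ex: "\<exists>u\<in>F. u \<unlhd> w" if "w \<in> E" for w
    using that
  proof (induction "fst w + snd w" arbitrary: w rule: less_induct)
    case less
    show ?case
    proof (cases "w \<in> F")
      case True
      then show ?thesis by blast
    next
      case False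
      then obtain u where u: "u \<in> E" "u \<unlhd> w" "u \<noteq> w"
        using less.prems unfolding F_def by blast
      then have "fst u + snd u < fst w + snd w"
        by (auto simp: prod_eq_iff)
      from less.hyps[OF this u(1)] show ?thesis
        using u(2) le_trans by blast
    qed
  qed
  have anti: "u = w" if "u \<in> F" "w \<in> F" "u \<unlhd> w" for u w
    using that by (auto simp: F_def)
  have "finite F"
  proof (cases "F = {}")
    case False
    then obtain w0 where w0: "w0 \<in> F" by blast
    let ?A = "{w \<in> F. fst w \<le> fst w0}" and ?B = "{w \<in> F. snd w \<le> snd w0}"
    have "inj_on fst ?A"
      by (rule inj_onI) (metis (mono_tags, lifting) anti le_refl mem_Collect_eq nle_le)
    moreover have "fst ` ?A \<subseteq> {..fst w0}" by auto
    ultimately have A: "finite ?A" by (meson finite_atMost finite_imageD finite_subset)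
    have "inj_on snd ?B"
      by (rule inj_onI) (metis (mono_tags, lifting) anti le_refl mem_Collect_eq nle_le)
    moreover have "snd ` ?B \<subseteq> {..snd w0}" by auto
    ultimately have B: "finite ?B" by (meson finite_atMost finite_imageD finite_subset)
    have "F \<subseteq> ?A \<union> ?B"
    proof
      fix w assume w: "w \<in> F"
      then show "w \<in> ?A \<union> ?B"
        using anti[of w0 w] w0 by (cases "fst w \<le> fst w0 \<or> snd w \<le> snd w0") auto
    qed
    then show ?thesis using A B by (meson finite_UnI finite_subset)
  qed simp
  moreover have "F \<subseteq> E" by (auto simp: F_def)
  ultimately show ?thesis using ex by blast
qed

lemma fps_nth_0_eq_0_iff: "fps_nth f 0 = 0 \<longleftrightarrow> (\<forall>i. coef f (i, 0) = 0)"
  by (simp add: coef_def fps_eq_iff)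

lemma xy_monomial_supported_iff: "xy_monomial w \<in> (supported D :: 'k::field fps fps set) \<longleftrightarrow> w \<in> D"
  by (cases w) (simp add: supported_def coef_xy_monomial)

lemma coef_mult_0: "coef (f * g) 0 = coef f 0 * coef g 0"
  by (simp add: coef_def)

section \<open>Weierstrass division and relations over the series in one variable\<close>

text \<open>A series in \<open>y\<close> over the series in \<open>x\<close> is divided by \<open>f\<close>, whose constant term is \<open>x\<^sup>m\<close> times a unit. The
  coefficient of \<open>y\<^sup>j\<close> in the quotient is chosen to cancel all powers of \<open>x\<close> from \<open>x\<^sup>m\<close> on in the
  coefficient of \<open>y\<^sup>j\<close> in the remainder.\<close>

fun weierstrass_quotient :: "'k::field fps fps \<Rightarrow> 'k fps fps \<Rightarrow> nat \<Rightarrow> 'k fps"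
  where "weierstrass_quotient f h j =
    fps_shift (subdegree (fps_nth f 0))
      (fps_nth h j - (\<Sum>p<j. weierstrass_quotient f h p * fps_nth f (j - p))) *
    inverse (fps_shift (subdegree (fps_nth f 0)) (fps_nth f 0))"

declare weierstrass_quotient.simps [simp del]

lemma weierstrass_division:
  assumes "fps_nth f 0 \<noteq> 0"
  shows "\<exists>q. \<forall>w. subdegree (fps_nth f 0) \<le> fst w \<longrightarrow> coef (h - q * f) w = 0"
proof -
  let ?m = "subdegree (fps_nth f 0)"
  let ?u = "fps_shift ?m (fps_nth f 0)"
  let ?Q = "weierstrass_quotient f h"
  define q where "q = Abs_fps ?Q"
  have u: "?u * inverse ?u = 1"
    using assms by (intro inverse_mult_eq_1') simp
  have f0: "fps_nth f 0 = ?u * fps_X ^ ?m"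
    by (rule subdegree_decompose)
  have "fps_nth (fps_nth (h - q * f) j) i = 0" if "?m \<le> i" for i j
  proof -
    define D where "D = fps_nth h j - (\<Sum>p<j. ?Q p * fps_nth f (j - p))"
    have "fps_nth (q * f) j = (\<Sum>p\<le>j. ?Q p * fps_nth f (j - p))"
      by (simp add: fps_mult_nth q_def atLeast0AtMost)
    also have "\<dots> = (\<Sum>p<j. ?Q p * fps_nth f (j - p)) + ?Q j * fps_nth f 0"
      by (simp add: lessThan_Suc_atMost[symmetric])
    finally have "fps_nth (h - q * f) j = D - ?Q j * fps_nth f 0"
      by (simp add: D_def)
    also have "?Q j = fps_shift ?m D * inverse ?u"
      unfolding D_def by (subst weierstrass_quotient.simps) (rule refl)
    also have "fps_shift ?m D * inverse ?u * fps_nth f 0 = fps_shift ?m D * (?u * inverse ?u) * fps_X ^ ?m"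
      by (subst f0) (simp only: mult_ac)
    also have "\<dots> = fps_shift ?m D * fps_X ^ ?m"
      by (simp add: u)
    finally show ?thesis
      using that by (simp add: fps_X_power_mult_right_nth)
  qed
  then show ?thesis
    by (intro exI[of _ q]) (simp add: coef_def)
qed

text \<open>Elimination without fractions: if some vector has a nonzero entry at \<open>j\<close>, cross-multiply with it to
  clear that entry in the others and recurse.\<close>

lemma linear_dependence:
  fixes V :: "'i \<Rightarrow> 'j \<Rightarrow> 'a::idom"
  assumes "finite J" "finite I" "card J < card I"
  shows "\<exists>c. (\<exists>k\<in>I. c k \<noteq> 0) \<and> (\<forall>j\<in>J. (\<Sum>k\<in>I. c k * V k j) = 0)"
  using assms
proof (induction J arbitrary: I V rule: finite_induct)
  case empty
  then have "I \<noteq> {}" by auto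
  then show ?case by (intro exI[of _ "\<lambda>_. 1"]) auto
next
  case (insert j J)
  show ?case
  proof (cases "\<forall>k\<in>I. V k j = 0")
    case True
    have "card J < card I" using insert by simp
    then obtain c where "\<exists>k\<in>I. c k \<noteq> 0" "\<forall>j\<in>J. (\<Sum>k\<in>I. c k * V k j) = 0"
      using insert.IH[of I V] insert.prems by blast
    then show ?thesis using True by (intro exI[of _ c]) auto
  next
    case False
    then obtain p where p: "p \<in> I" "V p j \<noteq> 0" by blast
    let ?I = "I - {p}"
    have "card J < card ?I" using insert p by simp
    then obtain c where c: "\<exists>k\<in>?I. c k \<noteq> 0"
      "\<forall>i\<in>J. (\<Sum>k\<in>?I. c k * (V p j * V k i - V k j * V p i)) = 0"
      using insert.IH[of ?I "\<lambda>k i. V p j * V k i - V k j * V p i"] insert.prems by auto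
    define d where "d k = (if k = p then - (\<Sum>k\<in>?I. c k * V k j) else V p j * c k)" for k
    have split: "(\<Sum>k\<in>I. d k * V k i) = (\<Sum>k\<in>?I. c k * (V p j * V k i - V k j * V p i))" for i
    proof -
      have "(\<Sum>k\<in>I. d k * V k i) = d p * V p i + (\<Sum>k\<in>?I. d k * V k i)"
        using insert.prems(1) p(1) by (rule sum.remove)
      also have "(\<Sum>k\<in>?I. d k * V k i) = (\<Sum>k\<in>?I. V p j * c k * V k i)"
        by (intro sum.cong) (auto simp: d_def)
      also have "d p * V p i = (\<Sum>k\<in>?I. - (c k * V k j * V p i))"
        by (simp add: d_def sum_distrib_right sum_negf)
      finally show ?thesis
        by (simp add: sum.distrib[symmetric] algebra_simps)
    qed
    have "(\<Sum>k\<in>I. d k * V k i) = 0" if "i \<in> insert j J" for i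
    proof (cases "i = j")
      case True
      then show ?thesis unfolding split by (simp add: mult.commute)
    next
      case False
      then show ?thesis unfolding split using c(2) that by blast
    qed
    moreover have "\<exists>k\<in>I. d k \<noteq> 0"
    proof -
      obtain k where "k \<in> ?I" "c k \<noteq> 0" using c(1) by blast
      then show ?thesis using p by (intro bexI[of _ k]) (auto simp: d_def)
    qed
    ultimately show ?thesis by blast
  qed
qed

definition column :: "'k::field fps fps \<Rightarrow> nat \<Rightarrow> 'k fps"
  where "column f i = Abs_fps (\<lambda>j. coef f (i, j))"

definition in_y :: "'k::field fps \<Rightarrow> 'k fps fps"
  where "in_y c = of_coef (\<lambda>w. if fst w = 0 then fps_nth c (snd w) else 0)"

lemma column_in_y_mult: "column (in_y c * f) i = c * column f i"
proof (rule fps_ext)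
  fix j
  have "coef (in_y c * f) (i, j) = (\<Sum>u\<in>{0..i}\<times>{0..j}. coef (in_y c) u * coef f ((i, j) - u))"
    unfolding coef_mult below_eq by simp
  also have "\<dots> = (\<Sum>u\<in>{0}\<times>{0..j}. coef (in_y c) u * coef f ((i, j) - u))"
    by (rule sum.mono_neutral_right) (auto simp: in_y_def)
  also have "\<dots> = (\<Sum>q=0..j. fps_nth c q * coef f (i, j - q))"
    unfolding sum.cartesian_product[symmetric, of _ "{0..j}" "{0}", simplified]
    by (simp add: sum.cartesian_product' in_y_def)
  finally show "fps_nth (column (in_y c * f) i) j = fps_nth (c * column f i) j"
    by (simp add: column_def fps_mult_nth)
qed

lemma column_sum: "column (sum f A) i = (\<Sum>x\<in>A. column (f x) i)"
  by (rule fps_ext) (simp add: column_def fps_sum_nth)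

lemma column_ext: "(\<And>i. column f i = column g i) \<Longrightarrow> f = g"
  by (rule coef_ext) (metis column_def fps_nth_Abs_fps prod.collapse)

text \<open>The series with powers of \<open>x\<close> below \<open>x\<^sup>m\<close> form a module of rank \<open>m\<close> over the series in \<open>y\<close>. Hence the
  remainders of \<open>1, h, \<dots>, h\<^sup>m\<close> modulo \<open>f\<close> are dependent over that ring.\<close>

lemma relation_over_y:
  fixes f h :: "'k::field fps fps"
  assumes "fps_nth f 0 \<noteq> 0"
  shows "\<exists>c m Q. (\<exists>k\<le>m. c k \<noteq> 0) \<and> (\<Sum>k\<le>m. in_y (c k) * h ^ k) = Q * f"
proof -
  let ?m = "subdegree (fps_nth f 0)"
  obtain q where q: "\<And>k w. ?m \<le> fst w \<Longrightarrow> coef (h ^ k - q k * f) w = 0"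
    using weierstrass_division[OF assms, of "h ^ _"] by metis
  define r where "r k = h ^ k - q k * f" for k
  obtain c where c: "\<exists>k\<in>{..?m}. c k \<noteq> 0" "\<forall>i\<in>{..<?m}. (\<Sum>k\<in>{..?m}. c k * column (r k) i) = 0"
    using linear_dependence[of "{..<?m}" "{..?m}" "\<lambda>k i. column (r k) i"] by auto
  have "(\<Sum>k\<le>?m. in_y (c k) * r k) = 0"
  proof (rule column_ext)
    fix i
    have "column (r k) i = 0" if "?m \<le> i" for k
      using q[of "(i, _)" k] that by (intro fps_ext) (simp add: column_def r_def)
    then have "(\<Sum>k\<le>?m. c k * column (r k) i) = 0"
      using c(2) by (cases "i < ?m") auto
    moreover have "column (0 :: 'k fps fps) i = 0"
      by (rule fps_ext) (simp add: column_def)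
    ultimately show "column (\<Sum>k\<le>?m. in_y (c k) * r k) i = column 0 i"
      by (simp add: column_sum column_in_y_mult)
  qed
  then have "(\<Sum>k\<le>?m. in_y (c k) * h ^ k) - (\<Sum>k\<le>?m. in_y (c k) * q k) * f = 0"
    by (simp add: r_def algebra_simps sum_subtractf sum_distrib_left sum_distrib_right)
  then have "(\<Sum>k\<le>?m. in_y (c k) * h ^ k) = (\<Sum>k\<le>?m. in_y (c k) * q k) * f"
    by simp
  moreover have "\<exists>k\<le>?m. c k \<noteq> 0" using c(1) by blast
  ultimately show ?thesis by blast
qed

section \<open>The invariant series and the boundary ideal\<close>

context cyclic_weights begin

text \<open>The elements of the invariant ring as plain series; that this is the carrier of the ring is shown
  in \<open>carrier_IR\<close>.\<close>

definition RR :: "'k::field fps fps set"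
  where "RR = supported (weight_class 0)"

lemma RR_0 [simp]: "0 \<in> RR"
  by (simp add: RR_def)

lemma RR_scalar [simp]: "scalar c \<in> RR"
proof -
  have "scalar c * 1 \<in> supported (weight_class 0)"
    by (intro supported_scalar_mult) (use supported_xy_monomial[OF zero_in_weight_class] in \<open>simp add: xy_monomial_0\<close>)
  then show ?thesis by (simp add: RR_def)
qed

lemma RR_1 [simp]: "1 \<in> RR"
  using supported_xy_monomial[OF zero_in_weight_class] by (simp add: RR_def xy_monomial_0)

lemma RR_add: "f \<in> RR \<Longrightarrow> g \<in> RR \<Longrightarrow> f + g \<in> RR"
  and RR_minus: "f \<in> RR \<Longrightarrow> - f \<in> RR"
  and RR_diff: "f \<in> RR \<Longrightarrow> g \<in> RR \<Longrightarrow> f - g \<in> RR"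
  by (simp_all add: RR_def supported_add supported_minus supported_diff)

lemma RR_supported_mult: "f \<in> RR \<Longrightarrow> g \<in> supported (weight_class t) \<Longrightarrow> f * g \<in> supported (weight_class t)"
  unfolding RR_def by (erule (1) supported_mult) (rule weight_class_0_add)

lemma RR_mult: "f \<in> RR \<Longrightarrow> g \<in> RR \<Longrightarrow> f * g \<in> RR"
  using RR_supported_mult[of f g 0] by (simp add: RR_def)

lemma RR_power: "f \<in> RR \<Longrightarrow> f ^ k \<in> RR"
  by (induction k) (auto intro: RR_mult)

lemma RR_monomial: "w \<in> weight_class 0 \<Longrightarrow> xy_monomial w \<in> RR"
  by (simp add: RR_def supported_xy_monomial)

lemma RR_sum: "(\<And>x. x \<in> A \<Longrightarrow> f x \<in> RR) \<Longrightarrow> sum f A \<in> RR"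
  unfolding RR_def by (rule supported_sum)

lemma RR_res_mult:
  "g \<in> RR \<Longrightarrow> res (weight_class t) (f * g) = res (weight_class t) f * g"
  unfolding RR_def by (erule res_mult) (rule weight_class_0_add_iff)

lemma RR_res: "res (weight_class 0) f \<in> RR"
  unfolding RR_def by (rule res_supported)

lemma RR_inverse:
  assumes "f \<in> RR" "coef f 0 \<noteq> 0"
  shows "\<exists>g\<in>RR. f * g = 1"
proof -
  obtain g where g: "f * g = 1"
    using exists_inverse[OF assms(2)] by blast
  have "res (weight_class 0) g * f = res (weight_class 0) (g * f)"
    using RR_res_mult[OF assms(1), of 0 g] by simp
  also have "\<dots> = 1"
    using g res_id[OF RR_1[unfolded RR_def]] by (simp only: mult.commute[of g])
  finally show ?thesis
    using RR_res by (intro bexI[of _ "res (weight_class 0) g"]) (auto simp: mult.commute)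
qed

lemma monomial_times_unit:
  assumes g: "g \<in> RR" and w0: "coef g w0 \<noteq> 0" and least: "\<And>w. coef g w \<noteq> 0 \<Longrightarrow> w0 \<unlhd> w"
  shows "w0 \<in> weight_class 0 \<and> (\<exists>v\<in>RR. v * g = xy_monomial w0)"
proof -
  have w0G: "w0 \<in> weight_class 0"
    using g w0 unfolding RR_def supported_def by blast
  let ?E = "{w \<in> weight_class 0. w0 \<unlhd> w}"
  have "g \<in> supported ?E"
    using g least unfolding RR_def supported_def by blast
  then obtain r where r: "r \<in> RR" "g = xy_monomial w0 * r"
    using supported_xy_monomial_factor[of g ?E w0 "weight_class 0"] weight_class_0_diff[OF w0G] unfolding RR_def by blast
  have "coef r 0 \<noteq> 0"
    using w0 unfolding r(2) by (simp add: coef_xy_monomial_mult)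
  from RR_inverse[OF r(1) this] obtain v where "v \<in> RR" "r * v = 1" by blast
  then show ?thesis
    using w0G r(2) by (intro conjI bexI[of _ v]) (auto simp: mult_ac)
qed

text \<open>Project the relation over the series in \<open>y\<close> to the invariant ring, and divide out the first power of \<open>h\<close>
  that occurs. The remaining lowest coefficient is an invariant series in \<open>y\<close>, so it is a power of
  \<open>y\<^sup>n\<close> times a unit.\<close>

lemma relation_in_RR:
  fixes f h :: "'k::field fps fps"
  assumes f: "f \<in> RR" "fps_nth f 0 \<noteq> 0" and h: "h \<in> RR"
  shows "\<exists>p N. \<exists>A\<in>RR. \<exists>B\<in>RR. h ^ p * (xy_monomial (0, n * N) + A * h) = B * f"
proof -
  obtain c m Q where c: "\<exists>k\<le>m. c k \<noteq> 0" and rel: "(\<Sum>k\<le>m. in_y (c k) * h ^ k) = Q * f"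
    using relation_over_y[OF f(2), of h] by blast
  obtain k0 where k0: "k0 \<le> m" "c k0 \<noteq> 0" using c by blast
  obtain b where b: "fps_nth (c k0) b \<noteq> 0"
    using k0(2) by (auto simp: fps_eq_iff)
  \<comment> \<open>a factor \<open>y\<^bsup>(n - 1) b\<^esup>\<close> moves a nonzero coefficient at \<open>y\<^sup>b\<close> to \<open>y\<^bsup>n b\<^esup>\<close>, so it survives the projection\<close>
  define s :: "'k fps fps" where "s = xy_monomial (0, (n - 1) * b)"
  define d where "d k = res (weight_class 0) (s * in_y (c k))" for k
  have dR: "d k \<in> RR" for k by (simp add: d_def RR_res)
  have coef_s: "coef (s * in_y (c k)) w =
      (if (n - 1) * b \<le> snd w \<and> fst w = 0 then fps_nth (c k) (snd w - (n - 1) * b) else 0)" for k w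
    by (auto simp: s_def coef_xy_monomial_mult in_y_def)
  have axis: "fst w = 0" if "coef (d k) w \<noteq> 0" for k w
    using that by (auto simp: d_def coef_s split: if_splits)
  have "(0, n * b) \<in> weight_class 0"
    by (simp add: y_axis_weight)
  moreover have "(n - 1) * b \<le> n * b" "n * b - (n - 1) * b = b"
    using n_gt_1 by (auto simp: algebra_simps)
  ultimately have "coef (d k0) (0, n * b) \<noteq> 0"
    using b by (simp add: d_def coef_s)
  then have d0: "d k0 \<noteq> 0" by auto
  have rel': "(\<Sum>k\<le>m. d k * h ^ k) = res (weight_class 0) (s * Q) * f"
  proof -
    have "(\<Sum>k\<le>m. d k * h ^ k) = (\<Sum>k\<le>m. res (weight_class 0) (s * in_y (c k) * h ^ k))"
      unfolding d_def using h by (simp add: RR_res_mult RR_power)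
    also have "\<dots> = res (weight_class 0) (s * (\<Sum>k\<le>m. in_y (c k) * h ^ k))"
      by (simp add: res_sum sum_distrib_left mult.assoc)
    also have "\<dots> = res (weight_class 0) ((s * Q) * f)"
      by (simp only: rel mult.assoc)
    finally show ?thesis using f(1) by (simp only: RR_res_mult)
  qed
  define p where "p = (LEAST k. d k \<noteq> 0)"
  have dp: "d p \<noteq> 0" unfolding p_def using d0 by (rule LeastI)
  have pm: "p \<le> m" using k0(1) Least_le[of "\<lambda>k. d k \<noteq> 0", OF d0] unfolding p_def by simp
  have low: "d k = 0" if "k < p" for k
    using not_less_Least[of k "\<lambda>k. d k \<noteq> 0"] that unfolding p_def by blast
  define A where "A = (\<Sum>k\<in>{p<..m}. d k * h ^ (k - Suc p))"
  have AR: "A \<in> RR"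
    unfolding A_def using h dR by (intro RR_sum RR_mult RR_power)
  have "(\<Sum>k\<le>m. d k * h ^ k) = (\<Sum>k\<in>insert p {p<..m}. d k * h ^ k)"
    using low pm by (intro sum.mono_neutral_right) auto
  also have "\<dots> = d p * h ^ p + (\<Sum>k\<in>{p<..m}. d k * h ^ k)"
    by simp
  also have "(\<Sum>k\<in>{p<..m}. d k * h ^ k) = (\<Sum>k\<in>{p<..m}. h ^ p * (d k * h ^ (k - Suc p) * h))"
  proof (intro sum.cong refl)
    fix k assume "k \<in> {p<..m}"
    then have "k = p + (k - Suc p) + 1" by simp
    then have "h ^ k = h ^ p * h ^ (k - Suc p) * h"
      by (metis power_add power_one_right)
    then show "d k * h ^ k = h ^ p * (d k * h ^ (k - Suc p) * h)"
      by (simp only: mult_ac)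
  qed
  also have "\<dots> = h ^ p * (A * h)"
    by (simp only: A_def sum_distrib_left sum_distrib_right)
  finally have eq: "h ^ p * (d p + A * h) = res (weight_class 0) (s * Q) * f"
    unfolding rel' by (simp add: algebra_simps)
  define M where "M = (LEAST j. coef (d p) (0, j) \<noteq> 0)"
  have "\<exists>j. coef (d p) (0, j) \<noteq> 0"
  proof (rule ccontr)
    assume no: "\<not> ?thesis"
    have "coef (d p) w = coef 0 w" for w
      using no axis[of p w] by (cases w) auto
    then show False using dp coef_ext by blast
  qed
  then have M: "coef (d p) (0, M) \<noteq> 0"
    unfolding M_def by (rule LeastI_ex)
  have "(0, M) \<unlhd> w" if "coef (d p) w \<noteq> 0" for w
  proof -
    have "w = (0, snd w)" using axis[OF that] by (cases w) auto
    then have "coef (d p) (0, snd w) \<noteq> 0" using that by simp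
    then show ?thesis unfolding M_def by (simp add: Least_le)
  qed
  from monomial_times_unit[OF dR M this]
  obtain v where v: "(0, M) \<in> weight_class 0" "v \<in> RR" "v * d p = xy_monomial (0, M)" by blast
  obtain N where N: "M = n * N" using v(1) by (auto simp: y_axis_weight)
  have "h ^ p * (xy_monomial (0, n * N) + (v * A) * h) = v * (h ^ p * (d p + A * h))"
    unfolding v(3)[unfolded N, symmetric] by (simp add: algebra_simps)
  also have "\<dots> = (v * res (weight_class 0) (s * Q)) * f"
    by (simp only: eq mult.assoc)
  finally show ?thesis
    using v(2) AR RR_res RR_mult by blast
qed

text \<open>The ideal \<open>(f : h\<^sup>\<infinity>) + (h)\<close>, the boundary ideal of \<open>h\<close> modulo \<open>f\<close> in the elementary theory of Krull
  dimension. For \<open>f \<noteq> 0\<close> the quotient by it has dimension zero: it contains a power of every nonunit.\<close>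

definition boundary :: "'k::field fps fps \<Rightarrow> 'k fps fps \<Rightarrow> 'k fps fps set"
  where "boundary f h = {c \<in> RR. \<exists>p. \<exists>A\<in>RR. \<exists>B\<in>RR. h ^ p * (c + A * h) = B * f}"

lemma boundaryI:
  "c \<in> RR \<Longrightarrow> A \<in> RR \<Longrightarrow> B \<in> RR \<Longrightarrow> h ^ p * (c + A * h) = B * f \<Longrightarrow> c \<in> boundary f h"
  unfolding boundary_def by blast

lemma boundaryE:
  assumes "c \<in> boundary f h"
  obtains p A B where "c \<in> RR" "A \<in> RR" "B \<in> RR" "h ^ p * (c + A * h) = B * f"
  using assms unfolding boundary_def by blast

definition RR_ideal :: "'k::field fps fps set \<Rightarrow> bool"
  where "RR_ideal J \<longleftrightarrow> J \<subseteq> RR \<and> (\<forall>c\<in>J. \<forall>d\<in>J. c + d \<in> J) \<and> (\<forall>c\<in>J. \<forall>r\<in>RR. r * c \<in> J)"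

lemma boundary_ideal:
  assumes "f \<in> RR" "h \<in> RR"
  shows "RR_ideal (boundary f h)"
  unfolding RR_ideal_def
proof (intro conjI ballI)
  show "boundary f h \<subseteq> RR" by (auto simp: boundary_def)
next
  fix c c' assume "c \<in> boundary f h" "c' \<in> boundary f h"
  then obtain p A B p' A' B' where c: "c \<in> RR" "A \<in> RR" "B \<in> RR" "h ^ p * (c + A * h) = B * f"
    and c': "c' \<in> RR" "A' \<in> RR" "B' \<in> RR" "h ^ p' * (c' + A' * h) = B' * f"
    by (elim boundaryE)
  have "h ^ (p + p') * ((c + c') + (A + A') * h) =
      h ^ p' * (h ^ p * (c + A * h)) + h ^ p * (h ^ p' * (c' + A' * h))"
    by (simp add: power_add algebra_simps)
  also have "\<dots> = (h ^ p' * B + h ^ p * B') * f"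
    unfolding c(4) c'(4) by (simp add: algebra_simps)
  finally show "c + c' \<in> boundary f h"
    using c c' assms by (intro boundaryI) (auto intro: RR_add RR_mult RR_power)
next
  fix c r assume "c \<in> boundary f h" and r: "r \<in> (RR :: 'a fps fps set)"
  then obtain p A B where c: "c \<in> RR" "A \<in> RR" "B \<in> RR" "h ^ p * (c + A * h) = B * f"
    by (elim boundaryE)
  have "h ^ p * (r * c + (r * A) * h) = r * (h ^ p * (c + A * h))"
    by (simp add: algebra_simps)
  also have "\<dots> = (r * B) * f"
    unfolding c(4) by (simp only: mult.assoc)
  finally show "r * c \<in> boundary f h"
    using c r by (intro boundaryI) (auto intro: RR_mult)
qed

lemma boundary_mult:
  assumes "c \<in> boundary f h" "c' \<in> boundary f' h" "h \<in> RR"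
  shows "c * c' \<in> boundary (f * f') h"
proof -
  obtain p A B p' A' B' where c: "c \<in> RR" "A \<in> RR" "B \<in> RR" "h ^ p * (c + A * h) = B * f"
    and c': "c' \<in> RR" "A' \<in> RR" "B' \<in> RR" "h ^ p' * (c' + A' * h) = B' * f'"
    using assms by (elim boundaryE)
  have "h ^ (p + p') * (c * c' + (A * c' + A' * c + A * A' * h) * h) =
      (h ^ p * (c + A * h)) * (h ^ p' * (c' + A' * h))"
    by (simp add: power_add algebra_simps)
  also have "\<dots> = (B * B') * (f * f')"
    unfolding c(4) c'(4) by (simp only: mult_ac)
  finally show ?thesis
    using c c' assms by (intro boundaryI) (auto intro!: RR_add RR_mult)
qed

lemma boundary_self:
  assumes "f \<in> RR" "h \<in> RR"
  shows "f \<in> boundary f h" "h \<in> boundary f h"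
proof -
  show "f \<in> boundary f h"
    using assms by (intro boundaryI[of f 0 1 h 0]) auto
  show "h \<in> boundary f h"
    using assms by (intro boundaryI[of h "- 1" 0 h 0]) (auto intro: RR_minus)
qed

lemma boundary_dvd:
  assumes "c \<in> boundary (f * r) h" "r \<in> RR"
  shows "c \<in> boundary f h"
proof -
  obtain p A B where c: "c \<in> RR" "A \<in> RR" "B \<in> RR" "h ^ p * (c + A * h) = B * (f * r)"
    using assms by (elim boundaryE)
  then have "h ^ p * (c + A * h) = (B * r) * f" by (simp add: mult_ac)
  then show ?thesis using c assms(2) by (intro boundaryI[of c A "B * r" h p]) (auto intro: RR_mult)
qed

lemma power_supported:
  assumes "f \<in> RR" "\<And>w. coef f w \<noteq> 0 \<Longrightarrow> d \<le> \<phi> w"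
    and add: "\<And>u v. \<phi> (u + v) = \<phi> u + (\<phi> v :: nat)"
  shows "f ^ k \<in> supported {w \<in> weight_class 0. k * d \<le> \<phi> w}"
proof (induction k)
  case 0
  then show ?case using RR_1 by (simp add: RR_def)
next
  case (Suc k)
  have "f \<in> supported {w \<in> weight_class 0. d \<le> \<phi> w}"
    using assms(1,2) unfolding RR_def supported_def by blast
  from supported_mult[OF this Suc] show ?case
    by (auto simp: add weight_class_0_add algebra_simps intro!: add_mono)
qed

text \<open>Let \<open>g\<close> be the part of \<open>f\<close> on the \<open>x\<close>-axis, which is a power of \<open>x\<close> times a unit. As \<open>y\<close> divides \<open>f - g\<close>,
  a high power of \<open>f - g\<close> lies in \<open>J\<close>; modulo \<open>f\<close> this is a power of \<open>- g\<close>.\<close>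

lemma x_power_in_ideal:
  assumes J: "RR_ideal J" and f: "f \<in> J" "fps_nth f 0 \<noteq> 0" and y: "xy_monomial (0, n * N) \<in> J"
  shows "\<exists>M. xy_monomial (n * M, 0) \<in> J"
proof -
  have JR: "J \<subseteq> RR" and Jadd: "\<And>c d. c \<in> J \<Longrightarrow> d \<in> J \<Longrightarrow> c + d \<in> J"
    and Jmult: "\<And>r c. r \<in> RR \<Longrightarrow> c \<in> J \<Longrightarrow> r * c \<in> J"
    using J unfolding RR_ideal_def by auto
  have fR: "f \<in> RR" using f(1) JR by blast
  define g where "g = res {w. snd w = 0} f"
  have gR: "g \<in> RR"
    using fR unfolding g_def RR_def supported_def by auto
  define M where "M = (LEAST i. coef f (i, 0) \<noteq> 0)"
  have "\<exists>i. coef f (i, 0) \<noteq> 0"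
    using f(2) by (auto simp: coef_def fps_eq_iff)
  then have M: "coef f (M, 0) \<noteq> 0"
    unfolding M_def by (rule LeastI_ex)
  have Mle: "(M, 0) \<unlhd> w" if "coef g w \<noteq> 0" for w
    using that unfolding g_def M_def by (cases w) (auto split: if_splits intro: Least_le)
  have "coef g (M, 0) \<noteq> 0" using M by (simp add: g_def)
  from monomial_times_unit[OF gR this Mle] obtain v where
    v: "(M, 0) \<in> weight_class 0" "v \<in> RR" "v * g = xy_monomial (M, 0)" by blast
  let ?K = "n * N"
  have "(f - g) ^ ?K \<in> supported {w \<in> weight_class 0. ?K * 1 \<le> snd w}"
    using fR gR by (intro power_supported RR_diff) (auto simp: g_def split: if_splits)
  moreover have "(0, ?K) \<in> weight_class 0" by (simp add: y_axis_weight)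
  ultimately have "\<exists>r\<in>supported (weight_class 0). (f - g) ^ ?K = xy_monomial (0, ?K) * r"
    by (intro supported_xy_monomial_factor) (use weight_class_0_diff[of "(0, ?K)"] in auto)
  then obtain r where r: "r \<in> RR" "(f - g) ^ ?K = xy_monomial (0, ?K) * r"
    unfolding RR_def by blast
  have diffJ: "(f - g) ^ ?K \<in> J"
    unfolding r(2) using Jmult[OF r(1) y] by (simp add: mult.commute)
  have "\<exists>c\<in>RR. (f - g) ^ k = (- g) ^ k + c * f" for k
  proof (induction k)
    case 0
    then show ?case by (intro bexI[of _ 0]) auto
  next
    case (Suc k)
    then obtain c where c: "c \<in> RR" "(f - g) ^ k = (- g) ^ k + c * f" by blast
    have "(f - g) ^ Suc k = (f - g) * ((- g) ^ k + c * f)"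
      by (simp only: power_Suc c(2))
    also have "\<dots> = (- g) ^ Suc k + ((- g) ^ k + (f - g) * c) * f"
      by (simp add: algebra_simps)
    finally show ?case
      using c(1) fR gR by (intro bexI[of _ "(- g) ^ k + (f - g) * c"])
        (auto intro!: RR_add RR_mult RR_diff RR_power RR_minus)
  qed
  then obtain c where c: "c \<in> RR" "(f - g) ^ ?K = (- g) ^ ?K + c * f" by blast
  have "(- g) ^ ?K = (f - g) ^ ?K + (- c) * f"
    by (simp add: c(2))
  then have "(- g) ^ ?K \<in> J"
    using diffJ Jadd Jmult f(1) c(1) RR_minus by metis
  then have "(- v) ^ ?K * (- g) ^ ?K \<in> J"
    using v(2) by (intro Jmult RR_power RR_minus)
  moreover have "(- v) ^ ?K * (- g) ^ ?K = xy_monomial (?K * M, 0)"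
    by (simp add: power_mult_distrib[symmetric] v(3) xy_monomial_power)
  ultimately have "xy_monomial (n * (N * M), 0) \<in> J"
    by (simp add: mult.assoc)
  then show ?thesis by blast
qed

text \<open>By degrees: in a power of \<open>h\<close> that is high enough, each monomial is divisible by one of the two given
  ones.\<close>

lemma power_in_ideal:
  assumes J: "RR_ideal J" and x: "xy_monomial (n * M, 0) \<in> J" and y: "xy_monomial (0, n * N) \<in> J"
    and h: "h \<in> RR" "coef h 0 = 0"
  shows "\<exists>k. h ^ k \<in> J"
proof -
  let ?k = "n * M + n * N"
  have "h ^ ?k \<in> supported {w \<in> weight_class 0. ?k * 1 \<le> fst w + snd w}"
  proof (intro power_supported h)
    fix w assume "coef h w \<noteq> 0"
    then have "w \<noteq> 0" using h(2) by auto
    then show "1 \<le> fst w + snd w" by (cases w) (auto simp: zero_prod_def)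
  qed simp
  moreover have "\<exists>u\<in>{(n * M, 0), (0, n * N)}. u \<unlhd> w \<and> w - u \<in> weight_class 0"
    if "w \<in> {w \<in> weight_class 0. ?k * 1 \<le> fst w + snd w}" for w
  proof -
    have "(n * M, 0) \<unlhd> w \<or> (0, n * N) \<unlhd> w" using that by auto
    moreover have "(n * M, 0) \<in> weight_class 0" "(0, n * N) \<in> weight_class 0"
      by (simp_all add: x_axis_weight y_axis_weight)
    ultimately show ?thesis using that weight_class_0_diff by blast
  qed
  ultimately have "\<exists>r. (\<forall>u. r u \<in> supported (weight_class 0)) \<and>
    h ^ ?k = (\<Sum>u\<in>{(n * M, 0), (0, n * N)}. xy_monomial u * r u)"
    by (intro supported_decompose) auto
  then obtain r where r: "\<And>u. r u \<in> RR"
    "h ^ ?k = (\<Sum>u\<in>{(n * M, 0), (0, n * N)}. xy_monomial u * r u)"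
    unfolding RR_def by blast
  have sumJ: "(\<Sum>u\<in>F. xy_monomial u * r u) \<in> J"
    if "finite F" "F \<noteq> {}" "\<And>u. u \<in> F \<Longrightarrow> xy_monomial u \<in> J" for F
    using that
  proof (induction F rule: finite_ne_induct)
    case (singleton u)
    then show ?case using J r(1) unfolding RR_ideal_def by (simp add: mult.commute)
  next
    case (insert u F)
    then have "r u * xy_monomial u \<in> J" "(\<Sum>u\<in>F. xy_monomial u * r u) \<in> J"
      using J r(1) unfolding RR_ideal_def by auto
    then show ?case using insert J unfolding RR_ideal_def by (simp add: mult.commute)
  qed
  have "h ^ ?k \<in> J"
    unfolding r(2) using x y by (intro sumJ) auto
  then show ?thesis by blast
qed

text \<open>The claim is that a power of \<open>f\<^sub>3\<close> lies in the boundary ideal of \<open>f\<^sub>2\<close> modulo \<open>f\<^sub>1\<close>. Write \<open>f\<^sub>1\<^sup>n\<close> as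
  \<open>y\<^bsup>n b\<^esup> g\<^sup>n\<close>, where \<open>g\<close> does not vanish on the \<open>x\<close>-axis and \<open>g\<^sup>n\<close> is invariant. The boundary ideals of the
  two factors multiply into that of the product, so the factors can be treated separately. Each of the
  two ideals contains powers of \<open>x\<close> and \<open>y\<close>, and hence a power of every nonunit, or it contains \<open>1\<close>.\<close>

lemma collapse:
  assumes f: "f1 \<in> RR" "f1 \<noteq> 0" and f2: "f2 \<in> RR" and f3: "f3 \<in> RR" "coef f3 0 = 0"
  shows "\<exists>p q. \<exists>A\<in>RR. \<exists>B\<in>RR. f2 ^ p * (f3 ^ q + A * f2) = B * f1"
proof -
  define b where "b = subdegree f1"
  define g where "g = fps_shift b f1"
  have g: "f1 = xy_monomial (0, b) * g" "fps_nth g 0 \<noteq> 0"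
    using subdegree_decompose[of f1] f(2)
    by (auto simp: g_def b_def xy_monomial_altdef mult.commute)
  have f1n: "f1 ^ n = xy_monomial (0, n * b) * g ^ n"
    by (simp add: g(1) power_mult_distrib xy_monomial_power)
  have bG: "(0, n * b) \<in> weight_class 0" by (simp add: y_axis_weight)
  have gR: "g ^ n \<in> RR"
    unfolding RR_def supported_def
  proof (intro CollectI allI impI)
    fix w assume "coef (g ^ n) w \<noteq> 0"
    moreover have "coef (f1 ^ n) (w + (0, n * b)) = coef (g ^ n) w"
      unfolding f1n coef_xy_monomial_mult by (cases w) simp
    ultimately have "w + (0, n * b) \<in> weight_class 0"
      using RR_power[OF f(1), of n] unfolding RR_def supported_def by (metis (mono_tags, lifting) mem_Collect_eq)
    then show "w \<in> weight_class 0"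
      using weight_class_0_add_iff[OF bG] by blast
  qed
  have gn0: "fps_nth (g ^ n) 0 \<noteq> 0"
    using g(2) by (simp add: fps_nth_power_0)
  let ?J1 = "boundary (g ^ n) f2" and ?J2 = "boundary (xy_monomial (0, n * b)) f2"
  have J1: "RR_ideal ?J1" and J2: "RR_ideal ?J2"
    using gR f2 RR_monomial[OF bG] by (auto intro: boundary_ideal)
  obtain p N A B where "A \<in> RR" "B \<in> RR" "f2 ^ p * (xy_monomial (0, n * N) + A * f2) = B * g ^ n"
    using relation_in_RR[OF gR gn0 f2] by blast
  then have y1: "xy_monomial (0, n * N) \<in> ?J1"
    by (intro boundaryI) (auto intro: RR_monomial simp: y_axis_weight)
  obtain M where "xy_monomial (n * M, 0) \<in> ?J1"
    using x_power_in_ideal[OF J1 boundary_self(1)[OF gR f2] gn0 y1] by blast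
  from power_in_ideal[OF J1 this y1 f3] obtain k1 where k1: "f3 ^ k1 \<in> ?J1" by blast
  have y2: "xy_monomial (0, n * b) \<in> ?J2"
    using boundary_self(1)[OF RR_monomial[OF bG] f2] .
  have "\<exists>k2. f3 ^ k2 \<in> ?J2"
  proof (cases "fps_nth f2 0 = 0")
    case False
    obtain M where "xy_monomial (n * M, 0) \<in> ?J2"
      using x_power_in_ideal[OF J2 boundary_self(2)[OF RR_monomial[OF bG] f2] False y2] by blast
    from power_in_ideal[OF J2 this y2 f3] show ?thesis .
  next
    case True
    have "f2 ^ (n * b) \<in> supported {w \<in> weight_class 0. n * b * 1 \<le> snd w}"
    proof (intro power_supported f2)
      fix w assume "coef f2 w \<noteq> 0"
      then have "snd w \<noteq> 0" using True by (metis coef_def fps_zero_nth)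
      then show "1 \<le> snd w" by simp
    qed simp
    then have "\<exists>r\<in>supported (weight_class 0). f2 ^ (n * b) = xy_monomial (0, n * b) * r"
      by (rule supported_xy_monomial_factor) (use weight_class_0_diff[OF bG] in auto)
    then obtain r where "r \<in> RR" "f2 ^ (n * b) = xy_monomial (0, n * b) * r"
      unfolding RR_def by blast
    then have "1 \<in> ?J2"
      by (intro boundaryI[of 1 0 r f2 "n * b"]) (auto simp: mult.commute)
    then show ?thesis by (intro exI[of _ 0]) simp
  qed
  then obtain k2 where k2: "f3 ^ k2 \<in> ?J2" by blast
  have "f3 ^ (k1 + k2) \<in> boundary (g ^ n * xy_monomial (0, n * b)) f2"
    unfolding power_add by (rule boundary_mult[OF k1 k2 f2])
  moreover have "g ^ n * xy_monomial (0, n * b) = f1 * f1 ^ (n - 1)"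
    using f1n n_gt_1 by (simp add: mult.commute flip: power_Suc)
  ultimately have "f3 ^ (k1 + k2) \<in> boundary f1 f2"
    using boundary_dvd RR_power[OF f(1)] by metis
  then show ?thesis
    unfolding boundary_def by blast
qed

end

section \<open>The invariant ring, its monomial modules and their quotients\<close>

locale cyclic_quotient = cyclic_weights n a for n a :: nat +
  fixes z :: "'k::field"
  assumes root: "primitive_root_of_unity n z"
begin

abbreviation IR :: "'k fps fps ring"
  where "IR \<equiv> invariant_ring z a"

text \<open>Only the order \<open>n\<close> of the root enters: the action fixes a monomial exactly if its weight is \<open>0\<close>.\<close>

lemma root_power_eq_1: "z ^ k = 1 \<longleftrightarrow> n dvd k"
proof -
  have zn: "z ^ n = 1" and prim: "\<And>l. 0 < l \<Longrightarrow> l < n \<Longrightarrow> z ^ l \<noteq> 1"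
    using root by (auto simp: primitive_root_of_unity_def)
  have "z ^ k = z ^ (n * (k div n) + k mod n)" by simp
  also have "\<dots> = z ^ (k mod n)"
    by (simp only: power_add power_mult zn power_one mult_1)
  finally have "z ^ k = z ^ (k mod n)" .
  moreover have "k mod n < n" using n_gt_1 by simp
  ultimately show ?thesis
    using prim[of "k mod n"] by (cases "k mod n = 0") (auto simp: dvd_eq_mod_eq_0)
qed

lemma root_neq_0: "z \<noteq> 0"
  using root_power_eq_1[of n] n_gt_1 by (metis dvd_refl gr_implies_not0 power_0_left zero_neq_one)

lemma weight_class_0_iff: "w \<in> weight_class 0 \<longleftrightarrow> n dvd fst w + snd w * a"
  by (simp add: weight_class_iff flip: of_nat_mult of_nat_add)

lemma coef_diag_act: "coef (diag_act y a f) w = y ^ (fst w + snd w * a) * coef f w"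
  by (simp add: coef_def diag_act_def power_add power_mult[symmetric] mult.commute)

lemma diag_act_fixed_iff: "diag_act z a f = f \<longleftrightarrow> f \<in> RR"
proof -
  have "diag_act z a f = f \<longleftrightarrow> (\<forall>w. coef (diag_act z a f) w = coef f w)"
    using coef_ext by metis
  also have "\<dots> \<longleftrightarrow> (\<forall>w. coef f w \<noteq> 0 \<longrightarrow> n dvd fst w + snd w * a)"
    by (simp add: coef_diag_act root_power_eq_1) blast
  finally show ?thesis
    by (simp add: RR_def supported_def weight_class_0_iff)
qed

lemma diag_act_Bij: "diag_act z a \<in> Bij UNIV"
proof -
  have "diag_act (inverse z) a (diag_act z a f) = f" "diag_act z a (diag_act (inverse z) a f) = f" for f
    using root_neq_0 by (auto intro!: coef_ext simp: coef_diag_act power_inverse)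
  then have "bij (diag_act z a)"
    by (intro o_bij[of "diag_act (inverse z) a"]) (auto simp: fun_eq_iff)
  then show ?thesis
    by (simp add: Bij_def)
qed

lemma cyclic_action_fixes:
  assumes "f \<in> RR" "g \<in> cyclic_action z a"
  shows "g f = f"
proof -
  have f: "diag_act z a f = f" using assms(1) diag_act_fixed_iff by blast
  have sub: "{diag_act z a} \<subseteq> carrier (BijGroup UNIV)"
    using diag_act_Bij by (simp add: BijGroup_def)
  have "g f = f" if "g \<in> generate (BijGroup UNIV) {diag_act z a}" for g
    using that
  proof (induction g rule: generate.induct)
    case one
    then show ?case by (simp add: BijGroup_def)
  next
    case (incl h)
    then show ?case using f by simp
  next
    case (inv h)
    then have "h = diag_act z a" by simp
    moreover have "inv_into UNIV (diag_act z a) f = f"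
      using diag_act_Bij f by (metis Bij_imp_funcset Bij_def IntD2 bij_betw_imp_inj_on inv_f_eq mem_Collect_eq)
    ultimately show ?case
      using diag_act_Bij by (simp add: inv_BijGroup)
  next
    case (eng g h)
    have c: "carrier (BijGroup UNIV) = (Bij UNIV :: ('k fps fps \<Rightarrow> _) set)"
      by (simp add: BijGroup_def)
    have "g \<in> Bij UNIV" "h \<in> Bij UNIV"
      using group.generate_in_carrier[OF group_BijGroup sub eng.hyps(1)]
        group.generate_in_carrier[OF group_BijGroup sub eng.hyps(2)] unfolding c by blast+
    then show ?case
      using eng.IH by (simp add: BijGroup_def compose_def)
  qed
  then show ?thesis
    using assms(2) by (simp add: cyclic_action_def)
qed

lemma carrier_IR [simp]: "carrier IR = RR"
proof -
  have "f \<in> RR" if "\<forall>g\<in>cyclic_action z a. g f = f" for f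
    using that generate.incl[of "diag_act z a" "{diag_act z a}"] diag_act_fixed_iff
    by (auto simp: cyclic_action_def)
  then show ?thesis
    using cyclic_action_fixes by (auto simp: invariant_ring_def)
qed

lemma IR_simps [simp]:
  "monoid.mult IR = (*)" "monoid.one IR = 1" "ring.zero IR = 0" "ring.add IR = (+)"
  by (simp_all add: invariant_ring_def ring_of_type_algebra_def fun_eq_iff)

lemma IR_cring: "cring IR"
proof (rule cringI)
  show "abelian_group IR"
  proof (rule abelian_groupI)
    fix x assume "x \<in> carrier IR"
    then have "- x \<in> RR" by (simp add: RR_minus)
    then show "\<exists>y\<in>carrier IR. y \<oplus>\<^bsub>IR\<^esub> x = \<zero>\<^bsub>IR\<^esub>"
      by (intro bexI[of _ "- x"]) simp_all
  qed (simp_all add: RR_add add_ac)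
  show "comm_monoid IR"
    by (rule comm_monoidI) (simp_all add: RR_mult mult_ac)
qed (simp add: distrib_right)

definition smod :: "(nat \<times> nat) set \<Rightarrow> ('k fps fps, 'k fps fps) module"
  where "smod D = power_series_module\<lparr>carrier := supported D\<rparr>"

lemma smod_simps [simp]:
  "carrier (smod D) = supported D" "ring.zero (smod D) = 0" "ring.add (smod D) = (+)"
  "module.smult (smod D) = (*)"
  by (simp_all add: smod_def power_series_module_def)

lemma power_series_module_eq: "power_series_module = smod UNIV"
proof -
  have "supported UNIV = (UNIV :: 'k fps fps set)" by auto
  then show ?thesis by (simp add: smod_def power_series_module_def)
qed

definition exps_closed :: "(nat \<times> nat) set \<Rightarrow> bool"
  where "exps_closed D \<longleftrightarrow> (\<forall>u\<in>weight_class 0. \<forall>v\<in>D. u + v \<in> D)"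

lemma exps_closed_weight_class: "exps_closed (weight_class t)"
  by (simp add: exps_closed_def weight_class_0_add)

lemma exps_closed_UNIV: "exps_closed UNIV"
  by (simp add: exps_closed_def)

lemma RR_mult_supported:
  assumes "exps_closed D" "r \<in> RR" "v \<in> supported D"
  shows "r * v \<in> supported D"
  using supported_mult[OF assms(2)[unfolded RR_def] assms(3)] assms(1) by (simp add: exps_closed_def)

lemma smod_module: "exps_closed D \<Longrightarrow> module IR (smod D)"
proof (rule moduleI)
  show "abelian_group (smod D)"
  proof (rule abelian_groupI)
    fix x assume "x \<in> carrier (smod D)"
    then have "- x \<in> supported D" by (simp add: supported_minus)
    then show "\<exists>y\<in>carrier (smod D). y \<oplus>\<^bsub>smod D\<^esub> x = \<zero>\<^bsub>smod D\<^esub>"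
      by (intro bexI[of _ "- x"]) simp_all
  qed (simp_all add: supported_add add_ac)
qed (simp_all add: IR_cring RR_mult_supported distrib_left distrib_right mult.assoc)

definition RR_submod :: "'k fps fps set \<Rightarrow> bool"
  where "RR_submod N \<longleftrightarrow> 0 \<in> N \<and> (\<forall>x\<in>N. \<forall>y\<in>N. x + y \<in> N) \<and> (\<forall>r\<in>RR. \<forall>x\<in>N. r * x \<in> N)"

lemma RR_submodD:
  assumes "RR_submod N"
  shows "0 \<in> N" "x \<in> N \<Longrightarrow> y \<in> N \<Longrightarrow> x + y \<in> N" "r \<in> RR \<Longrightarrow> x \<in> N \<Longrightarrow> r * x \<in> N"
    "x \<in> N \<Longrightarrow> - x \<in> N" "x \<in> N \<Longrightarrow> y \<in> N \<Longrightarrow> x - y \<in> N"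
proof -
  show 1: "0 \<in> N" and 2: "\<And>x y. x \<in> N \<Longrightarrow> y \<in> N \<Longrightarrow> x + y \<in> N"
    and 3: "\<And>r x. r \<in> RR \<Longrightarrow> x \<in> N \<Longrightarrow> r * x \<in> N"
    using assms unfolding RR_submod_def by blast+
  show 4: "\<And>x. x \<in> N \<Longrightarrow> - x \<in> N"
    using 3[OF RR_minus[OF RR_1]] by simp
  show "x \<in> N \<Longrightarrow> y \<in> N \<Longrightarrow> x - y \<in> N"
    using 2[OF _ 4, of x y] by simp
qed

lemma RR_submod_supported: "exps_closed D \<Longrightarrow> RR_submod (supported D)"
  by (auto simp: RR_submod_def intro: supported_add RR_mult_supported)

lemma submodule_iff:
  "exps_closed D \<Longrightarrow> submodule IR N (smod D) \<longleftrightarrow> N \<subseteq> supported D \<and> RR_submod N"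
  by (auto simp: submodule_def RR_submod_def smod_module)

abbreviation R_span :: "(nat \<times> nat) set \<Rightarrow> 'k fps fps set \<Rightarrow> 'k fps fps set"
  where "R_span D S \<equiv> module.span IR (smod D) S"

lemma R_span_facts:
  assumes "exps_closed D" "S \<subseteq> supported D"
  shows "RR_submod (R_span D S)" "R_span D S \<subseteq> supported D" "S \<subseteq> R_span D S"
proof -
  interpret module IR "smod D" by (rule smod_module[OF assms(1)])
  have "submodule IR (R_span D S) (smod D)"
    using assms(2) by (intro span_is_submodule) simp
  then show "RR_submod (R_span D S)" "R_span D S \<subseteq> supported D"
    using submodule_iff[OF assms(1)] by auto
  show "S \<subseteq> R_span D S"
    using assms(2) by (intro in_own_span) simp
qed

lemma R_span_minimal:
  assumes "exps_closed D" "S \<subseteq> N" "N \<subseteq> supported D" "RR_submod N"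
  shows "R_span D S \<subseteq> N"
proof -
  interpret module IR "smod D" by (rule smod_module[OF assms(1)])
  show ?thesis
    using assms submodule_iff[OF assms(1)] by (intro span_is_subset) auto
qed

lemma R_span_mono:
  assumes "exps_closed D" "S \<subseteq> T"
  shows "R_span D S \<subseteq> R_span D T"
proof -
  interpret module IR "smod D" by (rule smod_module[OF assms(1)])
  show ?thesis using assms(2) by (rule span_is_monotone)
qed

lemma RR_submod_sum:
  assumes "RR_submod N" "\<And>u. u \<in> F \<Longrightarrow> f u \<in> N"
  shows "sum f F \<in> N"
  using assms(2) by (induction F rule: infinite_finite_induct) (auto intro: RR_submodD[OF assms(1)])

text \<open>By Dickson's lemma; within one weight class, the difference of comparable exponents is an invariant
  exponent.\<close>

lemma finite_monomial_generators:
  assumes "E \<subseteq> weight_class t"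
  obtains F where "F \<subseteq> E" "finite F"
    "\<forall>f\<in>(supported E :: 'k fps fps set).
      \<exists>r. (\<forall>u. r u \<in> RR) \<and> f = (\<Sum>u\<in>F. xy_monomial u * r u)"
proof -
  obtain F where F: "F \<subseteq> E" "finite F" "\<forall>w\<in>E. \<exists>u\<in>F. u \<unlhd> w"
    using dickson[of E] by blast
  have red: "\<exists>u\<in>F. u \<unlhd> w \<and> w - u \<in> weight_class 0" if "w \<in> E" for w
  proof -
    obtain u where u: "u \<in> F" "u \<unlhd> w" using F(3) \<open>w \<in> E\<close> by blast
    have "u \<in> weight_class t" "w \<in> weight_class t" using u(1) F(1) that assms by blast+
    from weight_class_diff[OF this u(2)] show ?thesis using u by auto
  qed
  have "\<forall>f\<in>(supported E :: 'k fps fps set). \<exists>r. (\<forall>u. r u \<in> RR) \<and> f = (\<Sum>u\<in>F. xy_monomial u * r u)"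
  proof
    fix f :: "'k fps fps" assume f: "f \<in> supported E"
    show "\<exists>r. (\<forall>u. r u \<in> RR) \<and> f = (\<Sum>u\<in>F. xy_monomial u * r u)"
      unfolding RR_def by (rule supported_decompose[OF f F(2) red])
  qed
  from that[OF F(1,2) this] show thesis .
qed

lemma R_span_eq_supported:
  assumes E: "E \<subseteq> weight_class t" "E \<subseteq> D" "exps_closed E" "exps_closed D"
    and S: "S \<subseteq> supported E" "\<And>w. w \<in> E \<Longrightarrow> xy_monomial w \<in> S"
  shows "R_span D S = supported E"
proof
  have ED: "supported E \<subseteq> supported D"
    using supported_mono[OF _ E(2)] by blast
  show "R_span D S \<subseteq> supported E"
    using S(1) ED by (intro R_span_minimal E RR_submod_supported) auto
  note sp = R_span_facts[OF E(4), of S]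
  obtain F where F: "F \<subseteq> E" "finite F"
    "\<forall>f\<in>(supported E :: 'k fps fps set). \<exists>r. (\<forall>u. r u \<in> RR) \<and> f = (\<Sum>u\<in>F. xy_monomial u * r u)"
    by (rule finite_monomial_generators[OF E(1)])
  show "supported E \<subseteq> R_span D S"
  proof
    fix f :: "'k fps fps" assume "f \<in> supported E"
    then obtain r where r: "\<forall>u. r u \<in> RR" "f = (\<Sum>u\<in>F. xy_monomial u * r u)"
      using F(3) by blast
    have SD: "S \<subseteq> supported D" using S(1) ED by blast
    show "f \<in> R_span D S"
      unfolding r(2)
    proof (rule RR_submod_sum[OF sp(1)[OF SD]])
      fix u assume "u \<in> F"
      then have "xy_monomial u \<in> R_span D S"
        using F(1) S(2) sp(3)[OF SD] by blast
      then show "xy_monomial u * r u \<in> R_span D S"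
        unfolding mult.commute[of "xy_monomial u"] using RR_submodD(3)[OF sp(1)[OF SD]] r(1) by blast
    qed
  qed
qed

lemma fin_gen_smod:
  assumes "E \<subseteq> weight_class t" "exps_closed E"
  shows "fin_gen IR (smod E)"
proof -
  obtain F where F: "F \<subseteq> E" "finite F"
    "\<forall>f\<in>(supported E :: 'k fps fps set). \<exists>r. (\<forall>u. r u \<in> RR) \<and> f = (\<Sum>u\<in>F. xy_monomial u * r u)"
    by (rule finite_monomial_generators[OF assms(1)])
  let ?S = "xy_monomial ` F :: 'k fps fps set"
  have SD: "?S \<subseteq> supported E"
    using F(1) by (auto intro: supported_xy_monomial)
  note sp = R_span_facts[OF assms(2) SD]
  have "f \<in> R_span E ?S" if f: "f \<in> supported E" for f
  proof -
    obtain r where r: "\<forall>u. r u \<in> RR" "f = (\<Sum>u\<in>F. xy_monomial u * r u)"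
      using F(3) f by blast
    show "f \<in> R_span E ?S"
      unfolding r(2)
    proof (rule RR_submod_sum[OF sp(1)])
      fix u assume "u \<in> F"
      then have "xy_monomial u \<in> R_span E ?S"
        using sp(3) by blast
      then show "xy_monomial u * r u \<in> R_span E ?S"
        unfolding mult.commute[of "xy_monomial u"] using RR_submodD(3)[OF sp(1)] r(1) by blast
    qed
  qed
  then have "R_span E ?S = carrier (smod E)"
    using sp(2) by auto
  then show ?thesis
    unfolding fin_gen_def using SD F(2) by (intro exI[of _ ?S]) auto
qed

lemma semi_invariants_eq: "semi_invariants n a z t = smod (weight_class t)"
proof -
  have "{var_x ^ i * var_y ^ j | i j. [int i + int j * int a = t] (mod int n)} =
      (xy_monomial ` weight_class t :: 'k fps fps set)"
  proof (intro equalityI subsetI)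
    fix m :: "'k fps fps" assume "m \<in> {var_x ^ i * var_y ^ j | i j. [int i + int j * int a = t] (mod int n)}"
    then obtain i j where "m = xy_monomial (i, j)" "(i, j) \<in> weight_class t"
      by (auto simp: xy_monomial_def weight_class_def)
    then show "m \<in> xy_monomial ` weight_class t" by blast
  qed (auto simp: xy_monomial_def weight_class_def)
  moreover have "R_span UNIV (xy_monomial ` weight_class t) = supported (weight_class t)"
    by (rule R_span_eq_supported[of _ t])
      (auto intro: supported_xy_monomial exps_closed_weight_class exps_closed_UNIV)
  ultimately show ?thesis
    by (simp add: semi_invariants_def power_series_module_eq) (simp add: smod_def)
qed

text \<open>Cosets without reference to an ambient module record, so that they can be computed with as sets of
  series.\<close>

definition coset :: "'k fps fps set \<Rightarrow> 'k fps fps \<Rightarrow> 'k fps fps set"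
  where "coset N v = (\<lambda>h. h + v) ` N"

lemma a_r_coset_smod: "a_r_coset (smod D) N v = coset N v"
  by (auto simp: a_r_coset_def' coset_def)

lemma coset_eq_iff:
  assumes "RR_submod N"
  shows "coset N v = coset N w \<longleftrightarrow> v - w \<in> N"
proof
  assume "coset N v = coset N w"
  moreover have "v \<in> coset N v"
    unfolding coset_def using RR_submodD(1)[OF assms] by (intro image_eqI[of _ _ 0]) auto
  ultimately obtain h where "h \<in> N" "v = h + w" by (auto simp: coset_def)
  then show "v - w \<in> N" by simp
next
  assume d: "v - w \<in> N"
  have "coset N v \<subseteq> coset N w" if d: "v - w \<in> N" for v w
  proof
    fix x assume "x \<in> coset N v"
    then obtain h where h: "h \<in> N" "x = h + v" by (auto simp: coset_def)
    then show "x \<in> coset N w"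
      unfolding coset_def using RR_submodD(2)[OF assms h(1) d] by (intro image_eqI[of _ _ "h + (v - w)"]) auto
  qed
  from this[OF d] this[of w v] show "coset N v = coset N w"
    using RR_submodD(4)[OF assms d] by auto
qed

lemma coset_0: "coset N 0 = N"
  by (simp add: coset_def)

lemma coset_eq_self:
  assumes "RR_submod N"
  shows "coset N v = N \<longleftrightarrow> v \<in> N"
  using coset_eq_iff[OF assms, of v 0] by (simp add: coset_0)

lemma coset_add:
  assumes "RR_submod N"
  shows "set_add (smod D) (coset N v) (coset N w) = coset N (v + w)"
proof -
  have "set_add (smod D) (coset N v) (coset N w) = {(h + v) + (k + w) | h k. h \<in> N \<and> k \<in> N}"
    by (auto simp: set_add_def' coset_def)
  also have "\<dots> = coset N (v + w)"
  proof (intro equalityI subsetI)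
    fix x assume "x \<in> {(h + v) + (k + w) | h k. h \<in> N \<and> k \<in> N}"
    then obtain h k where hk: "h \<in> N" "k \<in> N" "x = (h + v) + (k + w)" by blast
    then show "x \<in> coset N (v + w)"
      unfolding coset_def using RR_submodD(2)[OF assms hk(1,2)]
      by (intro image_eqI[of _ _ "h + k"]) (auto simp: algebra_simps)
  next
    fix x assume "x \<in> coset N (v + w)"
    then obtain h where "h \<in> N" "x = h + (v + w)" by (auto simp: coset_def)
    then show "x \<in> {(h + v) + (k + w) | h k. h \<in> N \<and> k \<in> N}"
      using RR_submodD(1)[OF assms] by (intro CollectI exI[of _ h] exI[of _ 0]) (auto simp: algebra_simps)
  qed
  finally show ?thesis .
qed

lemma coset_smult:
  assumes "RR_submod N" "r \<in> RR"
  shows "(\<Union>q\<in>coset N v. coset N (r * q)) = coset N (r * v)"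
proof -
  have "coset N (r * q) = coset N (r * v)" if q: "q \<in> coset N v" for q
  proof -
    obtain h where h: "h \<in> N" "q = h + v" using q by (auto simp: coset_def)
    have "r * q - r * v = r * h" by (simp add: h algebra_simps)
    then show ?thesis
      using RR_submodD(3)[OF assms h(1)] coset_eq_iff[OF assms(1)] by simp
  qed
  moreover have "v \<in> coset N v"
    unfolding coset_def using RR_submodD(1)[OF assms(1)] by (intro image_eqI[of _ _ 0]) auto
  ultimately show ?thesis by blast
qed

abbreviation quo :: "(nat \<times> nat) set \<Rightarrow> 'k fps fps set \<Rightarrow> ('k fps fps, 'k fps fps set) module"
  where "quo D N \<equiv> quot_module (smod D) N"

lemma quo_simps [simp]:
  "carrier (quo D N) = coset N ` supported D" "ring.zero (quo D N) = N"
  "ring.add (quo D N) = set_add (smod D)"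
  "module.smult (quo D N) = (\<lambda>r Q. \<Union>q\<in>Q. coset N (r * q))"
  by (auto simp: quot_module_def A_RCOSETS_def' a_r_coset_smod)

lemma quo_module:
  assumes D: "exps_closed D" and N: "RR_submod N" "N \<subseteq> supported D"
  shows "module IR (quo D N)"
proof (rule moduleI)
  show "abelian_group (quo D N)"
  proof (rule abelian_groupI)
    fix x assume "x \<in> carrier (quo D N)"
    then obtain v where v: "v \<in> supported D" "x = coset N v" by auto
    have "- v \<in> supported D" using v(1) by (rule supported_minus)
    then show "\<exists>y\<in>carrier (quo D N). y \<oplus>\<^bsub>quo D N\<^esub> x = \<zero>\<^bsub>quo D N\<^esub>"
      using v by (intro bexI[of _ "coset N (- v)"]) (simp_all add: coset_add[OF N(1)] coset_0)
    show "\<zero>\<^bsub>quo D N\<^esub> \<oplus>\<^bsub>quo D N\<^esub> x = x"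
      using coset_add[OF N(1), of D 0 v] v by (simp add: coset_0)
  next
    have "coset N 0 \<in> coset N ` supported D" by (rule imageI) simp
    then show "\<zero>\<^bsub>quo D N\<^esub> \<in> carrier (quo D N)"
      by (simp add: coset_0)
  next
    fix x y assume "x \<in> carrier (quo D N)" "y \<in> carrier (quo D N)"
    then obtain v w where vw: "v \<in> supported D" "x = coset N v" "w \<in> supported D" "y = coset N w"
      by auto
    show "x \<oplus>\<^bsub>quo D N\<^esub> y \<in> carrier (quo D N)"
      using vw by (simp add: coset_add[OF N(1)] supported_add)
    show "x \<oplus>\<^bsub>quo D N\<^esub> y = y \<oplus>\<^bsub>quo D N\<^esub> x"
      using vw by (simp add: coset_add[OF N(1)] add.commute)
    fix s assume "s \<in> carrier (quo D N)"
    then obtain u where u: "u \<in> supported D" "s = coset N u" by auto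
    show "x \<oplus>\<^bsub>quo D N\<^esub> y \<oplus>\<^bsub>quo D N\<^esub> s = x \<oplus>\<^bsub>quo D N\<^esub> (y \<oplus>\<^bsub>quo D N\<^esub> s)"
      using vw u by (simp add: coset_add[OF N(1)] add.assoc)
  qed
next
  fix r s x y assume rs: "r \<in> carrier IR" "s \<in> carrier IR"
    and "x \<in> carrier (quo D N)" "y \<in> carrier (quo D N)"
  then obtain v w where vw: "v \<in> supported D" "x = coset N v" "w \<in> supported D" "y = coset N w"
    by auto
  note simps = coset_add[OF N(1)] coset_smult[OF N(1)] RR_add RR_mult
  show "r \<odot>\<^bsub>quo D N\<^esub> x \<in> carrier (quo D N)"
    using rs vw by (simp add: simps RR_mult_supported[OF D])
  show "(r \<oplus>\<^bsub>IR\<^esub> s) \<odot>\<^bsub>quo D N\<^esub> x = r \<odot>\<^bsub>quo D N\<^esub> x \<oplus>\<^bsub>quo D N\<^esub> s \<odot>\<^bsub>quo D N\<^esub> x"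
    using rs vw distrib_right[of r s v] by (simp add: simps)
  show "r \<odot>\<^bsub>quo D N\<^esub> (x \<oplus>\<^bsub>quo D N\<^esub> y) = r \<odot>\<^bsub>quo D N\<^esub> x \<oplus>\<^bsub>quo D N\<^esub> r \<odot>\<^bsub>quo D N\<^esub> y"
    using rs vw by (simp add: simps distrib_left)
  show "(r \<otimes>\<^bsub>IR\<^esub> s) \<odot>\<^bsub>quo D N\<^esub> x = r \<odot>\<^bsub>quo D N\<^esub> (s \<odot>\<^bsub>quo D N\<^esub> x)"
    using rs vw by (simp add: simps) (simp only: mult.assoc)
next
  fix x assume "x \<in> carrier (quo D N)"
  then obtain v where "v \<in> supported D" "x = coset N v" by auto
  then show "\<one>\<^bsub>IR\<^esub> \<odot>\<^bsub>quo D N\<^esub> x = x"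
    using coset_smult[OF N(1) RR_1, of v] by simp
qed (rule IR_cring)

lemma nonzerodivisor_quo_iff:
  assumes "RR_submod N" "r \<in> RR"
  shows "nonzerodivisor_on (quo D N) r \<longleftrightarrow> (\<forall>v\<in>supported D. r * v \<in> N \<longrightarrow> v \<in> N)"
  by (simp add: nonzerodivisor_on_def coset_smult[OF assms] coset_eq_self[OF assms(1)])

lemma quo_nontrivial_iff:
  assumes "RR_submod N"
  shows "carrier (quo D N) \<noteq> {\<zero>\<^bsub>quo D N\<^esub>} \<longleftrightarrow> \<not> supported D \<subseteq> N"
proof -
  have "0 \<in> supported D" by simp
  then have "carrier (quo D N) = {\<zero>\<^bsub>quo D N\<^esub>} \<longleftrightarrow> (\<forall>v\<in>supported D. coset N v = N)"
    unfolding quo_simps by blast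
  then show ?thesis
    by (auto simp: coset_eq_self[OF assms])
qed

lemma ideal_smult_eq: "ideal_smult IR I (smod D) = R_span D {r * v | r v. r \<in> I \<and> v \<in> supported D}"
  by (simp add: ideal_smult_def)

text \<open>If \<open>I\<close> is squeezed between the monomials with exponents in \<open>U\<close> and the series supported on \<open>U\<close>, then so is
  \<open>I M\<^sub>t\<close> for the translates of \<open>U\<close>. Finite generation turns this into an equality.\<close>

lemma ideal_smult_monomial:
  assumes U: "U \<subseteq> weight_class 0" "exps_closed U"
    and I: "I \<subseteq> supported U" "\<And>u. u \<in> U \<Longrightarrow> xy_monomial u \<in> I"
  shows "ideal_smult IR I (smod (weight_class t)) = supported {u + v | u v. u \<in> U \<and> v \<in> weight_class t}"
  unfolding ideal_smult_eq
proof (rule R_span_eq_supported[of _ t])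
  show "{u + v | u v. u \<in> U \<and> v \<in> weight_class t} \<subseteq> weight_class t"
    using U(1) weight_class_0_add by blast
  then show "{u + v | u v. u \<in> U \<and> v \<in> weight_class t} \<subseteq> weight_class t" .
  show "exps_closed {u + v | u v. u \<in> U \<and> v \<in> weight_class t}"
    unfolding exps_closed_def
  proof (intro ballI)
    fix p w assume p: "p \<in> weight_class 0" and "w \<in> {u + v | u v. u \<in> U \<and> v \<in> weight_class t}"
    then obtain u v where uv: "w = u + v" "u \<in> U" "v \<in> weight_class t" by blast
    then have "p + w = (p + u) + v" "p + u \<in> U"
      using p U(2) by (simp_all add: exps_closed_def add.assoc)
    then show "p + w \<in> {u + v | u v. u \<in> U \<and> v \<in> weight_class t}"
      using uv(3) by blast
  qed
  show "{r * v | r v. r \<in> I \<and> v \<in> supported (weight_class t)} \<subseteq>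
      (supported {u + v | u v. u \<in> U \<and> v \<in> weight_class t} :: 'k fps fps set)"
  proof clarify
    fix r v :: "'k fps fps" assume "r \<in> I" "v \<in> supported (weight_class t)"
    then show "r * v \<in> supported {u + v | u v. u \<in> U \<and> v \<in> weight_class t}"
      using I(1) by (intro supported_mult[of r U v "weight_class t"]) (blast, blast, blast)
  qed
  fix w assume "w \<in> {u + v | u v. u \<in> U \<and> v \<in> weight_class t}"
  then obtain u v where "w = u + v" "u \<in> U" "v \<in> weight_class t" by blast
  then show "xy_monomial w \<in> {r * v | r v. r \<in> I \<and> v \<in> supported (weight_class t)}"
    using I(2) supported_xy_monomial
    by (intro CollectI exI[of _ "xy_monomial u"] exI[of _ "xy_monomial v"]) (simp add: xy_monomial_add)
qed (rule exps_closed_weight_class)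

section \<open>The invariant ring is local of dimension two\<close>

lemma a_inv_IR: "x \<in> RR \<Longrightarrow> a_inv IR x = - x"
proof -
  interpret cring IR by (rule IR_cring)
  assume "x \<in> RR"
  then show ?thesis
    by (intro minus_equality) (simp_all add: RR_minus)
qed

lemma ideal_IR_iff: "ideal I IR \<longleftrightarrow> I \<subseteq> RR \<and> RR_submod I"
proof
  assume "ideal I IR"
  then interpret ideal I IR .
  have "I \<subseteq> RR" using a_subset by simp
  moreover have "RR_submod I"
    unfolding RR_submod_def
    using additive_subgroup.zero_closed[OF is_additive_subgroup]
      additive_subgroup.a_closed[OF is_additive_subgroup] I_l_closed by simp
  ultimately show "I \<subseteq> RR \<and> RR_submod I" ..
next
  assume I: "I \<subseteq> RR \<and> RR_submod I"
  then have N: "RR_submod I" and sub: "I \<subseteq> RR" by auto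
  show "ideal I IR"
  proof (rule idealI)
    show "ring IR" using IR_cring by (rule cring.axioms)
    show "subgroup I (add_monoid IR)"
    proof (rule subgroup.intro)
      fix x assume x: "x \<in> I"
      then have "a_inv IR x = - x" using sub by (intro a_inv_IR) blast
      then show "inv\<^bsub>add_monoid IR\<^esub> x \<in> I"
        using RR_submodD(4)[OF N x] by (simp add: a_inv_def)
    qed (use sub RR_submodD(1,2)[OF N] in auto)
    show "\<And>x r. x \<in> I \<Longrightarrow> r \<in> carrier IR \<Longrightarrow> r \<otimes>\<^bsub>IR\<^esub> x \<in> I"
      using RR_submodD(3)[OF N] by simp
    then show "\<And>x r. x \<in> I \<Longrightarrow> r \<in> carrier IR \<Longrightarrow> x \<otimes>\<^bsub>IR\<^esub> r \<in> I"
      by (simp add: mult.commute)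
  qed
qed

definition mm :: "'k fps fps set"
  where "mm = {f \<in> RR. coef f 0 = 0}"

lemma mm_eq_supported: "mm = supported invariant_exps"
  unfolding mm_def RR_def supported_def invariant_exps_def by blast

lemma ideal_mm: "ideal mm IR"
  unfolding ideal_IR_iff RR_submod_def
  by (auto simp: mm_def coef_mult_0 RR_add RR_mult)

lemma RR_submod_one:
  assumes "RR_submod N" "1 \<in> N"
  shows "RR \<subseteq> N"
  using RR_submodD(3)[OF assms(1) _ assms(2)] by auto

lemma proper_ideal_subset_mm:
  assumes "ideal I IR" "I \<noteq> RR"
  shows "I \<subseteq> mm"
proof
  fix f assume f: "f \<in> I"
  have I: "I \<subseteq> RR" "RR_submod I" using assms(1) ideal_IR_iff by auto
  have "coef f 0 = 0"
  proof (rule ccontr)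
    assume "coef f 0 \<noteq> 0"
    then obtain g where "g \<in> RR" "f * g = 1"
      using RR_inverse[of f] f I(1) by blast
    then have "1 \<in> I"
      using RR_submodD(3)[OF I(2) _ f, of g] by (simp add: mult.commute)
    then show False
      using RR_submod_one[OF I(2)] I(1) assms(2) by blast
  qed
  then show "f \<in> mm" using f I(1) by (auto simp: mm_def)
qed

lemma mm_neq_RR: "mm \<noteq> RR"
proof -
  have "1 \<notin> mm" by (simp add: mm_def coef_1)
  then show ?thesis using RR_1 by blast
qed

lemma maximalideal_mm: "maximalideal mm IR"
proof (rule maximalidealI[OF ideal_mm])
  show "carrier IR \<noteq> mm" using mm_neq_RR by auto
  fix J assume "ideal J IR" "mm \<subseteq> J"
  then show "J = mm \<or> J = carrier IR"
    using proper_ideal_subset_mm[of J] by auto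
qed

lemma max_ideal_IR: "max_ideal IR = mm"
  unfolding max_ideal_def
proof (rule the_equality)
  show "maximalideal mm IR" by (rule maximalideal_mm)
  fix I assume "maximalideal I IR"
  then interpret maximalideal I IR .
  have "I \<subseteq> mm"
    using proper_ideal_subset_mm[OF is_ideal] I_notcarr by auto
  moreover have "mm \<subseteq> carrier IR" by (auto simp: mm_def)
  ultimately have "mm = I \<or> mm = carrier IR"
    using I_maximal[OF ideal_mm] by blast
  then show "I = mm" using mm_neq_RR by auto
qed

lemma primeideal_cancel:
  assumes "primeideal P IR" "f \<in> RR" "g \<in> RR" "f \<notin> P" "f ^ p * g \<in> P"
  shows "g \<in> P"
proof -
  interpret primeideal P IR by (rule assms(1))
  show ?thesis
    using assms(5)
  proof (induction p)
    case (Suc p)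
    then have "f \<otimes>\<^bsub>IR\<^esub> (f ^ p * g) \<in> P" by (simp add: mult.assoc)
    then have "f \<in> P \<or> f ^ p * g \<in> P"
      using assms(2,3) by (intro I_prime) (simp_all add: RR_mult RR_power)
    then show ?case using assms(4) Suc.IH by blast
  qed simp
qed

text \<open>Choose \<open>f\<^sub>i\<close> in the \<open>i\<close>-th prime but not in the previous one. The identity of \<open>collapse\<close> puts its left side
  into \<open>P 1\<close>; cancelling powers of \<open>f\<^sub>2\<close> modulo \<open>P 1\<close> and of \<open>f\<^sub>3\<close> modulo \<open>P 2\<close> then gives \<open>1 \<in> P 2\<close>.\<close>

lemma no_long_prime_chain:
  assumes P: "\<And>i. i \<le> 3 \<Longrightarrow> primeideal (P i) IR" and sub: "\<And>i. i < 3 \<Longrightarrow> P i \<subset> P (Suc i)"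
  shows False
proof -
  have ideal: "P i \<subseteq> RR" "RR_submod (P i)" "P i \<noteq> RR" if "i \<le> 3" for i
  proof -
    interpret primeideal "P i" IR by (rule P[OF that])
    show "P i \<subseteq> RR" "RR_submod (P i)" using is_ideal ideal_IR_iff by auto
    show "P i \<noteq> RR" using I_notcarr by auto
  qed
  have "\<exists>f. f \<in> P (Suc i) \<and> f \<notin> P i" if "i < 3" for i
    using sub[OF that] by blast
  then obtain f1 f2 f3 where f: "f1 \<in> P 1" "f1 \<notin> P 0" "f2 \<in> P 2" "f2 \<notin> P 1" "f3 \<in> P 3" "f3 \<notin> P 2"
    by (metis One_nat_def Suc_1 numeral_3_eq_3 lessI less_SucI zero_less_Suc)
  have "f1 \<in> RR" "f2 \<in> RR" "f3 \<in> RR"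
    using f ideal(1)[of 1] ideal(1)[of 2] ideal(1)[of 3] by auto
  moreover have "f1 \<noteq> 0" using f(2) RR_submodD(1)[OF ideal(2)[of 0]] by auto
  moreover have "coef f3 0 = 0"
  proof -
    interpret primeideal "P 3" IR by (rule P) simp
    have "f3 \<in> mm" using proper_ideal_subset_mm[OF is_ideal ideal(3)] f(5) by auto
    then show ?thesis by (simp add: mm_def)
  qed
  ultimately obtain p q A B where rel: "A \<in> RR" "B \<in> RR" "f2 ^ p * (f3 ^ q + A * f2) = B * f1"
    and fR: "f1 \<in> RR" "f2 \<in> RR" "f3 \<in> RR"
    using collapse[of f1 f2 f3] by blast
  have S2: "RR_submod (P 2)" using ideal(2)[of 2] by simp
  have P12: "P 1 \<subseteq> P 2" using sub[of 1] by (simp add: numeral_2_eq_2 psubset_imp_subset)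
  have "B * f1 \<in> P 1"
    using RR_submodD(3)[OF ideal(2)[of 1] rel(2) f(1)] by simp
  then have "f2 ^ p * (f3 ^ q + A * f2) \<in> P 1"
    by (simp only: rel(3))
  moreover have "f3 ^ q + A * f2 \<in> RR"
    using fR rel(1) by (intro RR_add RR_mult RR_power)
  ultimately have "f3 ^ q + A * f2 \<in> P 1"
    using primeideal_cancel[OF P[of 1] fR(2) _ f(4)] by simp
  then have "f3 ^ q + A * f2 - A * f2 \<in> P 2"
    using P12 RR_submodD(3)[OF S2 rel(1) f(3)] RR_submodD(5)[OF S2] by blast
  then have "f3 ^ q * 1 \<in> P 2" by simp
  then have "1 \<in> P 2"
    using primeideal_cancel[OF P[of 2] fR(3) RR_1 f(6)] by simp
  then show False
    using RR_submod_one[OF ideal(2)[of 2]] ideal(1,3)[of 2] by auto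
qed

lemma primeideal_IR_I:
  assumes "P \<subseteq> RR" "RR_submod P" "1 \<notin> P"
    and "\<And>f g. f \<in> RR \<Longrightarrow> g \<in> RR \<Longrightarrow> f * g \<in> P \<Longrightarrow> f \<in> P \<or> g \<in> P"
  shows "primeideal P IR"
proof (rule primeidealI)
  show "ideal P IR" using assms(1,2) ideal_IR_iff by blast
  show "carrier IR \<noteq> P" using assms(3) RR_1 by auto
qed (use IR_cring assms(4) in auto)

lemma krull_dim_IR: "krull_dim IR = enat 2"
  unfolding krull_dim_def
proof (rule antisym)
  show "Sup {enat l |l. \<exists>P. (\<forall>i\<le>l. primeideal (P i) IR) \<and> (\<forall>i<l. P i \<subset> P (Suc i))} \<le> enat 2"
  proof (rule Sup_least, clarify)
    fix l P assume P: "\<forall>i\<le>l. primeideal (P i) IR" "\<forall>i<l. P i \<subset> P (Suc i)"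
    have "\<not> 3 \<le> l"
      using no_long_prime_chain[of P] P by auto
    then show "enat l \<le> enat 2" by simp
  qed
  \<comment> \<open>the invariant series that vanish on the \<open>x\<close>-axis\<close>
  define P1 :: "'k fps fps set" where "P1 = {f \<in> RR. fps_nth f 0 = 0}"
  define P where "P i = (if i = 0 then {0} else if i = 1 then P1 else mm)" for i :: nat
  have "primeideal {0} IR"
    by (rule primeideal_IR_I) (auto simp: RR_submod_def)
  moreover have "primeideal P1 IR"
    by (rule primeideal_IR_I) (auto simp: P1_def RR_submod_def RR_add RR_mult)
  moreover have "primeideal mm IR"
    by (rule primeideal_IR_I) (auto simp: mm_def RR_submod_def coef_mult_0 coef_1 RR_add RR_mult)
  ultimately have prime: "\<forall>i\<le>2. primeideal (P i) IR"
    by (auto simp: P_def)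
  have xn: "xy_monomial (n, 0) \<in> RR" and yn: "xy_monomial (0, n) \<in> RR"
    by (auto intro: RR_monomial simp: x_axis_weight y_axis_weight)
  have "{0} \<subset> P1"
  proof
    show "{0} \<subseteq> P1" by (auto simp: P1_def)
    have "xy_monomial (0, n) \<in> P1"
      using yn n_gt_1 by (simp add: P1_def fps_nth_0_eq_0_iff coef_xy_monomial)
    then show "{0} \<noteq> P1" using xy_monomial_neq_0 by blast
  qed
  moreover have "P1 \<subset> mm"
  proof
    show "P1 \<subseteq> mm" by (auto simp: P1_def mm_def coef_def)
    have "xy_monomial (n, 0) \<in> mm"
      using xn n_gt_1 by (simp add: mm_def coef_xy_monomial zero_prod_def)
    moreover have "xy_monomial (n, 0) \<notin> P1"
      by (auto simp: P1_def fps_nth_0_eq_0_iff coef_xy_monomial)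
    ultimately show "P1 \<noteq> mm" by blast
  qed
  ultimately have "\<forall>i<2. P i \<subset> P (Suc i)"
    by (auto simp: P_def less_2_cases_iff)
  with prime show "enat 2 \<le> Sup {enat l |l. \<exists>P. (\<forall>i\<le>l. primeideal (P i) IR) \<and> (\<forall>i<l. P i \<subset> P (Suc i))}"
    by (intro Sup_upper) blast
qed

section \<open>The modules of semi-invariants have depth two\<close>

abbreviation M :: "int \<Rightarrow> ('k fps fps, 'k fps fps) module"
  where "M t \<equiv> smod (weight_class t)"

text \<open>The submodule \<open>(xs) M\<^sub>t\<close>, by which \<open>mod_out\<close> divides.\<close>

definition seq_smult :: "int \<Rightarrow> 'k fps fps list \<Rightarrow> 'k fps fps set"
  where "seq_smult t xs = ideal_smult IR (genideal IR (set xs)) (M t)"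

lemma seq_smult_facts:
  assumes "set xs \<subseteq> RR"
  shows "RR_submod (seq_smult t xs)" "seq_smult t xs \<subseteq> supported (weight_class t)"
    "f \<in> set xs \<Longrightarrow> v \<in> supported (weight_class t) \<Longrightarrow> f * v \<in> seq_smult t xs"
proof -
  interpret cring IR by (rule IR_cring)
  let ?I = "genideal IR (set xs)"
  let ?S = "{r * v | r v. r \<in> ?I \<and> v \<in> supported (weight_class t)}"
  have xs: "set xs \<subseteq> carrier IR" using assms by simp
  have "ideal ?I IR" by (rule genideal_ideal[OF xs])
  then have "?I \<subseteq> RR" using ideal_IR_iff by blast
  then have S: "?S \<subseteq> supported (weight_class t)"
    using RR_mult_supported[OF exps_closed_weight_class] by blast
  note sp = R_span_facts[OF exps_closed_weight_class S]
  show "RR_submod (seq_smult t xs)" "seq_smult t xs \<subseteq> supported (weight_class t)"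
    using sp(1,2) by (simp_all add: seq_smult_def ideal_smult_eq)
  show "f * v \<in> seq_smult t xs" if "f \<in> set xs" "v \<in> supported (weight_class t)"
  proof -
    have "f \<in> ?I" using genideal_self[OF xs] that(1) by blast
    then have "f * v \<in> ?S" using that(2) by blast
    then show ?thesis using sp(3) unfolding seq_smult_def ideal_smult_eq by (rule subsetD[rotated])
  qed
qed

lemma seq_smult_mono:
  assumes "set ys \<subseteq> RR" "set xs \<subseteq> set ys"
  shows "seq_smult t xs \<subseteq> seq_smult t ys"
proof -
  interpret cring IR by (rule IR_cring)
  have "genideal IR (set xs) \<subseteq> genideal IR (set ys)"
    using assms by (intro subset_Idl_subset) auto
  then have "{r * v | r v. r \<in> genideal IR (set xs) \<and> v \<in> supported (weight_class t)} \<subseteq>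
      {r * v | r v. r \<in> genideal IR (set ys) \<and> v \<in> supported (weight_class t)}"
    by blast
  then show ?thesis
    unfolding seq_smult_def ideal_smult_eq by (rule R_span_mono[OF exps_closed_weight_class])
qed

lemma mod_out_eq: "mod_out IR (M t) xs = quo (weight_class t) (seq_smult t xs)"
  by (simp add: mod_out_def seq_smult_def)

lemma nonzerodivisor_cancel_power:
  assumes N: "RR_submod N" and D: "exps_closed D" and r: "r \<in> RR"
    and nz: "nonzerodivisor_on (quo D N) r"
    and v: "v \<in> supported D" "r ^ p * v \<in> N"
  shows "v \<in> N"
  using v(2)
proof (induction p)
  case (Suc p)
  have "r ^ p * v \<in> supported D"
    using RR_mult_supported[OF D RR_power[OF r] v(1)] .
  moreover have "r * (r ^ p * v) \<in> N"
    using Suc.prems by (simp add: mult.assoc)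
  ultimately have "r ^ p * v \<in> N"
    using nz nonzerodivisor_quo_iff[OF N r] by blast
  then show ?case by (rule Suc.IH)
qed simp

text \<open>Apply the identity of \<open>collapse\<close> to an element \<open>v\<close> and cancel \<open>f\<^sub>2\<close> modulo \<open>f\<^sub>1\<close> and then \<open>f\<^sub>3\<close> modulo
  \<open>(f\<^sub>1, f\<^sub>2)\<close>. This shows \<open>v \<in> (f\<^sub>1, f\<^sub>2) M\<^sub>t\<close>, so the last quotient would be zero.\<close>

lemma regular_sequence_length_le_2:
  assumes xs: "set xs \<subseteq> mm" and reg: "regular_sequence IR (M t) xs"
  shows "length xs \<le> 2"
proof (rule ccontr)
  assume "\<not> length xs \<le> 2"
  then obtain f1 f2 f3 ys where eq: "xs = f1 # f2 # f3 # ys"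
    by (cases xs rule: remdups_adj.cases) (auto simp: neq_Nil_conv Suc_le_eq)
  let ?D = "weight_class t"
  have xsR: "set xs \<subseteq> RR" using xs by (auto simp: mm_def)
  have f: "f1 \<in> RR" "f2 \<in> RR" "f3 \<in> RR" "coef f3 0 = 0"
    using xs eq by (auto simp: mm_def)
  have nz: "nonzerodivisor_on (quo ?D (seq_smult t (take i xs))) (xs ! i)" if "i < length xs" for i
    using reg that unfolding regular_sequence_def mod_out_eq by blast
  have nz0: "nonzerodivisor_on (quo ?D (seq_smult t [])) f1" using nz[of 0] by (simp add: eq)
  have nz1: "nonzerodivisor_on (quo ?D (seq_smult t [f1])) f2" using nz[of 1] by (simp add: eq)
  have nz2: "nonzerodivisor_on (quo ?D (seq_smult t [f1, f2])) f3"
    using nz[of 2] by (simp add: eq)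
  have o0: "RR_submod (seq_smult t [])" and o1: "RR_submod (seq_smult t [f1])" and o2: "RR_submod (seq_smult t [f1, f2])"
    using f by (auto intro!: seq_smult_facts)
  have nontriv: "\<not> supported ?D \<subseteq> seq_smult t xs"
    using reg quo_nontrivial_iff[OF seq_smult_facts(1)[OF xsR]] unfolding regular_sequence_def mod_out_eq by blast
  have f1: "f1 \<noteq> 0"
  proof
    assume "f1 = 0"
    then have "supported ?D \<subseteq> seq_smult t []"
      using nz0 nonzerodivisor_quo_iff[OF o0 RR_0] RR_submodD(1)[OF o0] by auto
    then show False
      using nontriv seq_smult_mono[OF xsR, of "[]" t] by auto
  qed
  obtain p q A B where rel: "A \<in> RR" "B \<in> RR" "f2 ^ p * (f3 ^ q + A * f2) = B * f1"
    using collapse[OF f(1) f1 f(2-4)] by blast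
  have "supported ?D \<subseteq> seq_smult t [f1, f2]"
  proof
    fix v :: "'k fps fps" assume v: "v \<in> supported ?D"
    note cl = RR_mult_supported[OF exps_closed_weight_class]
    have "f2 ^ p * (f3 ^ q * v + A * (f2 * v)) = f1 * (B * v)"
    proof -
      have "f2 ^ p * (f3 ^ q * v + A * (f2 * v)) = (f2 ^ p * (f3 ^ q + A * f2)) * v"
        by (simp add: algebra_simps)
      then show ?thesis by (simp only: rel(3) mult_ac)
    qed
    moreover have "f1 * (B * v) \<in> seq_smult t [f1]"
      using f(1) cl[OF rel(2) v] by (intro seq_smult_facts) auto
    ultimately have "f2 ^ p * (f3 ^ q * v + A * (f2 * v)) \<in> seq_smult t [f1]" by simp
    moreover have "f3 ^ q * v + A * (f2 * v) \<in> supported ?D"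
      using v f rel(1) by (intro supported_add cl RR_power)
    ultimately have "f3 ^ q * v + A * (f2 * v) \<in> seq_smult t [f1]"
      using nonzerodivisor_cancel_power[OF o1 exps_closed_weight_class f(2) nz1] by blast
    then have "f3 ^ q * v + A * (f2 * v) \<in> seq_smult t [f1, f2]"
      using seq_smult_mono[of "[f1, f2]" "[f1]" t] f by auto
    moreover have "A * (f2 * v) \<in> seq_smult t [f1, f2]"
      using f v by (intro RR_submodD(3)[OF o2 rel(1)] seq_smult_facts) auto
    ultimately have "f3 ^ q * v \<in> seq_smult t [f1, f2]"
      using RR_submodD(5)[OF o2, of "f3 ^ q * v + A * (f2 * v)" "A * (f2 * v)"] by simp
    then show "v \<in> seq_smult t [f1, f2]"
      by (rule nonzerodivisor_cancel_power[OF o2 exps_closed_weight_class f(3) nz2 v])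
  qed
  then show False
    using nontriv seq_smult_mono[OF xsR, of "[f1, f2]" t] by (auto simp: eq)
qed

lemma seq_smult_monomials:
  assumes F: "F \<subseteq> weight_class 0" and xs: "set xs = xy_monomial ` F"
  shows "seq_smult t xs = supported {p + w | p w. p \<in> F \<and> w \<in> weight_class t}"
proof -
  interpret cring IR by (rule IR_cring)
  let ?U = "{p + u | p u. p \<in> F \<and> u \<in> weight_class 0}"
  let ?I = "genideal IR (set xs)"
  have xsR: "set xs \<subseteq> RR" using F xs RR_monomial by auto
  have U: "?U \<subseteq> weight_class 0" using F weight_class_0_add by blast
  have clU: "exps_closed ?U"
    unfolding exps_closed_def
  proof (intro ballI)
    fix v w assume v: "v \<in> weight_class 0" and "w \<in> ?U"
    then obtain p u where pu: "w = p + u" "p \<in> F" "u \<in> weight_class 0" by blast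
    have "v + w = p + (v + u)" by (simp add: pu(1) add.left_commute)
    then show "v + w \<in> ?U" using pu weight_class_0_add[OF v pu(3)] by blast
  qed
  have ideal: "ideal ?I IR" using xsR by (intro genideal_ideal) simp
  have "set xs \<subseteq> supported ?U"
  proof
    fix x assume "x \<in> set xs"
    then obtain p where p: "p \<in> F" "x = xy_monomial p" using xs by blast
    have "p + 0 \<in> ?U" using p(1) zero_in_weight_class by blast
    then have "p \<in> ?U" by (simp only: add_0_right)
    then show "x \<in> supported ?U" unfolding p(2) by (rule supported_xy_monomial)
  qed
  moreover have "ideal (supported ?U) IR"
    unfolding ideal_IR_iff RR_def using RR_submod_supported[OF clU] supported_mono[OF _ U] by blast
  ultimately have I1: "?I \<subseteq> supported ?U"
    by (intro genideal_minimal)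
  have I2: "xy_monomial w \<in> ?I" if w: "w \<in> ?U" for w
  proof -
    obtain p u where pu: "w = p + u" "p \<in> F" "u \<in> weight_class 0" using w by blast
    have "xy_monomial p \<in> ?I"
      using pu(2) xs xsR genideal_self[of "set xs"] by auto
    moreover have "RR_submod ?I" using ideal unfolding ideal_IR_iff by blast
    ultimately have "xy_monomial u * xy_monomial p \<in> ?I"
      by (intro RR_submodD(3) RR_monomial pu(3))
    then show ?thesis by (simp add: pu(1) xy_monomial_add mult.commute)
  qed
  have "seq_smult t xs = supported {u + v | u v. u \<in> ?U \<and> v \<in> weight_class t}"
    unfolding seq_smult_def by (rule ideal_smult_monomial[OF U clU I1 I2])
  also have "{u + v | u v. u \<in> ?U \<and> v \<in> weight_class t} = {p + w | p w. p \<in> F \<and> w \<in> weight_class t}"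
  proof (intro equalityI subsetI)
    fix x assume "x \<in> {u + v | u v. u \<in> ?U \<and> v \<in> weight_class t}"
    then obtain p u v where "x = (p + u) + v" "p \<in> F" "u \<in> weight_class 0" "v \<in> weight_class t" by blast
    moreover from this have "x = p + (u + v)" by (simp only: add.assoc)
    ultimately show "x \<in> {p + w | p w. p \<in> F \<and> w \<in> weight_class t}"
      using weight_class_0_add[of u v t] by blast
  next
    fix x assume "x \<in> {p + w | p w. p \<in> F \<and> w \<in> weight_class t}"
    then obtain p w where "x = p + w" "p \<in> F" "w \<in> weight_class t" by blast
    moreover from this have "x = (p + 0) + w" by (simp only: add_0_right)
    ultimately
    show "x \<in> {u + v | u v. u \<in> ?U \<and> v \<in> weight_class t}"
      using zero_in_weight_class by blast
  qed
  finally show ?thesis .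
qed

lemma nonzerodivisor_monomial:
  assumes N: "exps_closed E" and p: "p \<in> weight_class 0"
    and "\<And>w. w \<in> D \<Longrightarrow> p + w \<in> E \<Longrightarrow> w \<in> E"
  shows "nonzerodivisor_on (quo D (supported E)) (xy_monomial p)"
  unfolding nonzerodivisor_quo_iff[OF RR_submod_supported[OF N] RR_monomial[OF p]]
proof (intro ballI impI)
  fix v :: "'k fps fps" assume v: "v \<in> supported D" "xy_monomial p * v \<in> supported E"
  show "v \<in> supported E"
    unfolding supported_def
  proof (intro CollectI allI impI)
    fix w assume w: "coef v w \<noteq> 0"
    have "coef (xy_monomial p * v) (p + w) = coef v w"
      by (simp add: coef_xy_monomial_mult)
    then have "p + w \<in> E" using v(2) w supportedD by metis
    moreover have "w \<in> D" using v(1) w supportedD by metis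
    ultimately show "w \<in> E" using assms(3) by blast
  qed
qed

lemma exists_axis_exponent: "\<exists>i<n. (i, 0) \<in> weight_class t"
proof (intro exI conjI)
  show "nat (t mod int n) < n" using n_gt_1 by (simp add: nat_less_iff)
  show "(nat (t mod int n), 0) \<in> weight_class t"
    using n_gt_1 by (simp add: weight_class_def cong_def)
qed

lemma regular_sequence_axes:
  "regular_sequence IR (M t) [xy_monomial (n, 0), xy_monomial (0, n)]"
proof -
  have xG: "(n, 0) \<in> weight_class 0" and yG: "(0, n) \<in> weight_class 0"
    by (simp_all add: x_axis_weight y_axis_weight)
  let ?E = "\<lambda>F. {p + w | p w. p \<in> F \<and> w \<in> weight_class t}"
  have E0: "seq_smult t [] = supported (?E {})"
    by (rule seq_smult_monomials) auto
  have E1: "seq_smult t [xy_monomial (n, 0)] = supported (?E {(n, 0)})"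
    using xG by (intro seq_smult_monomials) auto
  have E2: "seq_smult t [xy_monomial (n, 0), xy_monomial (0, n)] = supported (?E {(n, 0), (0, n)})"
    using xG yG by (intro seq_smult_monomials) auto
  have clE1: "exps_closed (?E {(n, 0)})"
    unfolding exps_closed_def
  proof (intro ballI)
    fix u v assume u: "u \<in> weight_class 0" and "v \<in> ?E {(n, 0)}"
    then obtain w where w: "v = (n, 0) + w" "w \<in> weight_class t" by blast
    have "u + v = (n, 0) + (u + w)" by (simp only: w(1) add.left_commute)
    then show "u + v \<in> ?E {(n, 0)}" using weight_class_0_add[OF u w(2)] by blast
  qed
  have nz0: "nonzerodivisor_on (quo (weight_class t) (supported (?E {}))) (xy_monomial (n, 0))"
    using xG by (intro nonzerodivisor_monomial) (auto simp: exps_closed_def)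
  have nz1: "nonzerodivisor_on (quo (weight_class t) (supported (?E {(n, 0)}))) (xy_monomial (0, n))"
  proof (rule nonzerodivisor_monomial[OF clE1 yG])
    fix w assume w: "w \<in> weight_class t" "(0, n) + w \<in> ?E {(n, 0)}"
    then obtain w' where "(0, n) + w = (n, 0) + w'" by blast
    then have le: "(n, 0) \<unlhd> w" by (auto simp: prod_eq_iff)
    then have "w = (n, 0) + (w - (n, 0))" by (auto simp: prod_eq_iff)
    then show "w \<in> ?E {(n, 0)}" using weight_class_0_diff[OF xG w(1) le] by blast
  qed
  obtain i where i: "i < n" "(i, 0) \<in> weight_class t" using exists_axis_exponent by blast
  have "(i, 0) \<notin> ?E {(n, 0), (0, n)}"
    using i(1) n_gt_1 by auto
  then have "xy_monomial (i, 0) \<notin> (supported (?E {(n, 0), (0, n)}) :: 'k fps fps set)"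
    by (simp only: xy_monomial_supported_iff simp_thms)
  then have nontriv: "\<not> supported (weight_class t) \<subseteq> (supported (?E {(n, 0), (0, n)}) :: 'k fps fps set)"
    using supported_xy_monomial[OF i(2)] by blast
  have R: "set [xy_monomial (n, 0), xy_monomial (0, n)] \<subseteq> RR"
    using RR_monomial[OF xG] RR_monomial[OF yG] by simp
  have "nonzerodivisor_on (mod_out IR (M t) (take i [xy_monomial (n, 0), xy_monomial (0, n)]))
      ([xy_monomial (n, 0), xy_monomial (0, n)] ! i)" if "i < 2" for i
  proof -
    consider "i = 0" | "i = 1" using \<open>i < 2\<close> by linarith
    then show ?thesis
      by cases (simp_all only: mod_out_eq take_0 nth_Cons_0 E0 nz0 One_nat_def take_Suc_Cons nth_Cons_Suc E1 nz1)
  qed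
  moreover have "carrier (mod_out IR (M t) [xy_monomial (n, 0), xy_monomial (0, n)]) \<noteq>
      {\<zero>\<^bsub>mod_out IR (M t) [xy_monomial (n, 0), xy_monomial (0, n)]\<^esub>}"
    unfolding mod_out_eq quo_nontrivial_iff[OF seq_smult_facts(1)[OF R]] unfolding E2 by (rule nontriv)
  ultimately show ?thesis
    unfolding regular_sequence_def using R by (auto simp only: carrier_IR length_Cons list.size numeral_2_eq_2)
qed

lemma depth_M: "depth IR (M t) = enat 2"
  unfolding depth_def max_ideal_IR
proof (rule antisym)
  show "Sup {enat (length xs) |xs. set xs \<subseteq> mm \<and> regular_sequence IR (M t) xs} \<le> enat 2"
    by (rule Sup_least) (use regular_sequence_length_le_2 in auto)
  have "set [xy_monomial (n, 0), xy_monomial (0, n)] \<subseteq> mm"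
    using n_gt_1 by (auto simp: mm_def coef_xy_monomial zero_prod_def x_axis_weight y_axis_weight intro: RR_monomial)
  moreover have "enat 2 = enat (length [xy_monomial (n, 0), xy_monomial (0, n) :: 'k fps fps])" by simp
  ultimately show "enat 2 \<le> Sup {enat (length xs) |xs. set xs \<subseteq> mm \<and> regular_sequence IR (M t) xs}"
    using regular_sequence_axes[of t] by (intro Sup_upper) blast
qed

lemma M_maximal_cohen_macaulay: "maximal_cohen_macaulay IR (M t)"
proof -
  obtain i where "(i, 0) \<in> weight_class t" using exists_axis_exponent by blast
  then have "xy_monomial (i, 0) \<in> carrier (M t)" by (simp add: supported_xy_monomial)
  then have "carrier (M t) \<noteq> {\<zero>\<^bsub>M t\<^esub>}" using xy_monomial_neq_0 by auto
  then show ?thesis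
    unfolding maximal_cohen_macaulay_def
    using smod_module fin_gen_smod[OF subset_refl] exps_closed_weight_class depth_M krull_dim_IR by auto
qed

end

section \<open>Length and number of generators of quotients of monomial modules\<close>

text \<open>Vectors chosen from the successive differences are independent.\<close>

lemma (in vector_space) subspace_chain_length:
  assumes sub: "\<And>i. i \<le> l \<Longrightarrow> subspace (V i)" and strict: "\<And>i. i < l \<Longrightarrow> V i \<subset> V (Suc i)"
    and B: "V l \<subseteq> span B" "finite B"
  shows "l \<le> card B"
proof -
  have "\<exists>f. f \<in> V (Suc i) \<and> f \<notin> V i" if "i < l" for i
    using strict[OF that] by blast
  then obtain f where f: "\<And>i. i < l \<Longrightarrow> f i \<in> V (Suc i) \<and> f i \<notin> V i"
    by metis
  have "independent (f ` {..<i}) \<and> card (f ` {..<i}) = i \<and> f ` {..<i} \<subseteq> V i" if "i \<le> l" for i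
    using that
  proof (induction i)
    case 0
    then show ?case by (simp add: independent_empty)
  next
    case (Suc i)
    then have i: "i < l" and IH: "independent (f ` {..<i})" "card (f ` {..<i}) = i" "f ` {..<i} \<subseteq> V i"
      by simp_all
    have "span (f ` {..<i}) \<subseteq> V i"
      using IH(3) sub[of i] i by (intro span_minimal) auto
    then have notin: "f i \<notin> span (f ` {..<i})"
      using f[OF i] by blast
    then have "f i \<notin> f ` {..<i}"
      using span_base[of "f i" "f ` {..<i}"] by blast
    moreover have eq: "f ` {..<Suc i} = insert (f i) (f ` {..<i})"
      by (auto simp: less_Suc_eq)
    ultimately show ?case
      using independent_insertI[OF notin IH(1)] IH(2,3) f[OF i] strict[OF i] by (auto simp: eq)
  qed
  from this[of l] have "independent (f ` {..<l})" "card (f ` {..<l}) = l" "f ` {..<l} \<subseteq> span B"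
    using B(1) by auto
  then show ?thesis
    using independent_span_bound[OF B(2), of "f ` {..<l}"] by simp
qed

lemma scalar_simps:
  "scalar (c + d) = scalar c + scalar d" "scalar (c * d) = scalar c * scalar d"
  "scalar 0 = 0" "scalar 1 = 1"
  by (simp_all add: scalar_def)

lemma scalar_vector_space: "vector_space (\<lambda>c (f :: 'k::field fps fps). scalar c * f)"
  by unfold_locales (simp_all add: scalar_simps algebra_simps)

lemma coef_scalar_sum:
  "finite T \<Longrightarrow> coef (\<Sum>w\<in>T. scalar (c w) * xy_monomial w) v = (if v \<in> T then c v else 0)"
  by (simp add: coef_xy_monomial if_distrib cong: if_cong)

lemma res_eq_sum:
  "finite T \<Longrightarrow> res T f = (\<Sum>w\<in>T. scalar (coef f w) * xy_monomial w)"
  by (rule coef_ext) (simp only: coef_scalar_sum coef_res)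

context cyclic_quotient begin

text \<open>Adding an exponent of maximal degree keeps the set closed, because translating it by a nonzero
  invariant exponent leads to a larger degree, hence into \<open>E\<close>.\<close>

lemma exps_closed_chain:
  assumes "E \<subseteq> D" "exps_closed E" "exps_closed D" "finite (D - E)"
  shows "\<exists>C. C 0 = E \<and> C (card (D - E)) = D \<and> (\<forall>i\<le>card (D - E). exps_closed (C i) \<and> E \<subseteq> C i \<and> C i \<subseteq> D) \<and>
    (\<forall>i<card (D - E). C i \<subset> C (Suc i))"
  using assms
proof (induction "card (D - E)" arbitrary: E)
  case 0
  then have "D = E" by auto
  then show ?case using 0 by (intro exI[of _ "\<lambda>_. E"]) auto
next
  case (Suc d)
  define s where "s w = fst w + snd w" for w :: "nat \<times> nat"
  have ne: "D - E \<noteq> {}"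
  proof
    assume "D - E = {}"
    then have "card (D - E) = 0" by (simp only: card.empty)
    then show False using Suc.hyps(2) by simp
  qed
  define m where "m = Max (s ` (D - E))"
  have "m \<in> s ` (D - E)"
    unfolding m_def using ne Suc.prems(4) by (intro Max_in) auto
  then obtain w where w: "w \<in> D - E" "s w = m" by blast
  have max: "s v \<le> s w" if "v \<in> D - E" for v
    unfolding w(2) m_def using that Suc.prems(4) by (intro Max_ge) auto
  let ?E = "insert w E"
  have cl: "exps_closed ?E"
    unfolding exps_closed_def
  proof (intro ballI)
    fix u v assume u: "u \<in> weight_class 0" and v: "v \<in> ?E"
    show "u + v \<in> ?E"
    proof (cases "v = w \<and> u \<noteq> 0")
      case True
      then have "s w < s (u + v)" by (auto simp: s_def prod_eq_iff)
      moreover have "u + v \<in> D" using u v True w Suc.prems(3) unfolding exps_closed_def by blast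
      ultimately show ?thesis using max[of "u + v"] by auto
    next
      case False
      then show ?thesis using u v Suc.prems(2) unfolding exps_closed_def by auto
    qed
  qed
  have "D - ?E = (D - E) - {w}" by blast
  then have card: "d = card (D - ?E)" "finite (D - ?E)"
    using Suc.hyps(2) w(1) Suc.prems(4) by simp_all
  obtain C where C: "C 0 = ?E" "C d = D" "\<forall>i\<le>d. exps_closed (C i) \<and> ?E \<subseteq> C i \<and> C i \<subseteq> D"
    "\<forall>i<d. C i \<subset> C (Suc i)"
    using Suc.hyps(1)[OF card(1) _ cl Suc.prems(3) card(2)] w(1) Suc.prems(1) card(1) by auto
  show ?case
    unfolding Suc.hyps(2)[symmetric]
  proof (intro exI[of _ "case_nat E C"] conjI allI impI)
    fix i assume "i \<le> Suc d"
    then show "exps_closed (case i of 0 \<Rightarrow> E | Suc j \<Rightarrow> C j)" "E \<subseteq> (case i of 0 \<Rightarrow> E | Suc j \<Rightarrow> C j)"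
      "(case i of 0 \<Rightarrow> E | Suc j \<Rightarrow> C j) \<subseteq> D"
      using C(3) Suc.prems(1,2) by (cases i; auto)+
  next
    fix i assume "i < Suc d"
    then show "(case i of 0 \<Rightarrow> E | Suc j \<Rightarrow> C j) \<subset> (case Suc i of 0 \<Rightarrow> E | Suc j \<Rightarrow> C j)"
      using C(1,4) w(1) by (cases i) auto
  qed (use C(2) in auto)
qed

text \<open>Submodules are subspaces over the field, because scalars are invariant; so a chain of them is no longer
  than the number of monomials that span the quotient. Adding the exponents of \<open>D - E\<close> one at a time
  gives a chain of this length.\<close>

lemma module_length_quo:
  assumes ED: "E \<subseteq> D" and clE: "exps_closed E" and clD: "exps_closed D" and fin: "finite (D - E)"
  shows "module_length IR (quo D (supported E)) = enat (card (D - E))"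
  unfolding module_length_def
proof (rule antisym)
  let ?N = "supported E :: 'k fps fps set"
  let ?Q = "quo D ?N"
  let ?T = "D - E"
  have N: "RR_submod ?N" and ND: "?N \<subseteq> supported D"
    using RR_submod_supported[OF clE] supported_mono[OF _ ED] by blast+
  interpret Q: module IR ?Q by (rule quo_module[OF clD N ND])
  interpret vs: vector_space "\<lambda>c (f :: 'k fps fps). scalar c * f" by (rule scalar_vector_space)
  show "Sup {enat l |l. \<exists>H. (\<forall>i\<le>l. Module.submodule (H i) IR ?Q) \<and> (\<forall>i<l. H i \<subset> H (Suc i))}
      \<le> enat (card ?T)"
  proof (rule Sup_least, clarify)
    fix l H assume H: "\<forall>i\<le>l. Module.submodule (H i) IR ?Q" "\<forall>i<l. H i \<subset> H (Suc i)"
    \<comment> \<open>a subspace of the quotient is seen as a subspace of the series supported on \<open>D - E\<close>\<close>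
    define V where "V i = res ?T ` {v \<in> supported D. coset ?N v \<in> H i}" for i
    have Hsub: "Module.submodule (H i) IR ?Q" if "i \<le> l" for i using H(1) that by blast
    have H0: "?N \<in> H i" if i: "i \<le> l" for i
    proof -
      obtain x where x: "x \<in> H i" using Q.submoduleE(2)[OF Hsub[OF i]] by blast
      then have "x \<in> carrier ?Q" using Q.submoduleE(1)[OF Hsub[OF i]] by blast
      then have "\<zero>\<^bsub>IR\<^esub> \<odot>\<^bsub>?Q\<^esub> x = \<zero>\<^bsub>?Q\<^esub>" by (rule Q.smult_l_null)
      moreover have "\<zero>\<^bsub>IR\<^esub> \<odot>\<^bsub>?Q\<^esub> x \<in> H i"
        by (rule Q.submoduleE(4)[OF Hsub[OF i] _ x]) simp
      ultimately have "\<zero>\<^bsub>?Q\<^esub> \<in> H i" by (rule subst)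
      then show ?thesis by (simp only: quo_simps)
    qed
    have "l \<le> card (xy_monomial ` ?T :: 'k fps fps set)"
    proof (rule vs.subspace_chain_length[of l V])
      fix i assume i: "i \<le> l"
      show "vs.subspace (V i)"
      proof (rule vs.subspaceI)
        have "res ?T 0 = (0 :: 'k fps fps)" by (rule coef_ext) simp
        then show "0 \<in> V i"
          unfolding V_def using H0[OF i] by (intro image_eqI[of _ _ 0]) (auto simp: coset_0)
      next
        fix x y assume "x \<in> V i" "y \<in> V i"
        then obtain v w where v: "x = res ?T v" "v \<in> supported D" "coset ?N v \<in> H i"
          and w: "y = res ?T w" "w \<in> supported D" "coset ?N w \<in> H i" by (auto simp: V_def)
        have "coset ?N (v + w) \<in> H i"
          using Q.submoduleE(5)[OF Hsub[OF i] v(3) w(3)] by (simp add: coset_add[OF N])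
        moreover have "x + y = res ?T (v + w)" by (rule coef_ext) (simp add: v(1) w(1))
        ultimately show "x + y \<in> V i"
          unfolding V_def using v(2) w(2) supported_add by blast
      next
        fix c x assume "x \<in> V i"
        then obtain v where v: "x = res ?T v" "v \<in> supported D" "coset ?N v \<in> H i" by (auto simp: V_def)
        have "coset ?N (scalar c * v) \<in> H i"
          using Q.submoduleE(4)[OF Hsub[OF i] _ v(3), of "scalar c"] by (simp add: coset_smult[OF N])
        moreover have "scalar c * x = res ?T (scalar c * v)" by (rule coef_ext) (simp add: v(1))
        ultimately show "scalar c * x \<in> V i"
          unfolding V_def using v(2) supported_scalar_mult by blast
      qed
    next
      fix i assume i: "i < l"
      have "V i \<subseteq> V (Suc i)" unfolding V_def using H(2) i by blast
      moreover have "V i \<noteq> V (Suc i)"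
      proof
        assume eq: "V i = V (Suc i)"
        obtain x where x: "x \<in> H (Suc i)" "x \<notin> H i" using H(2) i by blast
        have "x \<in> carrier ?Q" using Q.submoduleE(1)[OF Hsub[of "Suc i"]] x(1) i by auto
        then obtain v where v: "v \<in> supported D" "x = coset ?N v" by auto
        have "res ?T v \<in> V (Suc i)" unfolding V_def using v x(1) by blast
        then have "res ?T v \<in> V i" by (simp only: eq)
        then obtain v' where v': "res ?T v = res ?T v'" "v' \<in> supported D" "coset ?N v' \<in> H i"
          unfolding V_def by blast
        have "v - v' \<in> ?N"
          unfolding supported_def
        proof (intro CollectI allI impI)
          fix w assume w: "coef (v - v') w \<noteq> 0"
          have "w \<in> D" using supportedD[OF supported_diff[OF v(1) v'(2)]] w by blast
          moreover have "w \<notin> ?T"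
          proof
            assume "w \<in> ?T"
            then have "coef v w = coef v' w"
              using arg_cong[OF v'(1), of "\<lambda>f. coef f w"] by simp
            then show False using w by simp
          qed
          ultimately show "w \<in> E" by blast
        qed
        then have "x = coset ?N v'" using v(2) coset_eq_iff[OF N] by blast
        then show False using v'(3) x(2) by simp
      qed
      ultimately show "V i \<subset> V (Suc i)" by blast
    next
      show "V l \<subseteq> vs.span (xy_monomial ` ?T)"
      proof
        fix x assume "x \<in> V l"
        then obtain v where "x = res ?T v" by (auto simp: V_def)
        then have x: "x = (\<Sum>w\<in>?T. scalar (coef v w) * xy_monomial w)"
          by (simp only: res_eq_sum[OF fin])
        show "x \<in> vs.span (xy_monomial ` ?T)"
          unfolding x by (intro vs.span_sum vs.span_scale vs.span_base imageI)
      qed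
      show "finite (xy_monomial ` ?T :: 'k fps fps set)" using fin by simp
    qed
    also have "\<dots> \<le> card ?T" using fin by (rule card_image_le)
    finally show "enat l \<le> enat (card ?T)" by simp
  qed
  from exps_closed_chain[OF ED clE clD fin] obtain C where
    CC: "C 0 = E \<and> C (card ?T) = D \<and> (\<forall>i\<le>card ?T. exps_closed (C i) \<and> E \<subseteq> C i \<and> C i \<subseteq> D) \<and>
      (\<forall>i<card ?T. C i \<subset> C (Suc i))" ..
  note C = CC[THEN conjunct2, THEN conjunct2, THEN conjunct1, rule_format]
    CC[THEN conjunct2, THEN conjunct2, THEN conjunct2, rule_format]
  define H where "H i = coset ?N ` supported (C i)" for i
  have "Module.submodule (H i) IR ?Q" if i: "i \<le> card ?T" for i
  proof (rule Q.submoduleI)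
    have cl: "exps_closed (C i)" and CD: "C i \<subseteq> D" using C(1)[OF i] by auto
    have sub: "supported (C i) \<subseteq> (supported D :: 'k fps fps set)" using supported_mono[OF _ CD] by blast
    then show "H i \<subseteq> carrier ?Q" by (auto simp: H_def)
    have "coset ?N 0 \<in> H i" unfolding H_def by (rule imageI) simp
    then show "\<zero>\<^bsub>?Q\<^esub> \<in> H i" by (simp add: coset_0)
    fix x assume x: "x \<in> H i"
    then obtain v where v: "x = coset ?N v" "v \<in> supported (C i)" by (auto simp: H_def)
    have v': "- v \<in> supported (C i)" using v(2) by (rule supported_minus)
    have "\<ominus>\<^bsub>?Q\<^esub> x = coset ?N (- v)"
      using v v' sub by (intro Q.minus_equality) (auto simp: coset_add[OF N] coset_0)
    then show "\<ominus>\<^bsub>?Q\<^esub> x \<in> H i" using v' by (simp add: H_def)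
    show "r \<odot>\<^bsub>?Q\<^esub> x \<in> H i" if "r \<in> carrier IR" for r
      using that v RR_mult_supported[OF cl _ v(2)] by (simp add: H_def coset_smult[OF N])
    fix y assume "y \<in> H i"
    then obtain w where w: "y = coset ?N w" "w \<in> supported (C i)" by (auto simp: H_def)
    show "x \<oplus>\<^bsub>?Q\<^esub> y \<in> H i"
      using supported_add[OF v(2) w(2)] by (simp add: v(1) w(1) H_def coset_add[OF N])
  qed
  moreover have "H i \<subset> H (Suc i)" if i: "i < card ?T" for i
  proof
    show "H i \<subseteq> H (Suc i)"
      unfolding H_def using supported_mono[of _ "C i" "C (Suc i)"] C(2)[OF i] by blast
    obtain w where w: "w \<in> C (Suc i)" "w \<notin> C i" using C(2)[OF i] by blast
    have "coset ?N (xy_monomial w) \<notin> H i"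
    proof
      assume "coset ?N (xy_monomial w) \<in> H i"
      then obtain v where v: "coset ?N (xy_monomial w) = coset ?N v" "v \<in> supported (C i)"
        by (auto simp: H_def)
      then have d: "xy_monomial w - v \<in> ?N" using coset_eq_iff[OF N] by blast
      have "w \<notin> E" using w(2) C(1)[of i] i by auto
      then have "coef (xy_monomial w - v) w = 0" using supportedD[OF d] by blast
      moreover have "coef v w = 0" using supportedD[OF v(2) w(2)] .
      ultimately show False by (simp add: coef_xy_monomial)
    qed
    moreover have "coset ?N (xy_monomial w) \<in> H (Suc i)"
      unfolding H_def using supported_xy_monomial[OF w(1)] by blast
    ultimately show "H i \<noteq> H (Suc i)" by blast
  qed
  ultimately show "enat (card ?T) \<le>
      Sup {enat l |l. \<exists>H. (\<forall>i\<le>l. Module.submodule (H i) IR ?Q) \<and> (\<forall>i<l. H i \<subset> H (Suc i))}"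
    by (intro Sup_upper) blast
qed

text \<open>The cosets of the monomials with exponents in \<open>D - E\<close> form a basis.\<close>

lemma dim_quo:
  assumes ED: "E \<subseteq> D" and clE: "exps_closed E" and clD: "exps_closed D" and fin: "finite (D - E)"
  shows "vectorspace.dim (ring_of_type_algebra :: 'k ring)
    (restrict_scalars scalar (quo D (supported E))) = card (D - E)"
proof -
  let ?N = "supported E :: 'k fps fps set"
  let ?Q = "quo D ?N"
  let ?T = "D - E"
  let ?K = "ring_of_type_algebra :: 'k ring"
  let ?V = "restrict_scalars scalar ?Q"
  have N: "RR_submod ?N" and ND: "?N \<subseteq> supported D"
    using RR_submod_supported[OF clE] supported_mono[OF _ ED] by blast+
  interpret Q: module IR ?Q by (rule quo_module[OF clD N ND])
  have V: "carrier ?V = carrier ?Q" "ring.add ?V = ring.add ?Q" "ring.zero ?V = ring.zero ?Q"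
    "module.smult ?V = (\<lambda>c. module.smult ?Q (scalar c))"
    by (simp_all add: restrict_scalars_def)
  have K: "carrier ?K = UNIV" "monoid.mult ?K = (*)" "monoid.one ?K = 1" "ring.zero ?K = 0" "ring.add ?K = (+)"
    by (simp_all add: ring_of_type_algebra_def fun_eq_iff)
  have "module ?K ?V"
  proof (rule moduleI)
    show "cring ?K" by (rule cring_from_type_algebra)
    show "abelian_group ?V"
    proof (rule abelian_groupI; unfold V)
      show "\<exists>y\<in>carrier ?Q. y \<oplus>\<^bsub>?Q\<^esub> x = \<zero>\<^bsub>?Q\<^esub>" if "x \<in> carrier ?Q" for x
        using that by (intro bexI[of _ "\<ominus>\<^bsub>?Q\<^esub> x"] Q.l_neg Q.a_inv_closed)
    qed (rule Q.a_closed Q.zero_closed Q.a_assoc Q.a_comm Q.l_zero; assumption)+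
  next
    have s: "scalar c \<in> carrier IR" for c by simp
    fix c d x y assume xy: "x \<in> carrier ?V" "y \<in> carrier ?V"
    show "c \<odot>\<^bsub>?V\<^esub> x \<in> carrier ?V"
      using xy Q.smult_closed[OF s] unfolding V by blast
    show "(c \<oplus>\<^bsub>?K\<^esub> d) \<odot>\<^bsub>?V\<^esub> x = c \<odot>\<^bsub>?V\<^esub> x \<oplus>\<^bsub>?V\<^esub> d \<odot>\<^bsub>?V\<^esub> x"
      using xy(1) Q.smult_l_distr[OF s s, of x c d] unfolding V K scalar_simps IR_simps by blast
    show "c \<odot>\<^bsub>?V\<^esub> (x \<oplus>\<^bsub>?V\<^esub> y) = c \<odot>\<^bsub>?V\<^esub> x \<oplus>\<^bsub>?V\<^esub> c \<odot>\<^bsub>?V\<^esub> y"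
      using xy Q.smult_r_distr[OF s, of x y c] unfolding V by blast
    show "(c \<otimes>\<^bsub>?K\<^esub> d) \<odot>\<^bsub>?V\<^esub> x = c \<odot>\<^bsub>?V\<^esub> (d \<odot>\<^bsub>?V\<^esub> x)"
      using xy(1) Q.smult_assoc1[OF s s, of x c d] unfolding V K scalar_simps IR_simps by blast
  next
    fix x assume "x \<in> carrier ?V"
    then show "\<one>\<^bsub>?K\<^esub> \<odot>\<^bsub>?V\<^esub> x = x"
      using Q.smult_one[of x] unfolding V K scalar_simps IR_simps by blast
  qed
  then interpret V: vectorspace ?K ?V
    by (rule vectorspace.intro[OF _ field_from_type_algebra])
  define h where "h w = coset ?N (xy_monomial w)" for w
  have sumD: "(\<Sum>w\<in>F. scalar (c w) * xy_monomial w) \<in> (supported D :: 'k fps fps set)" if "F \<subseteq> D" for F c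
    using that by (intro supported_sum supported_scalar_mult supported_xy_monomial) blast
  have hD: "h w \<in> carrier ?V" if "w \<in> D" for w
    unfolding V h_def quo_simps by (intro imageI supported_xy_monomial that)
  have inj: "inj_on h ?T"
  proof (rule inj_onI)
    fix w w' assume w: "w \<in> ?T" "w' \<in> ?T" "h w = h w'"
    then have "xy_monomial w - xy_monomial w' \<in> ?N"
      using coset_eq_iff[OF N] by (simp add: h_def)
    from supportedD[OF this, of w] w(1) show "w = w'"
      by (auto simp: coef_xy_monomial split: if_splits)
  qed
  have lin: "V.lincomb c (h ` F) = coset ?N (\<Sum>w\<in>F. scalar (c (h w)) * xy_monomial w)"
    if "F \<subseteq> ?T" "finite F" for F c
    using that(2,1)
  proof (induction F rule: finite_induct)
    case empty
    then show ?case by (simp add: V.lincomb_def V coset_0)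
  next
    case (insert w F)
    have hw: "h w \<notin> h ` F" using inj insert.hyps(2) insert.prems by (auto simp: inj_on_def)
    have sub: "h ` F \<subseteq> carrier ?V" using insert.prems hD by blast
    have w: "w \<in> D" using insert.prems by blast
    have "V.lincomb c (h ` insert w F) = V.lincomb c (h ` F \<union> {h w})" by simp
    also have "\<dots> = c (h w) \<odot>\<^bsub>?V\<^esub> h w \<oplus>\<^bsub>?V\<^esub> V.lincomb c (h ` F)"
      using insert.hyps(1) sub hw hD[OF w] by (intro V.lincomb_insert) (auto simp: K)
    also have "c (h w) \<odot>\<^bsub>?V\<^esub> h w = coset ?N (scalar (c (h w)) * xy_monomial w)"
      by (simp add: V h_def coset_smult[OF N])
    finally show ?case
      using insert by (simp add: V coset_add[OF N])
  qed
  have "V.basis (h ` ?T)"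
    unfolding V.basis_def
  proof (intro conjI)
    show sub: "h ` ?T \<subseteq> carrier ?V" using hD by blast
    show "V.lin_indpt (h ` ?T)"
    proof (rule V.finite_lin_indpt2[OF finite_imageI[OF fin] sub], intro ballI)
      fix c x assume lc: "V.lincomb c (h ` ?T) = \<zero>\<^bsub>?V\<^esub>" and "x \<in> h ` ?T"
      then obtain w where w: "w \<in> ?T" "x = h w" by blast
      have "(\<Sum>w\<in>?T. scalar (c (h w)) * xy_monomial w) \<in> ?N"
        using lc lin[OF subset_refl fin, of c] coset_eq_self[OF N] by (simp add: V)
      then have "coef (\<Sum>w\<in>?T. scalar (c (h w)) * xy_monomial w) w = 0"
        using w(1) by (intro supportedD) auto
      then show "c x = \<zero>\<^bsub>?K\<^esub>"
        unfolding coef_scalar_sum[OF fin] using w by (simp add: K)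
    qed
    show "V.span (h ` ?T) = carrier ?V"
    proof
      show "V.span (h ` ?T) \<subseteq> carrier ?V" using sub by (rule V.span_is_subset2)
      show "carrier ?V \<subseteq> V.span (h ` ?T)"
      proof
        fix x assume "x \<in> carrier ?V"
        then obtain v where v: "v \<in> supported D" "x = coset ?N v" by (auto simp: V)
        define c where "c y = coef v (the_inv_into ?T h y)" for y
        have "(\<Sum>w\<in>?T. scalar (c (h w)) * xy_monomial w) = res ?T v"
          unfolding res_eq_sum[OF fin] by (intro sum.cong refl) (simp add: c_def the_inv_into_f_f[OF inj])
        then have "V.lincomb c (h ` ?T) = coset ?N (res ?T v)"
          using lin[OF subset_refl fin, of c] by simp
        also have "\<dots> = x"
        proof -
          have "res ?T v - v \<in> ?N"
            unfolding supported_def using supportedD[OF v(1)] by auto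
          then show ?thesis using v(2) coset_eq_iff[OF N] by blast
        qed
        finally have "x = V.lincomb c (h ` ?T)" by simp
        then show "x \<in> V.span (h ` ?T)"
          unfolding V.span_def using fin by (intro CollectI exI[of _ c] exI[of _ "h ` ?T"]) (auto simp: K)
      qed
    qed
  qed
  then have "V.dim = card (h ` ?T)"
    using fin by (intro V.dim_basis) auto
  then show ?thesis
    using card_image[OF inj] by simp
qed

lemma monomial_power_ideals:
  "ideal_pow IR mm l \<subseteq> supported (exps_pow l) \<and> (\<forall>u\<in>exps_pow l. xy_monomial u \<in> ideal_pow IR mm l)"
proof (induction l)
  case 0
  then show ?case by (auto simp: RR_def intro: supported_xy_monomial)
next
  case (Suc l)
  have "f \<in> supported (exps_pow (Suc l))" if "f \<in> ideal_prod IR mm (ideal_pow IR mm l)" for f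
    using that
  proof (induction f rule: ideal_prod.induct)
    case (prod i j)
    then have "i \<in> supported invariant_exps" "j \<in> supported (exps_pow l)"
      using Suc mm_eq_supported by auto
    then have "i * j \<in> supported (exps_pow (Suc l))"
      by (rule supported_mult) (rule exps_pow_SucI)
    then show ?case by simp
  next
    case (sum s1 s2)
    then show ?case using supported_add by simp
  qed
  moreover have "xy_monomial w \<in> ideal_prod IR mm (ideal_pow IR mm l)" if w: "w \<in> exps_pow (Suc l)" for w
  proof -
    from w obtain u v where uv: "w = u + v" "u \<in> invariant_exps" "v \<in> exps_pow l"
      by (rule exps_pow_SucE)
    have "xy_monomial u \<in> mm" using uv(2) mm_eq_supported supported_xy_monomial by blast
    from ideal_prod.prod[OF this, of "xy_monomial v" "ideal_pow IR mm l" IR] show ?thesis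
      using Suc uv by (simp add: xy_monomial_add)
  qed
  ultimately show ?case by auto
qed

lemma exps_closed_exps_pow: "exps_closed (exps_pow l)"
  unfolding exps_closed_def using exps_pow_add by blast

lemma exps_closed_exps_pow_class: "exps_closed (exps_pow_class l t)"
  unfolding exps_closed_def using exps_pow_class_add by blast

lemma mm_power_smult: "ideal_smult IR (ideal_pow IR mm l) (M t) = supported (exps_pow_class l t)"
  unfolding exps_pow_class_def
  using ideal_smult_monomial[OF exps_pow_subset exps_closed_exps_pow] monomial_power_ideals[of l] by blast

lemma mm_smult: "ideal_smult IR mm (M t) = supported (exps_pow_class 1 t)"
proof -
  have eq: "invariant_exps = exps_pow 1"
  proof (intro equalityI subsetI)
    fix u assume u: "u \<in> invariant_exps"
    show "u \<in> exps_pow 1"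
      using exps_pow_SucI[OF u, of 0 0] zero_in_weight_class by simp
  next
    fix w assume "w \<in> exps_pow 1"
    from this[unfolded One_nat_def] obtain u v where uv: "w = u + v" "u \<in> invariant_exps" "v \<in> exps_pow 0"
      by (rule exps_pow_SucE)
    then have "w \<in> weight_class 0" using weight_class_0_add by (simp add: invariant_exps_def)
    moreover have "w \<noteq> 0" using uv(1,2) by (auto simp: invariant_exps_def prod_eq_iff)
    ultimately show "w \<in> invariant_exps" by (simp add: invariant_exps_def)
  qed
  show ?thesis
    unfolding exps_pow_class_def
  proof (rule ideal_smult_monomial[OF exps_pow_subset exps_closed_exps_pow])
    show "mm \<subseteq> supported (exps_pow 1)" unfolding mm_eq_supported eq by (rule subset_refl)
    show "\<And>u. u \<in> exps_pow 1 \<Longrightarrow> xy_monomial u \<in> mm"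
      unfolding mm_eq_supported eq by (rule supported_xy_monomial)
  qed
qed

lemma num_generators_M:
  assumes "finite (min_gens t)"
  shows "num_generators scalar IR (M t) = card (min_gens t)"
  unfolding num_generators_def max_ideal_IR mm_smult min_gens_eq
  using assms unfolding min_gens_eq
  by (intro dim_quo exps_pow_class_subset exps_closed_exps_pow_class exps_closed_weight_class)

end

locale cyclic_quotient_hj = cyclic_quotient n a z + hj_vertices n a e vx vy
  for n a :: nat and z :: "'k::field" and e :: nat and vx vy :: "nat \<Rightarrow> nat"
begin

lemma multiplicity_M: "multiplicity_max IR (M t) = real e"
proof -
  have "module_length IR (quot_module (M t) (ideal_smult IR (ideal_pow IR mm l) (M t))) =
      enat (card (colength_set l t))" for l
  proof -
    have fin: "finite (weight_class t - exps_pow_class l t)"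
      using colength_upper[of l t] by (simp add: colength_set_def)
    show ?thesis
      unfolding mm_power_smult colength_set_def
      by (rule module_length_quo[OF exps_pow_class_subset exps_closed_exps_pow_class
            exps_closed_weight_class fin])
  qed
  then have "multiplicity_max IR (M t) = lim (\<lambda>l. 2 * real (card (colength_set l t)) / real l ^ 2)"
    by (simp add: multiplicity_max_def krull_dim_IR max_ideal_IR)
  also have "\<dots> = real e"
    by (rule limI[OF colength_limit])
  finally show ?thesis .
qed

lemma ulrich_iff: "ulrich scalar IR (semi_invariants n a z t) \<longleftrightarrow> card (min_gens t) = e"
  unfolding ulrich_def semi_invariants_eq
  using M_maximal_cohen_macaulay multiplicity_M num_generators_M[OF finite_min_gens] by simp

end

section \<open>The Ulrich modules among the modules of semi-invariants\<close>

theorem corollary1p4: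
  fixes n a :: nat and \<zeta> :: "'k::alg_closed_field"
  assumes "1 \<le> a" and "a \<le> n - 1" and "coprime a n"
    and "of_nat n \<noteq> (0::'k)"
    and "primitive_root_of_unity n \<zeta>"
  shows "(\<forall>t\<in>{0..int n - 1}.
            ulrich scalar (invariant_ring \<zeta> a) (semi_invariants n a \<zeta> t) \<longrightarrow>
            int n - int a \<le> t \<and> t \<le> int n - 1) \<and>
         ulrich scalar (invariant_ring \<zeta> a) (semi_invariants n a \<zeta> (int n - 1)) \<and>
         ulrich scalar (invariant_ring \<zeta> a) (semi_invariants n a \<zeta> (int n - int a))"
proof -
  interpret cyclic_quotient n a \<zeta>
    using assms by unfold_locales auto
  obtain e vx vy where "hj_chain e vx vy" "0 < e" "vx 0 = n" "vy 0 = 0" "vx 1 = n - a" "vy 1 = 1"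
    using hj_chain_exists by blast
  then interpret cyclic_quotient_hj n a \<zeta> e vx vy
    by unfold_locales
  show ?thesis
    unfolding ulrich_iff
    using card_min_gens_n_minus_1 card_min_gens_n_minus_a card_min_gens_lower by auto
qed

end
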